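(* Let $N$ be a tensor network of tree-factorable tensors such that $|\mathcal{F}(N)| \leq 3$, and suppose the structure graph $G$ of $N$ has a branch decomposition $T$ of width $w \geq 1$. Then one can construct in polynomial time a tensor network $M$ and a contraction tree $S$ for $M$ such that $\text{max-rank}(S) \leq \lceil 4w/3 \rceil$ and $N$ is a partial contraction of $M$.
   Context: Each index $i$ (element of a fixed set $\mathbf{Ind}$) has a finite domain $[i]$; for $I \subseteq \mathbf{Ind}$, $[I]$ is the set of assignments mapping each $i \in I$ to an element of $[i]$. A tensor $A$ over a finite index set $\mathcal{I}(A)$ is a function $A: [\mathcal{I}(A)] \to \mathbb{R}$; its rank is $|\mathcal{I}(A)|$. A tensor network $N$ is a nonempty set of tensors in which no index appears in more than two tensors; $\mathcal{F}(N)$ (free indices) are the indices appearing in exactly one tensor and $\mathcal{B}(N)$ (bond indices) those appearing in two. The contraction of $N$ is the tensor $\mathcal{T}(N)$ with indices $\mathcal{F}(N)$ given by $\mathcal{T}(N)(\tau) = \sum_{\rho \in [\mathcal{B}(N)]} \prod_{A \in N} A((\rho \cup \tau)|_{\mathcal{I}(A)})$. A tensor network $N'$ is a partial contraction of a tensor network $N$ if there is a surjective function $f: N \to N'$ such that $\mathcal{T}(f^{-1}(A)) = A$ for every $A \in N'$. Graphs may have multiple edges between two vertices; each edge has exactly two endpoints. The structure graph of a tensor network $N$ is the graph with vertex set $N \cup \{z\}$ ($z$ a fresh "free vertex") and edge set $\mathcal{B}(N) \cup \mathcal{F}(N)$, where the edges incident to $z$ are exactly $\mathcal{F}(N)$ and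 the edges incident to each $A \in N$ are exactly $\mathcal{I}(A)$ (so a bond index joins the two tensors containing it, and a free index joins its tensor to $z$). A tree is a simple connected acyclic graph; an unrooted binary tree is a tree in which every vertex has degree 1 or 3. A rooted binary tree is a tree that is a single vertex or in which every vertex has degree 1 or 3 except one vertex (the root) of degree 2. For an edge $a$ of a tree $T$, deleting $a$ splits the leaves $\mathcal{L}(T)$ into two parts; $C_a$ denotes one of them. A branch decomposition of a graph $G$ with nonempty edge set is an unrooted binary tree $T$ whose leaves are exactly the edges of $G$; its width is $\max_{a \in \mathcal{E}(T)} |V(C_a) \cap V(\mathcal{E}(G) \setminus C_a)|$, where $V(E)$ denotes the set of endpoints of edges in $E$. A tensor $A$ is tree-factorable if for every tree $T'$ whose leaves are $\mathcal{I}(A)$ there is a tensor network $N_A$ and a bijection $g_A: \mathcal{V}(T') \to N_A$ such that $A = \mathcal{T}(N_A)$ and: (i) $g_A$ is a graph isomorphism between $T'$ and the structure graph of $N_A$ with the free vertex removed; (ii) for every index $i$ of $A$, $i$ is an index of $g_A(i)$; (iii) for some index $i$ of $A$, every $j \in \mathcal{B}(N_A)$ satisfies $|[j]| \leq |[i]|$. A contraction tree for a tensor network $M$ is a rooted binary tree $S$ whose leaves are the tensors of $M$. For each vertex $n$ of $S$, let $L_n$ be the set of leaf tensors in the subtree rooted at $n$; the max-rank of $S$ is $\max_{n} |\mathcal{F}(L_n)|$, i.e. the maximum rank of the intermediate tensors $\mathcal{T}(L_n)$ computed when contracting $M$ recursively along $S$ (contracting the results of the two immediate subtrees at each internal ve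rtex).
   Formalization: For w = 1 the bound is 3 instead of 2 if |F(N)| = 3 or some tensor has rank at least 3 (the printed bound fails there); Ind has infinitely many indices of each domain size; the polynomial time covers the factoring trees and S, M being built from any given factorizations along them. *)

theory Defs
  imports Complex_Main "HOL-Library.FuncSet" "HOL-Computational_Algebra.Polynomial"
begin

section \<open>Tensors and tensor networks\<close>

text \<open>
  Indices are the elements of a type \<open>'i\<close>; a function \<open>D :: 'i \<Rightarrow> 'd set\<close> gives the domain of
  every index. The assignments of a set of indices are the extensional functions in \<open>PiE I D\<close>.
\<close>

datatype ('i, 'd) tensor = Tensor (inds: "'i set") (entry: "('i \<Rightarrow> 'd) \<Rightarrow> real")

text \<open>Extensionality of the entry function makes HOL equality of tensors over \<open>D\<close> the
  mathematical one.\<close>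

definition tensor_over :: "('i \<Rightarrow> 'd set) \<Rightarrow> ('i, 'd) tensor \<Rightarrow> bool" where
  "tensor_over D A \<longleftrightarrow> finite (inds A) \<and> entry A \<in> extensional (PiE (inds A) D)"

definition carriers :: "('i, 'd) tensor set \<Rightarrow> 'i \<Rightarrow> ('i, 'd) tensor set" where
  "carriers N i = {A \<in> N. i \<in> inds A}"

definition tensor_network :: "('i \<Rightarrow> 'd set) \<Rightarrow> ('i, 'd) tensor set \<Rightarrow> bool" where
  "tensor_network D N \<longleftrightarrow>
     finite N \<and> N \<noteq> {} \<and> (\<forall>A\<in>N. tensor_over D A) \<and> (\<forall>i. card (carriers N i) \<le> 2)"

definition free_inds :: "('i, 'd) tensor set \<Rightarrow> 'i set" where
  "free_inds N = {i. card (carriers N i) = 1}"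

definition bond_inds :: "('i, 'd) tensor set \<Rightarrow> 'i set" where
  "bond_inds N = {i. card (carriers N i) = 2}"

definition contraction :: "('i \<Rightarrow> 'd set) \<Rightarrow> ('i, 'd) tensor set \<Rightarrow> ('i, 'd) tensor" where
  "contraction D N = Tensor (free_inds N)
     (restrict
       (\<lambda>\<tau>. \<Sum>\<rho>\<in>PiE (bond_inds N) D.
              \<Prod>A\<in>N. entry A (restrict (\<lambda>i. if i \<in> bond_inds N then \<rho> i else \<tau> i) (inds A)))
       (PiE (free_inds N) D))"

definition partial_contraction ::
  "('i \<Rightarrow> 'd set) \<Rightarrow> ('i, 'd) tensor set \<Rightarrow> ('i, 'd) tensor set \<Rightarrow> bool" where
  "partial_contraction D N' N \<longleftrightarrow> tensor_network D N' \<and> tensor_network D N \<and>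
     (\<exists>f. f ` N = N' \<and> (\<forall>A\<in>N'. contraction D {B \<in> N. f B = A} = A))"

section \<open>Multigraphs, trees and branch decompositions\<close>

record ('v, 'e) graph =
  verts :: "'v set"
  edges :: "'e set"
  ends :: "'e \<Rightarrow> 'v set"

definition wf_graph :: "('v, 'e) graph \<Rightarrow> bool" where
  "wf_graph G \<longleftrightarrow> finite (verts G) \<and> finite (edges G) \<and>
     (\<forall>e\<in>edges G. ends G e \<subseteq> verts G \<and> card (ends G e) = 2)"

definition incident :: "('v, 'e) graph \<Rightarrow> 'v \<Rightarrow> 'e set" where
  "incident G v = {e \<in> edges G. v \<in> ends G e}"

abbreviation degree :: "('v, 'e) graph \<Rightarrow> 'v \<Rightarrow> nat" where
  "degree G v \<equiv> card (incident G v)"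

definition endpoints :: "('v, 'e) graph \<Rightarrow> 'e set \<Rightarrow> 'v set" where
  "endpoints G E = (\<Union>e\<in>E. ends G e)"

definition delete_vertex :: "('v, 'e) graph \<Rightarrow> 'v \<Rightarrow> ('v, 'e) graph" where
  "delete_vertex G v = \<lparr>verts = verts G - {v}, edges = {e \<in> edges G. v \<notin> ends G e}, ends = ends G\<rparr>"

definition delete_edge :: "('v, 'e) graph \<Rightarrow> 'e \<Rightarrow> ('v, 'e) graph" where
  "delete_edge G a = \<lparr>verts = verts G, edges = edges G - {a}, ends = ends G\<rparr>"

definition reachable :: "('v, 'e) graph \<Rightarrow> ('v \<times> 'v) set" where
  "reachable G = {(u, v). \<exists>e\<in>edges G. ends G e = {u, v}}\<^sup>*"

text \<open>A cycle is given by its list \<open>vs\<close> of vertices and its list \<open>es\<close> of edges; \<open>es ! k\<close> joins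
  \<open>vs ! k\<close> to \<open>vs ! (k + 1)\<close>.\<close>

definition is_cycle :: "('v, 'e) graph \<Rightarrow> 'v list \<Rightarrow> 'e list \<Rightarrow> bool" where
  "is_cycle G vs es \<longleftrightarrow> es \<noteq> [] \<and> length vs = length es + 1 \<and> set es \<subseteq> edges G \<and>
     (\<forall>k<length es. ends G (es ! k) = {vs ! k, vs ! (k + 1)}) \<and>
     hd vs = last vs \<and> distinct es \<and> distinct (tl vs)"

definition tree :: "('v, 'e) graph \<Rightarrow> bool" where
  "tree T \<longleftrightarrow> wf_graph T \<and> verts T \<noteq> {} \<and> inj_on (ends T) (edges T) \<and>
     (\<forall>u\<in>verts T. \<forall>v\<in>verts T. (u, v) \<in> reachable T) \<and> (\<nexists>vs es. is_cycle T vs es)"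

text \<open>The single vertex of a one-vertex tree counts as a leaf.\<close>

definition leaves :: "('v, 'e) graph \<Rightarrow> 'v set" where
  "leaves T = {v \<in> verts T. degree T v \<le> 1}"

definition unrooted_binary_tree :: "('v, 'e) graph \<Rightarrow> bool" where
  "unrooted_binary_tree T \<longleftrightarrow> tree T \<and> (\<forall>v\<in>verts T. degree T v \<in> {1, 3})"

text \<open>
  Trees whose leaves are the elements of a set \<open>L :: 'a set\<close> have vertices in \<open>'a + nat\<close>, the leaves
  being exactly \<open>Inl ` L\<close>. Every finite tree whose leaves are \<open>L\<close> is of this form up to the
  names of the other vertices and of the edges.
\<close>

type_synonym 'a leaf_tree = "('a + nat, nat) graph"

definition branch_decomposition :: "('v, 'a) graph \<Rightarrow> 'a leaf_tree \<Rightarrow> bool" where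
  "branch_decomposition G T \<longleftrightarrow>
     wf_graph G \<and> edges G \<noteq> {} \<and> unrooted_binary_tree T \<and> leaves T = Inl ` edges G"

text \<open>The part of the leaves on the side of the vertex \<open>u\<close> after deleting the edge \<open>a\<close>.\<close>

definition cut_side :: "'a leaf_tree \<Rightarrow> nat \<Rightarrow> 'a + nat \<Rightarrow> 'a set" where
  "cut_side T a u = {x. Inl x \<in> leaves T \<and> (u, Inl x) \<in> reachable (delete_edge T a)}"

text \<open>Both sides of every edge are included; they contribute the same value.\<close>

definition branch_width :: "('v, 'a) graph \<Rightarrow> 'a leaf_tree \<Rightarrow> nat" where
  "branch_width G T = Max {card (endpoints G C \<inter> endpoints G (edges G - C)) | C a u.
     a \<in> edges T \<and> u \<in> ends T a \<and> C = cut_side T a u}"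

section \<open>Structure graphs and tree-factorable tensors\<close>

text \<open>\<open>None\<close> is the free vertex.\<close>

definition structure_graph :: "('i, 'd) tensor set \<Rightarrow> (('i, 'd) tensor option, 'i) graph" where
  "structure_graph N =
     \<lparr>verts = insert None (Some ` N),
      edges = bond_inds N \<union> free_inds N,
      ends = (\<lambda>i. Some ` carriers N i \<union> (if i \<in> free_inds N then {None} else {}))\<rparr>"

definition graph_iso :: "('u \<Rightarrow> 'v) \<Rightarrow> ('u, 'e) graph \<Rightarrow> ('v, 'f) graph \<Rightarrow> bool" where
  "graph_iso g G H \<longleftrightarrow> bij_betw g (verts G) (verts H) \<and>
     (\<exists>h. bij_betw h (edges G) (edges H) \<and> (\<forall>e\<in>edges G. ends H (h e) = g ` ends G e))"

text \<open>The network \<open>NA\<close> and the bijection \<open>g\<close> factor the tensor \<open>A\<close> along the tree \<open>T'\<close>.\<close>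

definition tree_factorization ::
  "('i \<Rightarrow> 'd set) \<Rightarrow> ('i, 'd) tensor \<Rightarrow> 'i leaf_tree \<Rightarrow> ('i, 'd) tensor set \<Rightarrow>
   ('i + nat \<Rightarrow> ('i, 'd) tensor) \<Rightarrow> bool" where
  "tree_factorization D A T' NA g \<longleftrightarrow>
     tensor_network D NA \<and> bij_betw g (verts T') NA \<and> A = contraction D NA \<and>
     graph_iso (\<lambda>v. Some (g v)) T' (delete_vertex (structure_graph NA) None) \<and>
     (\<forall>i\<in>inds A. i \<in> inds (g (Inl i))) \<and>
     (\<exists>i\<in>inds A. \<forall>j\<in>bond_inds NA. card (D j) \<le> card (D i))"

definition tree_factorable :: "('i \<Rightarrow> 'd set) \<Rightarrow> ('i, 'd) tensor \<Rightarrow> bool" where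
  "tree_factorable D A \<longleftrightarrow>
     (\<forall>T'. tree T' \<and> leaves T' = Inl ` inds A \<longrightarrow> (\<exists>NA g. tree_factorization D A T' NA g))"

section \<open>Contraction trees\<close>

text \<open>Rooted binary trees with labelled leaves; the order of the two children is irrelevant in
  everything below.\<close>

datatype 'a btree = Leaf 'a | Node "'a btree" "'a btree"

fun leaf_list :: "'a btree \<Rightarrow> 'a list" where
  "leaf_list (Leaf a) = [a]"
| "leaf_list (Node l r) = leaf_list l @ leaf_list r"

fun subtrees :: "'a btree \<Rightarrow> 'a btree set" where
  "subtrees (Leaf a) = {Leaf a}"
| "subtrees (Node l r) = insert (Node l r) (subtrees l \<union> subtrees r)"

definition contraction_tree :: "('i, 'd) tensor set \<Rightarrow> ('i, 'd) tensor btree \<Rightarrow> bool" where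
  "contraction_tree M S \<longleftrightarrow> distinct (leaf_list S) \<and> set (leaf_list S) = M"

definition max_rank :: "('i, 'd) tensor btree \<Rightarrow> nat" where
  "max_rank S = Max ((\<lambda>U. card (free_inds (set (leaf_list U)))) ` subtrees S)"

section \<open>A model of computation\<close>

text \<open>
  Programs are built from combinators and transform binary trees without labels. Every construct
  is charged at least the size of the value it is applied to, that is, values are copied and never shared.
  So a run with cost \<open>t\<close> only produces values of size at most \<open>t\<close> (lemma \<open>vsize_le_cost\<close>), and
  every single step is simulated by a Turing machine in time polynomial in its cost.
\<close>

datatype data = Null | Cell data data

fun vsize :: "data \<Rightarrow> nat" where
  "vsize Null = 1"
| "vsize (Cell x y) = 1 + vsize x + vsize y"

fun left :: "data \<Rightarrow> data" where
  "left Null = Null"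
| "left (Cell x y) = x"

fun right :: "data \<Rightarrow> data" where
  "right Null = Null"
| "right (Cell x y) = y"

datatype prog =
    Ident
  | Empty
  | Left
  | Right
  | Equal
  | Pair prog prog
  | Seq prog prog
  | Cond prog prog prog
  | While prog prog

text \<open>\<open>runs P x t y\<close>: on input \<open>x\<close> the program \<open>P\<close> stops with output \<open>y\<close> and cost \<open>t\<close>.\<close>

inductive runs :: "prog \<Rightarrow> data \<Rightarrow> nat \<Rightarrow> data \<Rightarrow> bool" where
  Ident: "runs Ident x (vsize x) x"
| Empty: "runs Empty x (vsize x) Null"
| Left: "runs Left x (vsize x) (left x)"
| Right: "runs Right x (vsize x) (right x)"
| Equal: "runs Equal x (vsize x + 2) (if left x = right x then Cell Null Null else Null)"
| Pair: "runs p x s y \<Longrightarrow> runs q x t z \<Longrightarrow> runs (Pair p q) x (vsize x + s + t) (Cell y z)"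
| Seq: "runs p x s y \<Longrightarrow> runs q y t z \<Longrightarrow> runs (Seq p q) x (vsize x + s + t) z"
| Cond_true: "runs b x s c \<Longrightarrow> c \<noteq> Null \<Longrightarrow> runs p x t y \<Longrightarrow>
    runs (Cond b p q) x (vsize x + s + t) y"
| Cond_false: "runs b x s Null \<Longrightarrow> runs q x t y \<Longrightarrow> runs (Cond b p q) x (vsize x + s + t) y"
| While_false: "runs b x s Null \<Longrightarrow> runs (While b p) x (vsize x + s) x"
| While_true: "runs b x s c \<Longrightarrow> c \<noteq> Null \<Longrightarrow> runs p x t y \<Longrightarrow> runs (While b p) y u z \<Longrightarrow>
    runs (While b p) x (vsize x + s + t + u) z"

lemma vsize_pos: "0 < vsize x"
  by (cases x) auto

lemma vsize_le_cost: "runs p x t y \<Longrightarrow> vsize y \<le> t"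
proof (induction rule: runs.induct)
  case (Empty x)
  then show ?case using vsize_pos[of x] by simp
next
  case (Left x)
  then show ?case by (cases x) auto
next
  case (Right x)
  then show ?case by (cases x) auto
next
  case (Equal x)
  then show ?case using vsize_pos[of x] by simp
next
  case (Pair p x s y q t z)
  then show ?case using vsize_pos[of x] by simp
qed auto

inductive_cases runs_IdentE: "runs Ident x t y"
inductive_cases runs_EmptyE: "runs Empty x t y"
inductive_cases runs_LeftE: "runs Left x t y"
inductive_cases runs_RightE: "runs Right x t y"
inductive_cases runs_EqualE: "runs Equal x t y"
inductive_cases runs_PairE: "runs (Pair p q) x t y"
inductive_cases runs_SeqE: "runs (Seq p q) x t y"
inductive_cases runs_CondE: "runs (Cond b p q) x t y"
inductive_cases runs_WhileE: "runs (While b p) x t y"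

lemma runs_deterministic:
  "runs p x t y \<Longrightarrow> runs p x t' y' \<Longrightarrow> t = t' \<and> y = y'"
proof (induction arbitrary: t' y' rule: runs.induct)
  case (Pair p x s y q t z)
  from Pair.prems show ?case by (rule runs_PairE) (use Pair.IH in blast)
next
  case (Seq p x s y q t z)
  from Seq.prems show ?case by (rule runs_SeqE) (use Seq.IH in blast)
next
  case (Cond_true b x s c p t y q)
  from Cond_true.prems show ?case
    by (rule runs_CondE) (use Cond_true.IH Cond_true.hyps in blast)+
next
  case (Cond_false b x s q t y p)
  from Cond_false.prems show ?case by (rule runs_CondE) (use Cond_false.IH in blast)+
next
  case (While_false b x s p)
  from While_false.prems show ?case by (rule runs_WhileE) (use While_false.IH in blast)+
next
  case (While_true b x s c p t y u z)
  from While_true.prems show ?case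
    by (rule runs_WhileE) (use While_true.IH While_true.hyps in blast)+
qed (auto elim: runs_IdentE runs_EmptyE runs_LeftE runs_RightE runs_EqualE)

section \<open>Encodings\<close>

text \<open>
  The tensors, the indices and the vertices of trees enter an encoding through names, which are
  arbitrary pairwise different values. The size of an encoding counts the tensors, indices,
  vertices and edges (with their names), and not the entries of the tensors.
\<close>

fun list_code :: "data list \<Rightarrow> data" where
  "list_code [] = Null"
| "list_code (x # xs) = Cell x (list_code xs)"

definition graph_code :: "('v \<Rightarrow> data) \<Rightarrow> ('v, 'e) graph \<Rightarrow> data \<Rightarrow> bool" where
  "graph_code \<nu> G x \<longleftrightarrow> (\<exists>vs es ps.
     distinct vs \<and> set vs = verts G \<and> distinct es \<and> set es = edges G \<and>
     map (ends G) es = map (\<lambda>(u, v). {u, v}) ps \<and>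
     x = Cell (list_code (map \<nu> vs)) (list_code (map (\<lambda>(u, v). Cell (\<nu> u) (\<nu> v)) ps)))"

text \<open>The list of the pairs of the name of a tensor and the list of the names of its indices.\<close>

definition network_code ::
  "(('i, 'd) tensor \<Rightarrow> data) \<Rightarrow> ('i \<Rightarrow> data) \<Rightarrow> ('i, 'd) tensor set \<Rightarrow> data \<Rightarrow> bool" where
  "network_code \<mu> \<nu> N x \<longleftrightarrow> (\<exists>As is.
     distinct As \<and> set As = N \<and> (\<forall>A\<in>N. distinct (is A) \<and> set (is A) = inds A) \<and>
     x = list_code (map (\<lambda>A. Cell (\<mu> A) (list_code (map \<nu> (is A)))) As))"

text \<open>An instance is a network \<open>N\<close> with a tree \<open>T\<close> whose leaves are the indices of \<open>N\<close>; leaf and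
  index share their name.\<close>

definition instance_code ::
  "(('i, 'd) tensor \<Rightarrow> data) \<Rightarrow> ('i + nat \<Rightarrow> data) \<Rightarrow>
   ('i, 'd) tensor set \<Rightarrow> 'i leaf_tree \<Rightarrow> data \<Rightarrow> bool" where
  "instance_code \<mu> \<nu> N T x \<longleftrightarrow> inj_on \<mu> N \<and> inj_on \<nu> (verts T) \<and>
     (\<exists>y z. network_code \<mu> (\<nu> \<circ> Inl) N y \<and> graph_code \<nu> T z \<and> x = Cell y z)"

fun btree_code :: "('a \<Rightarrow> data) \<Rightarrow> 'a btree \<Rightarrow> data" where
  "btree_code \<kappa> (Leaf a) = Cell Null (\<kappa> a)"
| "btree_code \<kappa> (Node l r) = Cell (Cell Null Null) (Cell (btree_code \<kappa> l) (btree_code \<kappa> r))"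

section \<open>Networks obtained by factoring every tensor along a tree\<close>

text \<open>
  Being tree-factorable asserts that factorizations exist and says nothing about finding them
  (the entries are arbitrary reals). So what is computed is a plan: for every tensor \<open>A\<close> of \<open>N\<close> a tree \<open>Ts A\<close>
  along which it is to be factored, and a rooted binary tree \<open>R\<close> whose leaves are the pairs
  \<open>(A, v)\<close> of a tensor \<open>A\<close> and a vertex \<open>v\<close> of \<open>Ts A\<close>. Any factorizations \<open>g A\<close> along the trees
  \<open>Ts A\<close> turn a plan into a network and a binary tree of its tensors.
\<close>

definition plan_code ::
  "(('i, 'd) tensor \<Rightarrow> data) \<Rightarrow> ('i + nat \<Rightarrow> data) \<Rightarrow> ('i, 'd) tensor set \<Rightarrow>
   (('i, 'd) tensor \<Rightarrow> 'i leaf_tree) \<Rightarrow> (('i, 'd) tensor \<times> ('i + nat)) btree \<Rightarrow> data \<Rightarrow> bool" where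
  "plan_code \<mu> \<nu> N Ts R y \<longleftrightarrow> (\<exists>As cs \<nu>s.
     distinct As \<and> set As = N \<and>
     (\<forall>A\<in>N. inj_on (\<nu>s A) (verts (Ts A)) \<and> (\<forall>i\<in>inds A. \<nu>s A (Inl i) = \<nu> (Inl i)) \<and>
            graph_code (\<nu>s A) (Ts A) (cs A)) \<and>
     y = Cell (list_code (map (\<lambda>A. Cell (\<mu> A) (cs A)) As))
              (btree_code (\<lambda>(A, v). Cell (\<mu> A) (\<nu>s A v)) R))"

text \<open>
  A tensor without indices cannot be factored along a tree and is kept as it is, with a
  one-vertex tree. The indices introduced for different tensors have to be different.
\<close>

definition factors_along ::
  "('i \<Rightarrow> 'd set) \<Rightarrow> ('i, 'd) tensor set \<Rightarrow> (('i, 'd) tensor \<Rightarrow> 'i leaf_tree) \<Rightarrow>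
   (('i, 'd) tensor \<Rightarrow> 'i + nat \<Rightarrow> ('i, 'd) tensor) \<Rightarrow> bool" where
  "factors_along D N Ts g \<longleftrightarrow>
     (\<forall>A\<in>N. tree (Ts A) \<and>
        (if inds A = {} then (\<exists>v. verts (Ts A) = {v} \<and> g A v = A)
         else leaves (Ts A) = Inl ` inds A \<and>
              tree_factorization D A (Ts A) (g A ` verts (Ts A)) (g A))) \<and>
     (\<forall>A\<in>N. \<forall>B\<in>N. bond_inds (g A ` verts (Ts A)) \<inter> inds B = {}) \<and>
     (\<forall>A\<in>N. \<forall>B\<in>N. A \<noteq> B \<longrightarrow>
        bond_inds (g A ` verts (Ts A)) \<inter> bond_inds (g B ` verts (Ts B)) = {})"

definition factored_network ::
  "('i, 'd) tensor set \<Rightarrow> (('i, 'd) tensor \<Rightarrow> 'i leaf_tree) \<Rightarrow>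
   (('i, 'd) tensor \<Rightarrow> 'i + nat \<Rightarrow> ('i, 'd) tensor) \<Rightarrow> ('i, 'd) tensor set" where
  "factored_network N Ts g = (\<Union>A\<in>N. g A ` verts (Ts A))"

definition factored_tree ::
  "(('i, 'd) tensor \<times> ('i + nat)) btree \<Rightarrow>
   (('i, 'd) tensor \<Rightarrow> 'i + nat \<Rightarrow> ('i, 'd) tensor) \<Rightarrow> ('i, 'd) tensor btree" where
  "factored_tree R g = map_btree (\<lambda>(A, v). g A v) R"

end

theory Submission
  imports Defs
begin

text \<open>
  The branch decomposition \<open>T\<close> is contracted cherry by cherry: two leaves with a common neighbour \<open>n\<close> are
  merged into \<open>n\<close>, until two vertices are left. Every tensor \<open>A\<close> is factored along the subgraph of the
  arcs of \<open>T\<close> that separate two indices of \<open>A\<close>, so the number of bond indices over an arc is at most its width.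
  At \<open>n\<close> at most \<open>w\<close> tensors have a piece with three arcs. These pieces are split evenly into three parts:
  the first is contracted into the left child, the second into the right child and the third after the
  children have been contracted with each other. All intermediate ranks are then at most
  \<open>w + \<lceil>w / 3\<rceil> = \<lceil>4 w / 3\<rceil>\<close>.

  A free index costs one more index in the rank, which is paid for by the free vertex \<open>z\<close> as long as \<open>z\<close> has
  edges on both sides. A cherry is therefore called good if its two subtrees do not both contain a
  free index and do not contain all of them. If no cherry is good, then \<open>T\<close> has become a star with three leaves, each
  with one free index. The merged subtree then has rank one too high, but now \<open>z\<close> is on every arc, so at most
  \<open>w - 1\<close> tensors have three arcs and the third part has at most \<open>\<lceil>w / 3\<rceil> - 1\<close> pieces.
\<close>


section \<open>Polynomial time\<close>

text \<open>The program sees names only. \<open>rk\<close> counts, for a set of pieces, the pairs of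
  a tensor and an arc with one end inside, and this bounds the rank for every later choice of
  factorizations. A piece at \<open>n\<close> that misses one of the three arcs only swaps open
  indices when it is absorbed. A piece with all three arcs costs one extra index: in the left child,
  in the right child, or, if it is held back, when the two children meet. Three equal parts balance
  these three places, which gives the summand \<open>\<lceil>w / 3\<rceil>\<close>. The value 3 for
  \<open>w = 1\<close> arises because \<open>\<lceil>4 w / 3\<rceil>\<close> is then 2, whereas a
  piece with three arcs and a network with three free indices have rank 3. Two obstacles shape the
  rest. A loop stays polynomial if each round adds an amount that does not depend on the
  accumulator, for every value of the accumulator; the state and its updates are built for that. And
  tree-factorability leaves the names of bond indices open, so they are renamed to fresh indices
  with domains of the same size.\<close>

class enc =
  fixes enc :: "'a \<Rightarrow> data"
  assumes enc_inject: "enc x = enc y \<Longrightarrow> x = y"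

lemma enc_eq_iff [simp]: "enc x = enc y \<longleftrightarrow> x = y"
  using enc_inject by blast

instantiation data :: enc
begin
definition enc_data :: "data \<Rightarrow> data" where "enc_data x = x"
instance by standard (simp add: enc_data_def)
end

text \<open>\<open>False\<close> is \<open>Null\<close> and \<open>True\<close> is not, so an
  encoded Boolean can steer \<open>Cond\<close> directly.\<close>

instantiation bool :: enc
begin
definition enc_bool :: "bool \<Rightarrow> data" where "enc_bool b = (if b then Cell Null Null else Null)"
instance by standard (simp add: enc_bool_def split: if_splits)
end

instantiation prod :: (enc, enc) enc
begin
definition enc_prod :: "'a \<times> 'b \<Rightarrow> data" where "enc_prod p = Cell (enc (fst p)) (enc (snd p))"
instance by standard (simp add: enc_prod_def prod_eq_iff)
end

lemma list_code_inject: "list_code xs = list_code ys \<Longrightarrow> xs = ys"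
proof (induction xs arbitrary: ys)
  case Nil
  then show ?case by (cases ys) auto
next
  case (Cons a xs)
  then show ?case by (cases ys) auto
qed

text \<open>Pairs, lists and binary trees use the very codes of the input and output formats
  (\<open>Cell\<close>, \<open>list_code\<close>, \<open>btree_code\<close>), so the typed functions
  below act on the prescribed codes themselves.\<close>

instantiation list :: (enc) enc
begin
definition enc_list :: "'a list \<Rightarrow> data" where "enc_list xs = list_code (map enc xs)"
instance
proof
  fix x y :: "'a list"
  assume "enc x = enc y"
  then have "map enc x = map enc y" by (simp add: enc_list_def list_code_inject)
  moreover have "inj (enc :: 'a \<Rightarrow> data)" by (simp add: inj_def)
  ultimately show "x = y" by (simp add: inj_map_eq_map)
qed
end

instantiation btree :: (enc) enc
begin
definition enc_btree :: "'a btree \<Rightarrow> data" where "enc_btree t = btree_code enc t"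
instance
proof
  fix x y :: "'a btree"
  show "enc x = enc y \<Longrightarrow> x = y"
    unfolding enc_btree_def
  proof (induction x arbitrary: y)
    case (Leaf a)
    then show ?case by (cases y) auto
  next
    case (Node l r)
    then show ?case by (cases y) auto
  qed
qed
end

lemma enc_Pair [simp]: "enc (x, y) = Cell (enc x) (enc y)"
  by (simp add: enc_prod_def)

lemma enc_Nil [simp]: "enc [] = Null"
  by (simp add: enc_list_def)

lemma enc_Cons [simp]: "enc (x # xs) = Cell (enc x) (enc xs)"
  by (simp add: enc_list_def)

lemma enc_Leaf [simp]: "enc (Leaf a) = Cell Null (enc a)"
  by (simp add: enc_btree_def)

lemma enc_Node [simp]: "enc (Node l r) = Cell (Cell Null Null) (Cell (enc l) (enc r))"
  by (simp add: enc_btree_def)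

lemma enc_True [simp]: "enc True = Cell Null Null" and enc_False [simp]: "enc False = Null"
  by (simp_all add: enc_bool_def)

abbreviation esize :: "'a::enc \<Rightarrow> nat" where "esize x \<equiv> vsize (enc x)"

lemma esize_pos [simp]: "Suc 0 \<le> esize x"
  using vsize_pos[of "enc x"] by simp

text \<open>Cost bounds are polynomials over \<open>nat\<close>: without negative coefficients they
  are monotone, so one bound can be substituted into another.\<close>

lemma poly_nat_mono: "x \<le> y \<Longrightarrow> poly (p :: nat poly) x \<le> poly p y"
  by (induction p) (auto intro!: add_mono mult_mono)

text \<open>One program must respect the bound on the code of every value of the type, also on
  values that encode no instance. So the functions below are total, and their size bounds cannot
  rely on invariants of a run.\<close>

definition ptime :: "('a::enc \<Rightarrow> 'b::enc) \<Rightarrow> bool" where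
  "ptime f \<longleftrightarrow> (\<exists>P (q :: nat poly). \<forall>x. \<exists>t. runs P (enc x) t (enc (f x)) \<and> t \<le> poly q (esize x))"

lemma ptimeI:
  assumes "\<And>x. \<exists>t. runs P (enc x) t (enc (f x)) \<and> t \<le> poly q (esize x)"
  shows "ptime f"
  using assms unfolding ptime_def by blast

lemma ptimeE:
  assumes "ptime f"
  obtains P and q :: "nat poly" where
    "\<And>x. \<exists>t. runs P (enc x) t (enc (f x)) \<and> t \<le> poly q (esize x)"
  using assms unfolding ptime_def by blast

lemma ptime_esize:
  assumes "ptime f"
  obtains q :: "nat poly" where "\<And>x. esize (f x) \<le> poly q (esize x)"
proof -
  obtain P and q :: "nat poly" where
    *: "\<And>x. \<exists>t. runs P (enc x) t (enc (f x)) \<and> t \<le> poly q (esize x)"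
    by (rule ptimeE[OF assms]) blast
  have "esize (f x) \<le> poly q (esize x)" for x
    using *[of x] vsize_le_cost by (meson order_trans)
  then show ?thesis by (rule that)
qed

named_theorems ptime_intros

lemma ptime_id [ptime_intros]: "ptime (\<lambda>x. x)"
  by (rule ptimeI[where P = Ident and q = "[:0, 1:]"]) (auto intro: runs.intros)

lemma const_prog: "\<exists>P. \<forall>x. \<exists>t. runs P x t c \<and> t \<le> vsize c * vsize x * 2"
proof (induction c)
  case Null
  show ?case by (rule exI[of _ Empty]) (auto intro!: runs.intros exI)
next
  case (Cell c d)
  then obtain P Q where P: "\<And>x. \<exists>t. runs P x t c \<and> t \<le> vsize c * vsize x * 2"
    and Q: "\<And>x. \<exists>t. runs Q x t d \<and> t \<le> vsize d * vsize x * 2" by blast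
  show ?case
  proof (intro exI[of _ "Pair P Q"] allI)
    fix x
    obtain s t where "runs P x s c" "s \<le> vsize c * vsize x * 2" "runs Q x t d" "t \<le> vsize d * vsize x * 2"
      using P Q by meson
    then show "\<exists>t. runs (Pair P Q) x t (Cell c d) \<and> t \<le> vsize (Cell c d) * vsize x * 2"
      by (intro exI[of _ "vsize x + s + t"] conjI runs.Pair) (auto simp: algebra_simps)
  qed
qed

lemma ptime_const [ptime_intros]: "ptime (\<lambda>x. c)"
proof -
  obtain P where "\<And>x. \<exists>t. runs P x t (enc c) \<and> t \<le> esize c * vsize x * 2"
    using const_prog[of "enc c"] by blast
  then show ?thesis
    by (intro ptimeI[where P = P and q = "[:0, esize c * 2:]"]) (simp add: algebra_simps)
qed

text \<open>The second program is charged for the intermediate value, whose size is at most the cost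
  of the first program; hence the composed polynomial.\<close>

lemma ptime_comp:
  assumes "ptime g" "ptime f"
  shows "ptime (\<lambda>x. g (f x))"
proof -
  obtain P and p :: "nat poly" where
    P: "\<And>x. \<exists>t. runs P (enc x) t (enc (f x)) \<and> t \<le> poly p (esize x)" by (rule ptimeE[OF assms(2)]) blast
  obtain Q and q :: "nat poly" where
    Q: "\<And>x. \<exists>t. runs Q (enc x) t (enc (g x)) \<and> t \<le> poly q (esize x)" by (rule ptimeE[OF assms(1)]) blast
  show ?thesis
  proof (rule ptimeI[where P = "Seq P Q" and q = "[:0, 1:] + p + pcompose q p"])
    fix x
    obtain s where s: "runs P (enc x) s (enc (f x))" "s \<le> poly p (esize x)" using P by blast
    obtain t where t: "runs Q (enc (f x)) t (enc (g (f x)))" "t \<le> poly q (esize (f x))" using Q by blast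
    have "esize (f x) \<le> poly p (esize x)" using vsize_le_cost[OF s(1)] s(2) by simp
    then have "t \<le> poly q (poly p (esize x))" using t(2) poly_nat_mono order_trans by blast
    then show "\<exists>t. runs (Seq P Q) (enc x) t (enc (g (f x))) \<and>
        t \<le> poly ([:0, 1:] + p + pcompose q p) (esize x)"
      using runs.Seq[OF s(1) t(1)] s(2) by (auto simp: poly_pcompose)
  qed
qed

lemma ptime_Pair [ptime_intros]:
  assumes "ptime f" "ptime g"
  shows "ptime (\<lambda>x. (f x, g x))"
proof -
  obtain P and p :: "nat poly" where
    P: "\<And>x. \<exists>t. runs P (enc x) t (enc (f x)) \<and> t \<le> poly p (esize x)" by (rule ptimeE[OF assms(1)]) blast
  obtain Q and q :: "nat poly" where
    Q: "\<And>x. \<exists>t. runs Q (enc x) t (enc (g x)) \<and> t \<le> poly q (esize x)" by (rule ptimeE[OF assms(2)]) blast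
  show ?thesis
  proof (rule ptimeI[where P = "Pair P Q" and q = "[:0, 1:] + p + q"])
    fix x
    obtain s where s: "runs P (enc x) s (enc (f x))" "s \<le> poly p (esize x)" using P by blast
    obtain t where t: "runs Q (enc x) t (enc (g x))" "t \<le> poly q (esize x)" using Q by blast
    show "\<exists>t. runs (Pair P Q) (enc x) t (enc (f x, g x)) \<and> t \<le> poly ([:0, 1:] + p + q) (esize x)"
      using runs.Pair[OF s(1) t(1)] s(2) t(2) by auto
  qed
qed

lemma ptime_if [ptime_intros]:
  assumes "ptime b" "ptime f" "ptime g"
  shows "ptime (\<lambda>x. if b x then f x else g x)"
proof -
  obtain B and b' :: "nat poly" where
    B: "\<And>x. \<exists>t. runs B (enc x) t (enc (b x)) \<and> t \<le> poly b' (esize x)" by (rule ptimeE[OF assms(1)]) blast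
  obtain P and p :: "nat poly" where
    P: "\<And>x. \<exists>t. runs P (enc x) t (enc (f x)) \<and> t \<le> poly p (esize x)" by (rule ptimeE[OF assms(2)]) blast
  obtain Q and q :: "nat poly" where
    Q: "\<And>x. \<exists>t. runs Q (enc x) t (enc (g x)) \<and> t \<le> poly q (esize x)" by (rule ptimeE[OF assms(3)]) blast
  show ?thesis
  proof (rule ptimeI[where P = "Cond B P Q" and q = "[:0, 1:] + b' + p + q"])
    fix x
    obtain r where r: "runs B (enc x) r (enc (b x))" "r \<le> poly b' (esize x)" using B by blast
    obtain s where s: "runs P (enc x) s (enc (f x))" "s \<le> poly p (esize x)" using P by blast
    obtain t where t: "runs Q (enc x) t (enc (g x))" "t \<le> poly q (esize x)" using Q by blast
    show "\<exists>t. runs (Cond B P Q) (enc x) t (enc (if b x then f x else g x)) \<and>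
        t \<le> poly ([:0, 1:] + b' + p + q) (esize x)"
    proof (cases "b x")
      case True
      then show ?thesis using runs.Cond_true[OF r(1) _ s(1), of Q] r(2) s(2) by auto
    next
      case False
      then show ?thesis using runs.Cond_false[OF _ t(1)] r t(2) by fastforce
    qed
  qed
qed

lemma ptime_prim:
  assumes "\<And>x. runs P (enc x) (esize x + k) (enc (f x))"
  shows "ptime f"
  by (rule ptimeI[where P = P and q = "[:k, 1:]"]) (use assms in \<open>auto simp: add.commute\<close>)

lemma ptime_fst [ptime_intros]: "ptime f \<Longrightarrow> ptime (\<lambda>x. fst (f x))"
  by (rule ptime_comp[OF ptime_prim[where P = Left and k = 0]]) (auto simp: enc_prod_def intro: runs.Left[where x = "Cell x y" for x y, simplified])

lemma ptime_snd [ptime_intros]: "ptime f \<Longrightarrow> ptime (\<lambda>x. snd (f x))"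
  by (rule ptime_comp[OF ptime_prim[where P = Right and k = 0]]) (auto simp: enc_prod_def intro: runs.Right[where x = "Cell x y" for x y, simplified])

text \<open>\<open>Equal\<close> compares raw data; by injectivity of \<open>enc\<close> this
  decides equality of the typed values.\<close>

lemma ptime_eq [ptime_intros]:
  assumes "ptime f" "ptime g"
  shows "ptime (\<lambda>x. f x = g x)"
proof -
  have "ptime (\<lambda>p. fst p = (snd p :: 'b))"
  proof (rule ptime_prim[where P = Equal and k = 2])
    show "runs Equal (enc p) (esize p + 2) (enc (fst p = snd p))" for p :: "'b \<times> 'b"
      using runs.Equal[of "enc p"] by (simp add: enc_prod_def enc_bool_def)
  qed
  then show ?thesis using ptime_comp[OF _ ptime_Pair[OF assms]] by fastforce
qed

lemma ptime_not [ptime_intros]: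
  assumes "ptime b"
  shows "ptime (\<lambda>x. \<not> b x)"
proof -
  have "ptime (\<lambda>x. if b x then False else True)" by (intro ptime_intros assms)
  also have "(\<lambda>x. if b x then False else True) = (\<lambda>x. \<not> b x)" by auto
  finally show ?thesis .
qed

lemma ptime_conj [ptime_intros]:
  assumes "ptime b" "ptime c"
  shows "ptime (\<lambda>x. b x \<and> c x)"
proof -
  have "ptime (\<lambda>x. if b x then c x else False)" by (intro ptime_intros assms)
  also have "(\<lambda>x. if b x then c x else False) = (\<lambda>x. b x \<and> c x)" by auto
  finally show ?thesis .
qed

lemma ptime_disj [ptime_intros]:
  assumes "ptime b" "ptime c"
  shows "ptime (\<lambda>x. b x \<or> c x)"
proof -
  have "ptime (\<lambda>x. if b x then True else c x)" by (intro ptime_intros assms)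
  also have "(\<lambda>x. if b x then True else c x) = (\<lambda>x. b x \<or> c x)" by auto
  finally show ?thesis .
qed

lemma ptime_Cons [ptime_intros]: "ptime f \<Longrightarrow> ptime g \<Longrightarrow> ptime (\<lambda>x. f x # g x)"
  using ptime_Pair[of f g] by (simp add: ptime_def)

lemma ptime_Leaf [ptime_intros]: "ptime f \<Longrightarrow> ptime (\<lambda>x. Leaf (f x))"
  using ptime_Pair[OF ptime_const[of Null], of f] by (simp add: ptime_def enc_data_def)

lemma ptime_Node [ptime_intros]:
  "ptime f \<Longrightarrow> ptime g \<Longrightarrow> ptime (\<lambda>x. Node (f x) (g x))"
  using ptime_Pair[OF ptime_const[of "Cell Null Null"] ptime_Pair[of f g]]
  by (simp add: ptime_def enc_data_def)

text \<open>A nonempty list has the same code as the pair of its head and its tail, so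
  \<open>Pair Ident L\<close> already produces the environment \<open>(x, h, t)\<close> of the
  second branch. The empty list is \<open>Null\<close>, which \<open>Cond\<close> tests.\<close>

lemma ptime_case_list [ptime_intros]:
  assumes "ptime l" "ptime a" "ptime (\<lambda>p. b (fst p) (fst (snd p)) (snd (snd p)))"
  shows "ptime (\<lambda>x. case l x of [] \<Rightarrow> a x | h # t \<Rightarrow> b x h t)"
proof -
  obtain L and l' :: "nat poly" where
    L: "\<And>x. \<exists>t. runs L (enc x) t (enc (l x)) \<and> t \<le> poly l' (esize x)" by (rule ptimeE[OF assms(1)]) blast
  obtain P and p :: "nat poly" where
    P: "\<And>x. \<exists>t. runs P (enc x) t (enc (a x)) \<and> t \<le> poly p (esize x)" by (rule ptimeE[OF assms(2)]) blast
  obtain Q and q :: "nat poly" where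
    Q: "\<And>y. \<exists>t. runs Q (enc y) t (enc (b (fst y) (fst (snd y)) (snd (snd y)))) \<and> t \<le> poly q (esize y)"
    by (rule ptimeE[OF assms(3)]) blast
  let ?r = "[:1, 1:] + l'"
  show ?thesis
  proof (rule ptimeI[where P = "Cond L (Seq (Pair Ident L) Q) P" and
        q = "[:0, 4:] + l' + l' + p + pcompose q ?r"])
    fix x
    obtain r where r: "runs L (enc x) r (enc (l x))" "r \<le> poly l' (esize x)" using L by blast
    show "\<exists>t. runs (Cond L (Seq (Pair Ident L) Q) P) (enc x) t
        (enc (case l x of [] \<Rightarrow> a x | h # t \<Rightarrow> b x h t)) \<and>
        t \<le> poly ([:0, 4:] + l' + l' + p + pcompose q ?r) (esize x)"
    proof (cases "l x")
      case Nil
      obtain s where s: "runs P (enc x) s (enc (a x))" "s \<le> poly p (esize x)" using P by blast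
      show ?thesis using runs.Cond_false[of L "enc x" r P s] r s Nil by fastforce
    next
      case (Cons h t)
      obtain s where s: "runs Q (enc (x, h, t)) s (enc (b x h t))" "s \<le> poly q (esize (x, h, t))"
        using Q[of "(x, h, t)"] by auto
      have "esize (x, h, t) = 1 + esize x + esize (l x)" using Cons by simp
      also have "\<dots> \<le> poly ?r (esize x)" using vsize_le_cost[OF r(1)] r(2) by simp
      finally have "s \<le> poly q (poly ?r (esize x))" using s(2) poly_nat_mono order_trans by blast
      moreover have "runs (Seq (Pair Ident L) Q) (enc x) (esize x + (esize x + esize x + r) + s) (enc (b x h t))"
        using runs.Seq[OF runs.Pair[OF runs.Ident r(1)], of Q s] s(1) Cons by simp
      then have "runs (Cond L (Seq (Pair Ident L) Q) P) (enc x)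
          (esize x + r + (esize x + (esize x + esize x + r) + s)) (enc (b x h t))"
        using runs.Cond_true[OF r(1)] Cons by simp
      ultimately show ?thesis using r(2) Cons
        by (intro exI conjI) (auto simp: poly_pcompose)
    qed
  qed
qed

text \<open>A program for the body of a loop over a list: the value is
  \<open>Cell x (Cell s l)\<close> with the environment \<open>x\<close>, the accumulator \<open>s\<close> and the remaining list \<open>l\<close>.\<close>

lemma fold_loop:
  fixes f :: "'x::enc \<Rightarrow> 's::enc \<Rightarrow> 'a::enc \<Rightarrow> 's" and F :: prog and q :: "nat poly"
  defines "B \<equiv> Pair Left (Pair (Seq (Pair Left (Pair (Seq Right Left) (Seq Right (Seq Right Left)))) F)
                  (Seq Right (Seq Right Right)))"
  assumes F: "\<And>x s a. \<exists>t. runs F (enc (x, s, a)) t (enc (f x s a)) \<and> t \<le> poly q (esize (x, s, a))"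
    and size: "\<And>pre. \<exists>suf. as = pre @ suf \<Longrightarrow> esize (foldl (f x) s pre) \<le> m"
    and m: "esize x + esize as + 2 \<le> m"
  shows "\<exists>t. runs (While (Seq Right Right) B) (enc (x, s, as)) t (enc (x, foldl (f x) s as, [] :: 'a list)) \<and>
             t \<le> (length as + 1) * (60 * m + poly q (2 * m))"
  using size m
proof (induction as arbitrary: s)
  case Nil
  have "esize s \<le> m" using Nil.prems(1)[of "[]"] by simp
  then have *: "esize (x, s, [] :: 'a list) \<le> 2 * m" using Nil.prems(2) by simp
  have "\<exists>t. runs (Seq Right Right) (enc (x, s, [] :: 'a list)) t Null \<and> t \<le> 3 * esize (x, s, [] :: 'a list)"
    using runs.Seq[OF runs.Right[of "enc (x, s, [] :: 'a list)"] runs.Right]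
    by (intro exI conjI) (simp, simp)
  then obtain t where t: "runs (Seq Right Right) (enc (x, s, [] :: 'a list)) t Null"
    "t \<le> 3 * esize (x, s, [] :: 'a list)" by blast
  have "runs (While (Seq Right Right) B) (enc (x, s, [] :: 'a list))
      (esize (x, s, [] :: 'a list) + t) (enc (x, s, [] :: 'a list))"
    by (rule runs.While_false[OF t(1)])
  then show ?case using * t(2) by (intro exI conjI) (simp, simp)
next
  case (Cons a as)
  let ?y = "enc (x, s, a # as)"
  have s: "esize s \<le> m" using Cons.prems(1)[of "[]"] by simp
  have y: "vsize ?y \<le> 2 * m" using s Cons.prems(2) by simp
  obtain t where t: "runs F (enc (x, s, a)) t (enc (f x s a))" "t \<le> poly q (esize (x, s, a))" using F by blast
  have "esize (x, s, a) \<le> 2 * m" using y by simp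
  then have t2: "t \<le> poly q (2 * m)" using t(2) poly_nat_mono order_trans by blast
  have fs: "esize (f x s a) \<le> m" using Cons.prems(1)[of "[a]"] by simp
  have L: "runs Left ?y (vsize ?y) (enc x)" using runs.Left[of ?y] by simp
  have R: "runs Right ?y (vsize ?y) (enc (s, a # as))" using runs.Right[of ?y] by simp
  have RL: "runs (Seq Right Left) ?y (vsize ?y + vsize ?y + esize (s, a # as)) (enc s)"
    using runs.Seq[OF R runs.Left] by simp
  have R2: "runs Right (enc (s, a # as)) (esize (s, a # as)) (enc (a # as))"
    using runs.Right[of "enc (s, a # as)"] by simp
  have RR: "runs (Seq Right Right) ?y (vsize ?y + vsize ?y + esize (s, a # as)) (enc (a # as))"
    using runs.Seq[OF R R2] by simp
  have RRL: "runs (Seq Right (Seq Right Left)) ?y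
      (vsize ?y + vsize ?y + (esize (s, a # as) + esize (s, a # as) + esize (a # as))) (enc a)"
    using runs.Seq[OF R runs.Seq[OF R2 runs.Left]] by simp
  have RRR: "runs (Seq Right (Seq Right Right)) ?y
      (vsize ?y + vsize ?y + (esize (s, a # as) + esize (s, a # as) + esize (a # as))) (enc as)"
    using runs.Seq[OF R runs.Seq[OF R2 runs.Right]] by simp
  obtain u where u: "runs (Pair Left (Pair (Seq Right Left) (Seq Right (Seq Right Left)))) ?y u (enc (x, s, a))"
    "u \<le> 11 * vsize ?y"
    using runs.Pair[OF L runs.Pair[OF RL RRL]] by fastforce
  obtain v where v: "runs B ?y v (enc (x, f x s a, as))" "v \<le> 19 * vsize ?y + t + vsize ?y"
    using runs.Pair[OF L runs.Pair[OF runs.Seq[OF u(1) t(1)] RRR]] u(2) unfolding B_def by fastforce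
  have "esize x + esize as + 2 \<le> m" using Cons.prems(2) by simp
  moreover have "esize (foldl (f x) (f x s a) pre) \<le> m" if "\<exists>suf. as = pre @ suf" for pre
    using Cons.prems(1)[of "a # pre"] that by simp
  ultimately obtain w where w: "runs (While (Seq Right Right) B) (enc (x, f x s a, as)) w
      (enc (x, foldl (f x) (f x s a) as, [] :: 'a list))"
    "w \<le> (length as + 1) * (60 * m + poly q (2 * m))" using Cons.IH[of "f x s a"] by blast
  have "runs (While (Seq Right Right) B) ?y
     (vsize ?y + (vsize ?y + vsize ?y + esize (s, a # as)) + v + w) (enc (x, foldl (f x) (f x s a) as, [] :: 'a list))"
    using runs.While_true[OF RR _ v(1) w(1)] by simp
  \<comment> \<open>Apart from the call of \<open>F\<close>, one round costs at most 24 times the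
    size of the loop value, which is at most \<open>2 * m\<close>; the factor 60 leaves
    room.\<close>
  moreover have "vsize ?y + (vsize ?y + vsize ?y + esize (s, a # as)) + v \<le> 60 * m + poly q (2 * m)"
    using v(2) t2 y by simp
  ultimately show ?case using w(2) by (intro exI conjI) (assumption | simp)+
qed

lemma length_le_esize: "length xs < esize xs"
  by (induction xs) auto

lemma esize_append: "esize (xs @ ys) + 1 = esize xs + esize ys"
  by (induction xs) auto

lemma esize_mem: "x \<in> set xs \<Longrightarrow> esize x < esize xs"
  by (induction xs) auto

text \<open>The growth bound is additive and free of \<open>s\<close>. A round that could double the
  accumulator would allow exponential size; here the size after all rounds is at most its initial
  value plus the number of rounds times a polynomial of the input.\<close>

lemma ptime_foldl:
  fixes f :: "'x::enc \<Rightarrow> 's::enc \<Rightarrow> 'a::enc \<Rightarrow> 's"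
  assumes f: "ptime (\<lambda>p. f (fst p) (fst (snd p)) (snd (snd p)))"
    and growth: "\<And>x s a. esize (f x s a) \<le> esize s + poly k (esize x + esize a)"
    and s: "ptime s" and l: "ptime l"
  shows "ptime (\<lambda>x. foldl (f x) (s x) (l x))"
proof -
  obtain F and q :: "nat poly" where
    F: "\<And>y. \<exists>t. runs F (enc y) t (enc (f (fst y) (fst (snd y)) (snd (snd y)))) \<and> t \<le> poly q (esize y)"
    by (rule ptimeE[OF f]) blast
  define B where "B = Pair Left (Pair (Seq (Pair Left (Pair (Seq Right Left) (Seq Right (Seq Right Left)))) F)
                  (Seq Right (Seq Right Right)))"
  \<comment> \<open>The initial values fit into \<open>2 * n + 2\<close> for input size
    \<open>n\<close>, and at most \<open>n\<close> rounds add \<open>poly k n\<close> each.\<close>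
  define M :: "nat poly" where "M = [:2, 2:] + [:0, 1:] * k"
  have loop: "ptime (\<lambda>y. (fst y, foldl (f (fst y)) (fst (snd y)) (snd (snd y)), [] :: 'a list))"
  proof (rule ptimeI[where P = "While (Seq Right Right) B" and
        q = "[:1, 1:] * ([:60:] * M + pcompose q ([:2:] * M))"])
    fix y :: "'x \<times> 's \<times> 'a list"
    obtain x s as where y: "y = (x, s, as)" by (cases y)
    let ?n = "esize y" let ?m = "poly M ?n"
    have m: "?m = 2 + 2 * ?n + ?n * poly k ?n" by (simp add: M_def)
    have grow: "esize (foldl (f x) s pre) \<le> esize s + length pre * poly k ?n"
      if "set pre \<subseteq> set as" for pre
      using that
    proof (induction pre rule: rev_induct)
      case Nil
      then show ?case by simp
    next
      case (snoc a pre)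
      have "esize x + esize a \<le> ?n" using esize_mem[of a as] snoc.prems y by simp
      then have "poly k (esize x + esize a) \<le> poly k ?n" by (rule poly_nat_mono)
      then show ?case using snoc growth[of x "foldl (f x) s pre" a] by simp
    qed
    have "\<exists>t. runs (While (Seq Right Right) B) (enc (x, s, as)) t (enc (x, foldl (f x) s as, [] :: 'a list)) \<and>
             t \<le> (length as + 1) * (60 * ?m + poly q (2 * ?m))"
      unfolding B_def
    proof (rule fold_loop)
      show "\<exists>t. runs F (enc (x, s, a)) t (enc (f x s a)) \<and> t \<le> poly q (esize (x, s, a))" for x s a
        using F[of "(x, s, a)"] by simp
      show "esize x + esize as + 2 \<le> ?m" unfolding m using y by simp
      fix pre assume "\<exists>suf. as = pre @ suf"
      then obtain suf where suf: "as = pre @ suf" by blast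
      have "length pre \<le> ?n" using length_le_esize[of as] suf y by simp
      then have "length pre * poly k ?n \<le> ?n * poly k ?n" by (rule mult_le_mono1)
      then show "esize (foldl (f x) s pre) \<le> ?m" using grow[of pre] suf y unfolding m by simp
    qed
    then obtain t where t: "runs (While (Seq Right Right) B) (enc y) t (enc (x, foldl (f x) s as, [] :: 'a list))"
      "t \<le> (length as + 1) * (60 * ?m + poly q (2 * ?m))" unfolding y by blast
    have "length as + 1 \<le> ?n + 1" using length_le_esize[of as] y by simp
    then have "t \<le> (?n + 1) * (60 * ?m + poly q (2 * ?m))" using t(2) mult_le_mono1 order_trans by blast
    then show "\<exists>t. runs (While (Seq Right Right) B) (enc y) t
        (enc (fst y, foldl (f (fst y)) (fst (snd y)) (snd (snd y)), [] :: 'a list)) \<and>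
        t \<le> poly ([:1, 1:] * ([:60:] * M + pcompose q ([:2:] * M))) ?n"
      using t(1) y by (auto simp: poly_pcompose)
  qed
  have "ptime (\<lambda>x. (x, s x, l x))" by (intro ptime_intros s l)
  from ptime_fst[OF ptime_snd[OF ptime_comp[OF loop this]]] show ?thesis by simp
qed

section \<open>List operations as folds that push onto the accumulator, hence the reversals\<close>

lemma foldl_rebuild:
  "foldl (\<lambda>s a. a # s) s l = rev l @ s"
  "foldl (\<lambda>s a. g a # s) u l = rev (map g l) @ u"
  "foldl (\<lambda>s a. if P a then a # s else s) s l = rev (filter P l) @ s"
  "foldl (@) t ls = t @ concat ls"
  proof -
  show "foldl (\<lambda>s a. a # s) s l = rev l @ s" by (induction l arbitrary: s) auto
  show "foldl (\<lambda>s a. g a # s) u l = rev (map g l) @ u" by (induction l arbitrary: u) auto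
  show "foldl (\<lambda>s a. if P a then a # s else s) s l = rev (filter P l) @ s"
    by (induction l arbitrary: s) auto
  show "foldl (@) t ls = t @ concat ls" by (induction ls arbitrary: t) auto
qed

lemma ptime_rev [ptime_intros]:
  assumes "ptime l"
  shows "ptime (\<lambda>x. rev (l x))"
proof -
  have "ptime (\<lambda>x. foldl (\<lambda>s a. a # s) [] (l x))"
    by (rule ptime_foldl[where k = "[:1, 1:]"]) (intro ptime_intros assms | simp)+
  then show ?thesis by (simp add: foldl_rebuild)
qed

lemma ptime_append [ptime_intros]:
  assumes "ptime l" "ptime m"
  shows "ptime (\<lambda>x. l x @ m x)"
proof -
  have "ptime (\<lambda>x. foldl (\<lambda>s a. a # s) (m x) (rev (l x)))"
    by (rule ptime_foldl[where k = "[:1, 1:]"]) (intro ptime_intros assms | simp)+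
  then show ?thesis by (simp add: foldl_rebuild)
qed

lemma ptime_map [ptime_intros]:
  assumes f: "ptime (\<lambda>p. f (fst p) (snd p))" and l: "ptime l"
  shows "ptime (\<lambda>x. map (f x) (l x))"
proof -
  obtain q :: "nat poly" where q: "\<And>p. esize (f (fst p) (snd p)) \<le> poly q (esize p)"
    using ptime_esize[OF f] by blast
  have "ptime (\<lambda>x. rev (foldl (\<lambda>s a. f x a # s) [] (l x)))"
  proof (rule ptime_rev, rule ptime_foldl[where k = "1 + pcompose q [:1, 1:]"])
    show "ptime (\<lambda>p. f (fst p) (snd (snd p)) # fst (snd p))"
      using ptime_comp[OF f, of "\<lambda>p. (fst p, snd (snd p))"] by (intro ptime_intros) (simp add: ptime_intros)
    show "esize (f x a # s) \<le> esize s + poly (1 + pcompose q [:1, 1:]) (esize x + esize a)" for x s a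
      using q[of "(x, a)"] by (simp add: poly_pcompose)
  qed (intro ptime_intros l)+
  then show ?thesis by (simp add: foldl_rebuild)
qed

lemma ptime_filter [ptime_intros]:
  assumes P: "ptime (\<lambda>p. P (fst p) (snd p))" and l: "ptime l"
  shows "ptime (\<lambda>x. filter (P x) (l x))"
proof -
  have "ptime (\<lambda>x. rev (foldl (\<lambda>s a. if P x a then a # s else s) [] (l x)))"
  proof (rule ptime_rev, rule ptime_foldl[where k = "[:1, 1:]"])
    show "ptime (\<lambda>p. if P (fst p) (snd (snd p)) then snd (snd p) # fst (snd p) else fst (snd p))"
      using ptime_comp[OF P, of "\<lambda>p. (fst p, snd (snd p))"] by (intro ptime_intros) (simp add: ptime_intros)
  qed (intro ptime_intros l | simp)+
  then show ?thesis by (simp add: foldl_rebuild)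
qed

lemma ptime_concat [ptime_intros]:
  assumes l: "ptime l"
  shows "ptime (\<lambda>x. concat (l x))"
proof -
  have "ptime (\<lambda>x. foldl (\<lambda>s a. s @ a) [] (l x))"
  proof (rule ptime_foldl[where k = "[:0, 1:]"])
    show "esize (s @ a) \<le> esize s + poly [:0, 1:] (esize x + esize a)"
      for s a :: "'b list" and x :: 'a
      using esize_append[of s a] by simp
  qed (intro ptime_intros l)+
  then show ?thesis by (simp add: foldl_rebuild)
qed

lemma ptime_product [ptime_intros]:
  assumes "ptime l" "ptime m"
  shows "ptime (\<lambda>x. List.product (l x) (m x))"
  unfolding product_concat_map
  by (intro ptime_intros assms ptime_comp[OF assms(2)])

lemma ptime_Bex [ptime_intros]:
  assumes P: "ptime (\<lambda>p. P (fst p) (snd p))" and l: "ptime l"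
  shows "ptime (\<lambda>x. \<exists>a\<in>set (l x). P x a)"
proof -
  have "ptime (\<lambda>x. filter (P x) (l x) \<noteq> [])" by (intro ptime_intros assms)
  also have "(\<lambda>x. filter (P x) (l x) \<noteq> []) = (\<lambda>x. \<exists>a\<in>set (l x). P x a)"
    by (auto simp: filter_empty_conv)
  finally show ?thesis .
qed

lemma ptime_mem [ptime_intros]:
  assumes a: "ptime a" and l: "ptime l"
  shows "ptime (\<lambda>x. a x \<in> set (l x))"
proof -
  have "ptime (\<lambda>x. \<exists>b\<in>set (l x). a x = b)" by (intro ptime_intros l ptime_comp[OF a])
  then show ?thesis by simp
qed

lemma ptime_tl [ptime_intros]:
  assumes "ptime l"
  shows "ptime (\<lambda>x. tl (l x))"
proof -
  have "ptime (\<lambda>x. case l x of [] \<Rightarrow> [] | h # t \<Rightarrow> t)" by (intro ptime_intros assms)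
  also have "(\<lambda>x. case l x of [] \<Rightarrow> [] | h # t \<Rightarrow> t) = (\<lambda>x. tl (l x))"
    by (auto split: list.split)
  finally show ?thesis .
qed

lemma ptime_take_1 [ptime_intros]:
  assumes "ptime l"
  shows "ptime (\<lambda>x. take 1 (l x))"
proof -
  have "ptime (\<lambda>x. case l x of [] \<Rightarrow> [] | h # t \<Rightarrow> [h])" by (intro ptime_intros assms)
  also have "(\<lambda>x. case l x of [] \<Rightarrow> [] | h # t \<Rightarrow> [h]) = (\<lambda>x. take 1 (l x))"
    by (auto split: list.split)
  finally show ?thesis .
qed

section \<open>The algorithm\<close>

text \<open>\<open>'a\<close> names tensors and \<open>'n\<close> names tree vertices, where a leaf
  carries the name of its index. A \<open>blob\<close> is a contracted subtree: its root, the leaves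
  in it, and the contraction tree of the pieces inside. A \<open>state\<close> holds the blobs, the
  arcs not yet inside a blob, and the processed arcs, each with the leaves on one side of
  it.\<close>

type_synonym ('a, 'n) net = "('a \<times> 'n list) list"
type_synonym ('a, 'n) blob = "'n \<times> 'n list \<times> ('a \<times> 'n) btree"
type_synonym 'n arc = "'n \<times> 'n"
type_synonym ('a, 'n) state = "('a, 'n) blob list \<times> 'n arc list \<times> ('n arc \<times> 'n list) list"

definition owners :: "('a, 'n) net \<Rightarrow> ('n list \<Rightarrow> bool) \<Rightarrow> 'a list" where
  "owners Ns P = map fst (filter (\<lambda>p. P (snd p)) Ns)"

definition crosses :: "'n list \<Rightarrow> 'n list \<Rightarrow> bool" where
  "crosses js \<beta> \<longleftrightarrow> (\<exists>i\<in>set js. i \<in> set \<beta>) \<and> (\<exists>i\<in>set js. i \<notin> set \<beta>)"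

text \<open>Having exactly one owner is tested by the shape of the list of owners, which avoids
  arithmetic in the program.\<close>

definition frees :: "('a, 'n) net \<Rightarrow> 'n list \<Rightarrow> 'n list" where
  "frees Ns vs = filter (\<lambda>v. owners Ns (\<lambda>js. v \<in> set js) \<noteq> [] \<and> tl (owners Ns (\<lambda>js. v \<in> set js)) = []) vs"

definition joins :: "'n arc \<Rightarrow> 'n \<Rightarrow> 'n \<Rightarrow> bool" where
  "joins e u v \<longleftrightarrow> fst e = u \<and> snd e = v \<or> fst e = v \<and> snd e = u"

definition touches :: "'n arc \<Rightarrow> 'n \<Rightarrow> bool" where
  "touches e u \<longleftrightarrow> fst e = u \<or> snd e = u"

text \<open>A caterpillar: the pieces at \<open>n\<close> are contracted into \<open>X\<close> one
  at a time, so every intermediate result is \<open>X\<close> with some of these pieces.\<close>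

definition absorb :: "'n \<Rightarrow> ('a \<times> 'n) btree \<Rightarrow> 'a list \<Rightarrow> ('a \<times> 'n) btree" where
  "absorb n X as = foldl (\<lambda>Y a. Node Y (Leaf (a, n))) X as"

text \<open>The three parts have almost equal lengths, and the first one is never longer than the others.\<close>

definition split3 :: "'a list \<Rightarrow> 'a list \<times> 'a list \<times> 'a list" where
  "split3 xs = foldl (\<lambda>s x. (fst (snd s), snd (snd s), x # fst s)) ([], [], []) xs"

text \<open>A piece that misses one of the three arcs can be absorbed into a child that shares an
  arc with it without raising the rank; it goes left if it has the left arc, and right otherwise.
  Only the pieces with all three arcs are distributed by \<open>split3\<close>. The shortest part
  \<open>fst s\<close> is the one that waits until the children have been contracted.\<close>

definition merge_tree ::
  "('a, 'n) net \<Rightarrow> 'n \<Rightarrow> 'n list \<Rightarrow> 'n list \<Rightarrow> 'n list \<Rightarrow>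
   ('a \<times> 'n) btree \<Rightarrow> ('a \<times> 'n) btree \<Rightarrow> ('a \<times> 'n) btree" where
  "merge_tree Ns n \<beta> \<gamma> \<delta> X Y =
    (let s = split3 (owners Ns (\<lambda>js. crosses js \<beta> \<and> crosses js \<gamma> \<and> crosses js \<delta>)) in
       absorb n
         (Node (absorb n X (owners Ns (\<lambda>js. crosses js \<beta> \<and> \<not> (crosses js \<gamma> \<and> crosses js \<delta>)) @ fst (snd s)))
               (absorb n Y (owners Ns (\<lambda>js. crosses js \<gamma> \<and> \<not> crosses js \<beta>) @ snd (snd s))))
         (fst s))"

text \<open>Without free indices the two subtrees would trivially contain all of them, hence the
  separate case \<open>F = []\<close>.\<close>

definition good :: "'n list \<Rightarrow> 'n list \<Rightarrow> 'n list \<Rightarrow> bool" where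
  "good F \<beta> \<gamma> \<longleftrightarrow> (\<not> (\<exists>f\<in>set F. f \<in> set \<beta>) \<or> \<not> (\<exists>f\<in>set F. f \<in> set \<gamma>)) \<and>
     (F = [] \<or> (\<exists>f\<in>set F. f \<notin> set \<beta> \<and> f \<notin> set \<gamma>))"

definition cherries :: "'n list \<Rightarrow> ('a, 'n) blob list \<Rightarrow> 'n arc list \<Rightarrow>
    (('a, 'n) blob \<times> ('a, 'n) blob \<times> 'n) list" where
  "cherries vs L es = filter (\<lambda>t. fst (fst t) \<noteq> fst (fst (snd t)) \<and>
      (\<exists>e\<in>set es. joins e (fst (fst t)) (snd (snd t))) \<and>
      (\<exists>e\<in>set es. joins e (fst (fst (snd t))) (snd (snd t)))) (List.product L (List.product L vs))"

text \<open>The arcs come from the input \<open>es\<close> and \<open>\<beta>\<close> is cut down to \<open>vs\<close> so that the output is polynomial in the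
  input for every value of \<open>\<beta>\<close>, also for values that do not occur in a run.\<close>

definition record_arc :: "'n list \<Rightarrow> 'n arc list \<Rightarrow> 'n \<Rightarrow> 'n list \<Rightarrow> 'n \<Rightarrow> ('n arc \<times> 'n list) list" where
  "record_arc vs es u \<beta> v =
     map (\<lambda>e. (e, filter (\<lambda>x. x \<in> set \<beta>) vs)) (filter (\<lambda>e. joins e u v) es)"

definition merge :: "('a, 'n) net \<Rightarrow> 'n list \<Rightarrow> 'n arc list \<Rightarrow> ('a, 'n) state \<Rightarrow>
    ('a, 'n) blob \<times> ('a, 'n) blob \<times> 'n \<Rightarrow> ('a, 'n) state" where
  "merge Ns vs es s t =
    (let b = fst t; c = fst (snd t); n = snd (snd t);
         \<beta> = fst (snd b); \<gamma> = fst (snd c);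
         \<delta> = filter (\<lambda>x. x \<in> set \<beta> \<or> x \<in> set \<gamma>) vs in
      ((n, \<delta>, merge_tree Ns n \<beta> \<gamma> \<delta> (snd (snd b)) (snd (snd c))) #
         filter (\<lambda>d. fst d \<noteq> fst b \<and> fst d \<noteq> fst c) (fst s),
       filter (\<lambda>e. \<not> touches e (fst b) \<and> \<not> touches e (fst c)) (fst (snd s)),
       record_arc vs es (fst b) \<beta> n @ record_arc vs es (fst c) \<gamma> n @ snd (snd s)))"

text \<open>With the good cherries in front of all cherries, the head of the list is a good one if
  there is any and an arbitrary one otherwise. Without a cherry the state is left as it is, so
  surplus steps do no harm.\<close>

definition step :: "('a, 'n) net \<Rightarrow> 'n list \<Rightarrow> 'n arc list \<Rightarrow> ('a, 'n) state \<Rightarrow> ('a, 'n) state" where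
  "step Ns vs es s =
    (let C = cherries vs (fst s) (fst (snd s)) in
      case filter (\<lambda>t. good (frees Ns vs) (fst (snd (fst t))) (fst (snd (fst (snd t))))) C @ C of
        [] \<Rightarrow> s
      | t # _ \<Rightarrow> merge Ns vs es s t)"

text \<open>In a run \<open>v\<close> always has an owner. Elsewhere \<open>undefined\<close> is
  some fixed value, so the function is still in \<open>ptime\<close> as a case distinction with a
  constant branch.\<close>

definition leaf_tree :: "('a, 'n) net \<Rightarrow> 'n \<Rightarrow> ('a \<times> 'n) btree" where
  "leaf_tree Ns v =
    (case owners Ns (\<lambda>js. v \<in> set js) of [] \<Rightarrow> undefined | a # as \<Rightarrow> absorb v (Leaf (a, v)) as)"

definition initial :: "('a, 'n) net \<Rightarrow> 'n list \<Rightarrow> 'n arc list \<Rightarrow> ('a, 'n) state" where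
  "initial Ns vs es =
    (map (\<lambda>v. (v, [v], leaf_tree Ns v)) (filter (\<lambda>v. \<exists>p\<in>set Ns. v \<in> set (snd p)) vs), es, [])"

text \<open>\<open>vs\<close> serves as a counter only: a step removes one blob as long as there are
  more than two, and there are at most \<open>length vs\<close> blobs at the start.\<close>

definition final_state :: "('a, 'n) net \<Rightarrow> 'n list \<Rightarrow> 'n arc list \<Rightarrow> ('a, 'n) state" where
  "final_state Ns vs es = foldl (\<lambda>s _. step Ns vs es s) (initial Ns vs es) vs"

text \<open>The arc between the last two blobs is never consumed by a merge and has to be recorded
  at the end.\<close>

definition closing_arcs :: "'n list \<Rightarrow> 'n arc list \<Rightarrow> ('a, 'n) state \<Rightarrow> ('n arc \<times> 'n list) list" where
  "closing_arcs vs es s =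
    (case fst s of [] \<Rightarrow> [] | b # L \<Rightarrow>
      (case L of [] \<Rightarrow> [] | c # _ \<Rightarrow> record_arc vs es (fst b) (fst (snd b)) (fst c))) @ snd (snd s)"

text \<open>A tensor without indices crosses no arc and lies in no blob, so such tensors are
  contracted last. They sit at the first vertex of \<open>vs\<close>, the one vertex that
  \<open>tensor_tree\<close> gives them.\<close>

definition closing_tree :: "('a, 'n) net \<Rightarrow> 'n list \<Rightarrow> ('a, 'n) state \<Rightarrow> ('a \<times> 'n) btree" where
  "closing_tree Ns vs s =
    (case fst s of [] \<Rightarrow> undefined | b # L \<Rightarrow>
      (case L of [] \<Rightarrow> undefined | c # _ \<Rightarrow>
        (case vs of [] \<Rightarrow> undefined | v # _ \<Rightarrow>
          absorb v (Node (snd (snd b)) (snd (snd c))) (owners Ns (\<lambda>js. js = [])))))"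

text \<open>Every arc was recorded with the leaves on one side, so the tree of a tensor is read off
  without any search in the graph.\<close>

definition crossed_arcs :: "('n arc \<times> 'n list) list \<Rightarrow> 'n list \<Rightarrow> 'n arc list" where
  "crossed_arcs acc js = map fst (filter (\<lambda>q. crosses js (snd q)) acc)"

definition tensor_tree :: "'n list \<Rightarrow> ('n arc \<times> 'n list) list \<Rightarrow> 'n list \<Rightarrow> 'n list \<times> 'n arc list" where
  "tensor_tree vs acc js =
    (if js = [] then take 1 vs
     else filter (\<lambda>v. v \<in> set js \<or> (\<exists>e\<in>set (crossed_arcs acc js). touches e v)) vs,
     crossed_arcs acc js)"

definition plan :: "('a, 'n) net \<times> 'n list \<times> 'n arc list \<Rightarrow>
    ('a \<times> 'n list \<times> 'n arc list) list \<times> ('a \<times> 'n) btree" where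
  "plan x =
    (let s = final_state (fst x) (fst (snd x)) (snd (snd x)) in
      (map (\<lambda>p. (fst p, tensor_tree (fst (snd x)) (closing_arcs (fst (snd x)) (snd (snd x)) s) (snd p))) (fst x),
       closing_tree (fst x) (fst (snd x)) s))"

section \<open>The algorithm runs in polynomial time\<close>

lemma ptime_owners [ptime_intros]:
  assumes "ptime (\<lambda>p. P (fst p) (snd p))" "ptime f"
  shows "ptime (\<lambda>x. owners (f x) (P x))"
  unfolding owners_def
  using ptime_comp[OF assms(1), of "\<lambda>q. (fst q, snd (snd q))"]
  by (intro ptime_intros assms(2)) (simp add: ptime_intros)

text \<open>Under a binder the environment becomes a pair. A function of the outer environment is
  then used through \<open>ptime_comp\<close>, composed with a projection; the same device recurs in
  the following lemmas.\<close>

lemma ptime_crosses [ptime_intros]: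
  assumes "ptime f" "ptime g"
  shows "ptime (\<lambda>x. crosses (f x) (g x))"
  unfolding crosses_def by (intro ptime_intros assms ptime_comp[OF assms(2)])

lemma ptime_frees [ptime_intros]:
  assumes "ptime f" "ptime g"
  shows "ptime (\<lambda>x. frees (f x) (g x))"
  unfolding frees_def by (intro ptime_intros assms ptime_comp[OF assms(1)])

lemma ptime_joins [ptime_intros]:
  assumes "ptime f" "ptime g" "ptime h"
  shows "ptime (\<lambda>x. joins (f x) (g x) (h x))"
  unfolding joins_def by (intro ptime_intros assms)

lemma ptime_touches [ptime_intros]:
  assumes "ptime f" "ptime g"
  shows "ptime (\<lambda>x. touches (f x) (g x))"
  unfolding touches_def by (intro ptime_intros assms)

lemma ptime_absorb [ptime_intros]:
  assumes "ptime n" "ptime X" "ptime as"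
  shows "ptime (\<lambda>x. absorb (n x) (X x) (as x))"
proof -
  obtain q :: "nat poly" where q: "\<And>x. esize (n x) \<le> poly q (esize x)"
    using ptime_esize[OF assms(1)] by blast
  have "poly q (esize x) \<le> poly q (esize x + esize a)" for x :: 'a and a :: 'c
    by (rule poly_nat_mono) simp
  with q have q': "esize (n x) \<le> poly q (esize x + esize a)" for x :: 'a and a :: 'c
    using order_trans by blast
  show ?thesis unfolding absorb_def
  proof (rule ptime_foldl[where k = "[:8, 1:] + q"])
    show "esize (Node s (Leaf (a, n x))) \<le> esize s + poly ([:8, 1:] + q) (esize x + esize a)"
      for x :: 'a and a :: 'c and s
      using q'[of x a] by simp
  qed (intro ptime_intros assms ptime_comp[OF assms(1)])+
qed

lemma ptime_split3 [ptime_intros]: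
  assumes "ptime l"
  shows "ptime (\<lambda>x. split3 (l x))"
  unfolding split3_def
proof (rule ptime_foldl[where k = "[:1, 1:]"])
  show "esize (fst (snd s), snd (snd s), a # fst s) \<le> esize s + poly [:1, 1:] (esize x + esize a)"
    for s :: "'b list \<times> 'b list \<times> 'b list" and a and x :: 'a
    by (cases s) simp
qed (intro ptime_intros assms)+

lemma ptime_merge_tree [ptime_intros]:
  assumes "ptime Ns" "ptime n" "ptime \<beta>" "ptime \<gamma>" "ptime \<delta>" "ptime X" "ptime Y"
  shows "ptime (\<lambda>x. merge_tree (Ns x) (n x) (\<beta> x) (\<gamma> x) (\<delta> x) (X x) (Y x))"
  unfolding merge_tree_def Let_def
  by (intro ptime_intros assms ptime_comp[OF assms(3)] ptime_comp[OF assms(4)] ptime_comp[OF assms(5)])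

lemma ptime_good [ptime_intros]:
  assumes "ptime F" "ptime \<beta>" "ptime \<gamma>"
  shows "ptime (\<lambda>x. good (F x) (\<beta> x) (\<gamma> x))"
  unfolding good_def by (intro ptime_intros assms ptime_comp[OF assms(2)] ptime_comp[OF assms(3)])

lemma ptime_cherries [ptime_intros]:
  assumes "ptime vs" "ptime L" "ptime es"
  shows "ptime (\<lambda>x. cherries (vs x) (L x) (es x))"
  unfolding cherries_def by (intro ptime_intros assms ptime_comp[OF assms(3)])

lemma ptime_record_arc [ptime_intros]:
  assumes "ptime vs" "ptime es" "ptime u" "ptime \<beta>" "ptime v"
  shows "ptime (\<lambda>x. record_arc (vs x) (es x) (u x) (\<beta> x) (v x))"
  unfolding record_arc_def
  by (intro ptime_intros assms ptime_comp[OF assms(1)] ptime_comp[OF assms(3)]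
      ptime_comp[OF assms(4)] ptime_comp[OF ptime_comp[OF assms(4)]] ptime_comp[OF assms(5)])

lemma ptime_merge [ptime_intros]:
  assumes "ptime Ns" "ptime vs" "ptime es" "ptime s" "ptime t"
  shows "ptime (\<lambda>x. merge (Ns x) (vs x) (es x) (s x) (t x))"
  unfolding merge_def Let_def
  by (intro ptime_intros assms ptime_comp[OF assms(5)])

lemma ptime_step [ptime_intros]:
  assumes "ptime Ns" "ptime vs" "ptime es" "ptime s"
  shows "ptime (\<lambda>x. step (Ns x) (vs x) (es x) (s x))"
  unfolding step_def Let_def
  by (intro ptime_intros assms ptime_comp[OF assms(1)] ptime_comp[OF assms(2)]
      ptime_comp[OF assms(3)] ptime_comp[OF assms(4)])

lemma ptime_leaf_tree [ptime_intros]: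
  assumes "ptime Ns" "ptime v"
  shows "ptime (\<lambda>x. leaf_tree (Ns x) (v x))"
  unfolding leaf_tree_def by (intro ptime_intros assms ptime_comp[OF assms(2)])

lemma ptime_initial [ptime_intros]:
  assumes "ptime Ns" "ptime vs" "ptime es"
  shows "ptime (\<lambda>x. initial (Ns x) (vs x) (es x))"
  unfolding initial_def by (intro ptime_intros assms ptime_comp[OF assms(1)])

lemma ptime_closing_arcs [ptime_intros]:
  assumes "ptime vs" "ptime es" "ptime s"
  shows "ptime (\<lambda>x. closing_arcs (vs x) (es x) (s x))"
  unfolding closing_arcs_def
  by (intro ptime_intros assms ptime_comp[OF assms(1)] ptime_comp[OF assms(2)])

lemma ptime_closing_tree [ptime_intros]:
  assumes "ptime Ns" "ptime vs" "ptime s"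
  shows "ptime (\<lambda>x. closing_tree (Ns x) (vs x) (s x))"
  unfolding closing_tree_def
  by (intro ptime_intros assms ptime_comp[OF assms(1)] ptime_comp[OF assms(2)])

lemma ptime_crossed_arcs [ptime_intros]:
  assumes "ptime acc" "ptime js"
  shows "ptime (\<lambda>x. crossed_arcs (acc x) (js x))"
  unfolding crossed_arcs_def by (intro ptime_intros assms ptime_comp[OF assms(2)])

lemma ptime_tensor_tree [ptime_intros]:
  assumes "ptime vs" "ptime acc" "ptime js"
  shows "ptime (\<lambda>x. tensor_tree (vs x) (acc x) (js x))"
  unfolding tensor_tree_def
  by (intro ptime_intros assms ptime_comp[OF assms(2)] ptime_comp[OF assms(3)])

section \<open>Growth of the state in one step, bounded by the input alone\<close>

lemma esize_filter: "esize (filter P l) \<le> esize l"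
  by (induction l) auto

lemma esize_bounded:
  assumes "\<And>a. a \<in> set l \<Longrightarrow> esize a \<le> m"
  shows "esize l \<le> 1 + length l * (1 + m)"
  using assms
proof (induction l)
  case (Cons a l)
  from Cons.prems[of a] have "esize a \<le> m" by simp
  moreover have "esize l \<le> 1 + length l * (1 + m)" using Cons by simp
  ultimately show ?case by simp
qed simp

lemma esize_absorb:
  assumes "\<And>a. a \<in> set as \<Longrightarrow> esize a \<le> m"
  shows "esize (absorb n X as) \<le> esize X + length as * (8 + m + esize n)"
  using assms unfolding absorb_def
proof (induction as rule: rev_induct)
  case (snoc a as)
  from snoc.prems[of a] have "esize a \<le> m" by simp
  moreover have "esize (foldl (\<lambda>Y a. Node Y (Leaf (a, n))) X as) \<le> esize X + length as * (8 + m + esize n)"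
    using snoc by simp
  ultimately show ?case by simp
qed simp

text \<open>The two merged blobs leave the list, and their size pays for their trees, which reappear
  inside the merged blob. This makes the growth of a step independent of the state.\<close>

lemma esize_remove2:
  fixes L :: "('n::enc \<times> 'b::enc) list"
  assumes "b \<in> set L" "c \<in> set L" "fst b \<noteq> fst c"
  shows "esize (filter (\<lambda>d. fst d \<noteq> fst b \<and> fst d \<noteq> fst c) L) + esize b + esize c \<le> esize L"
proof -
  have "esize (filter (\<lambda>d. fst d \<noteq> u) L) + (if b \<in> set L \<and> fst b = u then esize b else 0) \<le> esize L"
    for u and b and L :: "('n \<times> 'b) list"
  proof (induction L)
    case (Cons a L)
    show ?case
    proof (cases "b \<in> set L \<and> fst b = u")
      case True
      then show ?thesis using Cons by auto
    next
      case False
      then show ?thesis using esize_filter[of "\<lambda>d. fst d \<noteq> u" L] by auto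
    qed
  qed simp
  from this[of "fst b" L b] this[of "fst c" "filter (\<lambda>d. fst d \<noteq> fst b) L" c]
  have "esize (filter (\<lambda>d. fst d \<noteq> fst c) (filter (\<lambda>d. fst d \<noteq> fst b) L)) + esize b + esize c \<le> esize L"
    using assms by simp
  moreover have "filter (\<lambda>d. fst d \<noteq> fst c) (filter (\<lambda>d. fst d \<noteq> fst b) L) =
      filter (\<lambda>d. fst d \<noteq> fst b \<and> fst d \<noteq> fst c) L"
    unfolding filter_filter by (rule filter_cong) auto
  ultimately show ?thesis by simp
qed

text \<open>The rotation always extends a shortest component and moves it to the end, so the lengths
  stay sorted and within one of each other.\<close>

lemma split3_props:
  assumes "split3 xs = (k, l, m)"
  shows "set xs = set k \<union> set l \<union> set m" "length xs = length k + length l + length m"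
    "length k \<le> length l" "length l \<le> length m" "length m \<le> length k + 1"
    "distinct xs \<Longrightarrow> distinct (k @ l @ m)"
proof -
  have "set xs = set k \<union> set l \<union> set m \<and> length xs = length k + length l + length m \<and>
    length k \<le> length l \<and> length l \<le> length m \<and> length m \<le> length k + 1 \<and>
    (distinct xs \<longrightarrow> distinct (k @ l @ m))"
    using assms unfolding split3_def
  proof (induction xs arbitrary: k l m rule: rev_induct)
    case (snoc x xs)
    obtain k' l' m' where *: "foldl (\<lambda>s x. (fst (snd s), snd (snd s), x # fst s)) ([], [], []) xs = (k', l', m')"
      using prod_cases3 by blast
    have klm: "k = l'" "l = m'" "m = x # k'" using snoc.prems * by simp_all
    from snoc.IH[OF *] show ?case unfolding klm
      by (intro conjI impI) (simp_all add: ac_simps, blast)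
  qed simp
  then show "set xs = set k \<union> set l \<union> set m" "length xs = length k + length l + length m"
    "length k \<le> length l" "length l \<le> length m" "length m \<le> length k + 1"
    "distinct xs \<Longrightarrow> distinct (k @ l @ m)" by blast+
qed


lemma esize_owners:
  "a \<in> set (owners Ns P) \<Longrightarrow> esize a \<le> esize Ns" "length (owners Ns P) \<le> esize Ns"
proof -
  show "esize a \<le> esize Ns" if a: "a \<in> set (owners Ns P)"
  proof -
    obtain p where p: "p \<in> set Ns" "a = fst p" using a by (auto simp: owners_def)
    have "esize a \<le> esize p" using p(2) by (cases p) simp
    then show ?thesis using esize_mem[OF p(1)] by simp
  qed
  show "length (owners Ns P) \<le> esize Ns"
    using le_trans[OF length_filter_le[of "\<lambda>p. P (snd p)" Ns]] length_le_esize[of Ns]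
    by (simp add: owners_def less_imp_le)
qed

text \<open>At most \<open>3 * N\<close> pieces are absorbed in total, each of them consisting of
  two names of the input and a constant number of cells.\<close>

lemma esize_merge_tree:
  assumes "esize Ns \<le> N" "esize n \<le> N"
  shows "esize (merge_tree Ns n \<beta> \<gamma> \<delta> X Y) \<le> esize X + esize Y + 5 + 3 * N * (8 + 2 * N)"
proof -
  let ?P = "owners Ns (\<lambda>js. crosses js \<beta> \<and> crosses js \<gamma> \<and> crosses js \<delta>)"
  obtain M K L where s: "split3 ?P = (M, K, L)" by (rule prod_cases3)
  let ?A = "owners Ns (\<lambda>js. crosses js \<beta> \<and> \<not> (crosses js \<gamma> \<and> crosses js \<delta>)) @ K"
  let ?B = "owners Ns (\<lambda>js. crosses js \<gamma> \<and> \<not> crosses js \<beta>) @ L"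
  have el: "a \<in> set ?A \<union> set ?B \<union> set M \<Longrightarrow> esize a \<le> N" for a
    using esize_owners(1)[of a Ns] split3_props(1)[OF s] assms(1) by fastforce
  have len: "length ?A + length ?B + length M \<le> 3 * N"
    using split3_props(2)[OF s] assms(1) esize_owners(2)[of Ns "\<lambda>js. crosses js \<beta> \<and> crosses js \<gamma> \<and> crosses js \<delta>"]
      esize_owners(2)[of Ns "\<lambda>js. crosses js \<beta> \<and> \<not> (crosses js \<gamma> \<and> crosses js \<delta>)"]
      esize_owners(2)[of Ns "\<lambda>js. crosses js \<gamma> \<and> \<not> crosses js \<beta>"] by simp
  have "esize (absorb n X ?A) \<le> esize X + length ?A * (8 + N + esize n)"
    "esize (absorb n Y ?B) \<le> esize Y + length ?B * (8 + N + esize n)"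
    "esize (absorb n (Node (absorb n X ?A) (absorb n Y ?B)) M)
      \<le> esize (Node (absorb n X ?A) (absorb n Y ?B)) + length M * (8 + N + esize n)"
    by (rule esize_absorb, rule el, unfold Un_iff, blast)+
  then have "esize (absorb n (Node (absorb n X ?A) (absorb n Y ?B)) M)
      \<le> esize X + esize Y + 5 + (length ?A + length ?B + length M) * (8 + N + esize n)"
    by (simp add: distrib_right)
  also have "\<dots> \<le> esize X + esize Y + 5 + 3 * N * (8 + 2 * N)"
    using len assms(2) by (intro add_left_mono mult_le_mono) auto
  finally show ?thesis by (simp add: merge_tree_def s)
qed

lemma esize_record_arc:
  assumes "esize vs \<le> N" "esize es \<le> N"
  shows "esize (record_arc vs es u \<beta> v) \<le> 1 + N * (2 + 2 * N)"
proof -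
  have "esize a \<le> 1 + 2 * N" if "a \<in> set (record_arc vs es u \<beta> v)" for a
  proof -
    obtain e where e: "e \<in> set es" "a = (e, filter (\<lambda>x. x \<in> set \<beta>) vs)"
      using \<open>a \<in> _\<close> by (auto simp: record_arc_def)
    then show ?thesis using esize_mem[OF e(1)] esize_filter[of "\<lambda>x. x \<in> set \<beta>" vs] assms by simp
  qed
  then have "esize (record_arc vs es u \<beta> v) \<le> 1 + length (record_arc vs es u \<beta> v) * (1 + (1 + 2 * N))"
    by (rule esize_bounded)
  moreover have "length (record_arc vs es u \<beta> v) \<le> N"
    using le_trans[OF length_filter_le[of "\<lambda>e. joins e u v" es], of N] length_le_esize[of es] assms(2)
    by (simp add: record_arc_def)
  then have "length (record_arc vs es u \<beta> v) * (1 + (1 + 2 * N)) \<le> N * (1 + (1 + 2 * N))"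
    by (rule mult_le_mono1)
  ultimately show ?thesis by simp
qed

text \<open>Besides the parts that are only moved, a merge creates new pieces, one leaf list and two
  arc records, all built from names and arcs of the input; hence a quadratic bound in
  \<open>N\<close>, with a generous constant.\<close>

lemma esize_merge:
  assumes N: "esize Ns \<le> N" "esize vs \<le> N" "esize es \<le> N"
    and t: "b \<in> set (fst s)" "c \<in> set (fst s)" "fst b \<noteq> fst c" "n \<in> set vs"
  shows "esize (merge Ns vs es s (b, c, n)) \<le> esize s + 100 * (N + 1) * (N + 1)"
proof -
  obtain u \<beta> X where b: "b = (u, \<beta>, X)" by (rule prod_cases3)
  obtain v \<gamma> Y where c: "c = (v, \<gamma>, Y)" by (rule prod_cases3)
  obtain L es' acc where s: "s = (L, es', acc)" by (rule prod_cases3)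
  let ?d = "filter (\<lambda>x. x \<in> set \<beta> \<or> x \<in> set \<gamma>) vs"
  have n: "esize n \<le> N" using esize_mem[OF t(4)] N(2) by simp
  have "esize ?d \<le> N" using esize_filter N(2) order_trans by blast
  moreover note esize_merge_tree[OF N(1) n, of \<beta> \<gamma> ?d X Y]
    esize_record_arc[OF N(2,3), of u \<beta> n] esize_record_arc[OF N(2,3), of v \<gamma> n]
  moreover have "esize (filter (\<lambda>d. fst d \<noteq> u \<and> fst d \<noteq> v) L) + esize b + esize c \<le> esize L"
    using esize_remove2[OF t(1-3)] by (simp add: s b c)
  moreover have "esize (filter (\<lambda>e. \<not> touches e u \<and> \<not> touches e v) es') \<le> esize es'"
    by (rule esize_filter)
  moreover have "esize (record_arc vs es u \<beta> n @ record_arc vs es v \<gamma> n @ acc)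
      \<le> esize (record_arc vs es u \<beta> n) + esize (record_arc vs es v \<gamma> n) + esize acc"
    using esize_append[of "record_arc vs es u \<beta> n" "record_arc vs es v \<gamma> n @ acc"]
      esize_append[of "record_arc vs es v \<gamma> n" acc] by simp
  ultimately show ?thesis using n
    by (simp add: merge_def Let_def s b c algebra_simps)
qed

lemma esize_step:
  assumes "esize Ns \<le> N" "esize vs \<le> N" "esize es \<le> N"
  shows "esize (step Ns vs es s) \<le> esize s + 100 * (N + 1) * (N + 1)"
proof -
  let ?C = "cherries vs (fst s) (fst (snd s))"
  let ?G = "filter (\<lambda>t. good (frees Ns vs) (fst (snd (fst t))) (fst (snd (fst (snd t))))) ?C @ ?C"
  show ?thesis
  proof (cases ?G)
    case Nil
    then show ?thesis by (simp add: step_def Let_def)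
  next
    case (Cons t r)
    obtain b c n where t: "t = (b, c, n)" by (rule prod_cases3)
    have "t \<in> set ?G" using Cons by simp
    then have "t \<in> set ?C" by auto
    then have "b \<in> set (fst s)" "c \<in> set (fst s)" "fst b \<noteq> fst c" "n \<in> set vs"
      unfolding cherries_def t by auto
    from esize_merge[OF assms this] Cons show ?thesis by (simp add: step_def Let_def t)
  qed
qed

lemma ptime_final_state:
  "ptime (\<lambda>x. final_state (fst x) (fst (snd x)) (snd (snd x)) :: ('a::enc, 'n::enc) state)"
  unfolding final_state_def
proof (rule ptime_foldl[where k = "[:100:] * [:1, 1:] * [:1, 1:]"])
  show "esize (step (fst x) (fst (snd x)) (snd (snd x)) s)
      \<le> esize s + poly ([:100:] * [:1, 1:] * [:1, 1:]) (esize x + esize (a :: 'n))"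
    for x :: "('a, 'n) net \<times> 'n list \<times> 'n arc list" and s a
  proof -
    have "esize (fst x) \<le> esize x + esize a" "esize (fst (snd x)) \<le> esize x + esize a"
      "esize (snd (snd x)) \<le> esize x + esize a"
      by (cases x; simp)+
    from esize_step[OF this, of s] show ?thesis by (simp add: algebra_simps)
  qed
qed (intro ptime_intros)+

lemma ptime_plan: "ptime (plan :: ('a::enc, 'n::enc) net \<times> 'n list \<times> 'n arc list \<Rightarrow> _)"
proof -
  have "ptime (\<lambda>x :: ('a, 'n) net \<times> 'n list \<times> 'n arc list.
      let s = final_state (fst x) (fst (snd x)) (snd (snd x)) in
      (map (\<lambda>p. (fst p, tensor_tree (fst (snd x)) (closing_arcs (fst (snd x)) (snd (snd x)) s) (snd p))) (fst x),
       closing_tree (fst x) (fst (snd x)) s))"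
    unfolding Let_def
    by (intro ptime_intros ptime_final_state ptime_comp[OF ptime_final_state])
  then show ?thesis by (simp add: plan_def[abs_def])
qed

section \<open>Correctness of the algorithm\<close>

definition adj :: "'n arc set \<Rightarrow> ('n \<times> 'n) set" where
  "adj E = {(u, v). \<exists>e\<in>E. joins e u v}"

lemma joins_sym: "joins e u v \<longleftrightarrow> joins e v u"
  by (auto simp: joins_def)

lemma joins_ends: "joins e u v \<Longrightarrow> (fst e \<in> S \<longleftrightarrow> snd e \<in> S) \<longleftrightarrow> (u \<in> S \<longleftrightarrow> v \<in> S)"
  by (auto simp: joins_def)

lemma joins_both: "joins e u v \<Longrightarrow> (fst e \<in> S \<and> snd e \<in> S) \<longleftrightarrow> (u \<in> S \<and> v \<in> S)"
  by (auto simp: joins_def)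

lemma adj_mono: "E \<subseteq> E' \<Longrightarrow> (adj E)\<^sup>* \<subseteq> (adj E')\<^sup>*"
  by (intro rtrancl_mono) (auto simp: adj_def)

lemma adj_sym: "(x, y) \<in> (adj E)\<^sup>* \<Longrightarrow> (y, x) \<in> (adj E)\<^sup>*"
proof -
  have "sym (adj E)" by (auto simp: adj_def sym_def joins_sym)
  then show "(x, y) \<in> (adj E)\<^sup>* \<Longrightarrow> (y, x) \<in> (adj E)\<^sup>*" by (meson sym_rtrancl symD)
qed

lemma adj_edge: "e \<in> E \<Longrightarrow> joins e u v \<Longrightarrow> (u, v) \<in> (adj E)\<^sup>*"
  by (rule r_into_rtrancl) (auto simp: adj_def)

text \<open>Most connectivity arguments below exhibit a set that no arc leaves instead of handling
  paths.\<close>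

lemma adj_invariant:
  assumes "(x, y) \<in> (adj E)\<^sup>*" "\<And>f. f \<in> E \<Longrightarrow> fst f \<in> S \<longleftrightarrow> snd f \<in> S"
  shows "x \<in> S \<longleftrightarrow> y \<in> S"
  using assms(1)
proof induction
  case (step y z)
  then obtain e where "e \<in> E" "joins e y z" by (auto simp: adj_def)
  then show ?case using assms(2)[of e] joins_ends[of e y z S] step.IH by blast
qed simp

text \<open>That the arcs form a tree enters as \<open>connected\<close> together with the count
  \<open>forest\<close>; cycles never have to be mentioned on the level of names.\<close>

locale network_tree =
  fixes Ns :: "('a, 'n) net" and vs :: "'n list" and es :: "'n arc list" and w :: nat
  assumes distinct_ids: "distinct (map fst Ns)"
    and distinct_vs: "distinct vs"
    and distinct_es: "distinct es" and es_nonempty: "es \<noteq> []"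
    and arcs: "\<And>e. e \<in> set es \<Longrightarrow> fst e \<in> set vs \<and> snd e \<in> set vs \<and> fst e \<noteq> snd e"
    and connected: "\<And>u v. u \<in> set vs \<Longrightarrow> v \<in> set vs \<Longrightarrow> (u, v) \<in> (adj (set es))\<^sup>*"
    and forest: "length es < length vs"
    and w_pos: "1 \<le> w"
begin

definition ids :: "'a set" where "ids = fst ` set Ns"

definition ix :: "'a \<Rightarrow> 'n set" where "ix a = \<Union> {set js |js. (a, js) \<in> set Ns}"

definition leaf_names :: "'n set" where "leaf_names = (\<Union>a\<in>ids. ix a)"

definition holders :: "'n \<Rightarrow> 'a set" where "holders i = {a \<in> ids. i \<in> ix a}"

definition free_names :: "'n set" where "free_names = {i. card (holders i) = 1}"

definition cr :: "'a \<Rightarrow> 'n set \<Rightarrow> bool" where "cr a C \<longleftrightarrow> ix a \<inter> C \<noteq> {} \<and> ix a - C \<noteq> {}"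

definition crossing :: "'n set \<Rightarrow> 'a set" where "crossing C = {a \<in> ids. cr a C}"

text \<open>The free vertex of the structure graph behaves like one more tensor whose indices are
  the free ones, and this is its version of \<open>cr\<close>.\<close>

definition free_crossing :: "'n set \<Rightarrow> bool" where
  "free_crossing C \<longleftrightarrow> free_names \<inter> C \<noteq> {} \<and> free_names - C \<noteq> {}"

text \<open>\<open>C\<close> is the side of the vertex \<open>v\<close> after deleting the arc \<open>e\<close> from \<open>v\<close> to \<open>p\<close>.\<close>

definition pend :: "'n \<Rightarrow> 'n arc \<Rightarrow> 'n \<Rightarrow> 'n set \<Rightarrow> bool" where
  "pend v e p C \<longleftrightarrow> e \<in> set es \<and> joins e v p \<and> v \<in> C \<and> p \<notin> C \<and> C \<subseteq> set vs \<and>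
     (\<forall>x\<in>C. (v, x) \<in> (adj {f \<in> set es. fst f \<in> C \<and> snd f \<in> C})\<^sup>*) \<and>
     (\<forall>f\<in>set es. f \<noteq> e \<longrightarrow> (fst f \<in> C \<longleftrightarrow> snd f \<in> C))"

definition side :: "'n arc \<Rightarrow> 'n set \<Rightarrow> bool" where
  "side e C \<longleftrightarrow> (\<exists>v p. pend v e p C)"

text \<open>\<open>(4 * w + 2) div 3\<close> is \<open>\<lceil>4 w / 3\<rceil>\<close>, which is 2
  for \<open>w = 1\<close>. A tree with at least three leaves has a vertex with at least three
  edges, and the full contraction with three free indices has rank 3; these two cases account for
  the value 3.\<close>

definition bound :: nat where
  "bound = (if w = 1 \<and> (card free_names = 3 \<or> (\<exists>a\<in>ids. 3 \<le> card (ix a))) then 3 else (4 * w + 2) div 3)"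

lemma bound_simps:
  "2 \<le> bound" "w + (w + 2) div 3 \<le> bound" "2 \<le> w \<Longrightarrow> 3 \<le> bound"
  "a \<in> ids \<Longrightarrow> 3 \<le> card (ix a) \<Longrightarrow> 3 \<le> bound" "card free_names = 3 \<Longrightarrow> 3 \<le> bound"
proof -
  have *: "w + (w + 2) div 3 = (4 * w + 2) div 3" by presburger
  show "2 \<le> bound" using w_pos by (auto simp: bound_def)
  show "w + (w + 2) div 3 \<le> bound" unfolding * bound_def by auto
  show **: "2 \<le> w \<Longrightarrow> 3 \<le> bound" by (auto simp: bound_def)
  show "a \<in> ids \<Longrightarrow> 3 \<le> card (ix a) \<Longrightarrow> 3 \<le> bound" "card free_names = 3 \<Longrightarrow> 3 \<le> bound"
  proof -
    have "w = 1 \<or> 2 \<le> w" using w_pos by linarith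
    then show "a \<in> ids \<Longrightarrow> 3 \<le> card (ix a) \<Longrightarrow> 3 \<le> bound" "card free_names = 3 \<Longrightarrow> 3 \<le> bound"
      using ** unfolding bound_def by fastforce+
  qed
qed

lemma ix_eq: "(a, js) \<in> set Ns \<Longrightarrow> ix a = set js"
  using distinct_ids unfolding ix_def by (auto dest: eq_key_imp_eq_value)

lemma finite_ids [simp]: "finite ids" by (simp add: ids_def)

lemma finite_ix [simp]: "finite (ix a)"
proof (cases "\<exists>js. (a, js) \<in> set Ns")
  case True
  then show ?thesis using ix_eq by auto
next
  case False
  then have "ix a = {}" by (auto simp: ix_def)
  then show ?thesis by simp
qed

lemma ix_ids: "i \<in> ix a \<Longrightarrow> a \<in> ids"
  by (force simp: ix_def ids_def)

lemma ix_leaf: "i \<in> ix a \<Longrightarrow> i \<in> leaf_names"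
  using ix_ids by (auto simp: leaf_names_def)

lemma finite_leaf_names [simp]: "finite leaf_names" by (simp add: leaf_names_def)

lemma finite_holders [simp]: "finite (holders i)" by (simp add: holders_def)

lemma free_leaf: "free_names \<subseteq> leaf_names"
proof
  fix i assume "i \<in> free_names"
  then have "holders i \<noteq> {}" by (auto simp: free_names_def)
  then show "i \<in> leaf_names" by (auto simp: holders_def leaf_names_def)
qed

lemma finite_free [simp]: "finite free_names"
  using free_leaf finite_leaf_names finite_subset by blast

lemma finite_crossing [simp]: "finite (crossing C)" by (simp add: crossing_def)

lemma owners_iff:
  assumes "\<And>a js. (a, js) \<in> set Ns \<Longrightarrow> P js \<longleftrightarrow> Q a"
  shows "set (owners Ns P) = {a \<in> ids. Q a}"
  using assms unfolding owners_def ids_def by force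

lemma distinct_owners: "distinct (owners Ns P)"
  using distinct_ids unfolding owners_def by (simp add: distinct_map_filter)

lemma crosses_iff:
  assumes "(a, js) \<in> set Ns" "set \<beta> = C \<inter> leaf_names"
  shows "crosses js \<beta> \<longleftrightarrow> cr a C"
proof -
  have "ix a \<subseteq> leaf_names" using ix_leaf by blast
  then show ?thesis using assms ix_eq[OF assms(1)] unfolding crosses_def cr_def by auto
qed

lemma set_owners_mem: "set (owners Ns (\<lambda>js. v \<in> set js)) = holders v"
  unfolding holders_def by (rule owners_iff) (simp add: ix_eq)

end

text \<open>\<open>width\<close> is the width of the branch decomposition in terms of names: the
  vertices of the structure graph on both sides of an arc are the crossing tensors and possibly the
  free vertex.\<close>

locale network_tree_width = network_tree Ns vs es w
  for Ns :: "('a, 'n) net" and vs :: "'n list" and es :: "'n arc list" and w :: nat +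
  assumes leaf_sub: "leaf_names \<subseteq> set vs"
    and degree_leaf: "\<And>v. v \<in> leaf_names \<Longrightarrow> card {e \<in> set es. touches e v} = 1"
    and degree_inner: "\<And>v. v \<in> set vs \<Longrightarrow> v \<notin> leaf_names \<Longrightarrow> card {e \<in> set es. touches e v} = 3"
    and holders_le: "\<And>i. card (holders i) \<le> 2"
    and free_le: "card free_names \<le> 3"
    and width: "\<And>e C. side e C \<Longrightarrow> card (crossing C) + (if free_crossing C then 1 else 0) \<le> w"
begin

lemma holders_ge: "i \<in> leaf_names \<Longrightarrow> holders i \<noteq> {}"
  by (auto simp: leaf_names_def holders_def)

lemma pendD:
  assumes "pend v e p C"
  shows "e \<in> set es" "joins e v p" "v \<in> C" "p \<notin> C" "C \<subseteq> set vs"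
    "\<And>x. x \<in> C \<Longrightarrow> (v, x) \<in> (adj {f \<in> set es. fst f \<in> C \<and> snd f \<in> C})\<^sup>*"
    "\<And>f. f \<in> set es \<Longrightarrow> f \<noteq> e \<Longrightarrow> fst f \<in> C \<longleftrightarrow> snd f \<in> C"
  using assms unfolding pend_def by blast+

lemma pend_boundary:
  assumes "pend v e p C" "f \<in> set es" "joins f x y" "x \<in> C" "y \<notin> C"
  shows "f = e" "x = v" "y = p"
proof -
  show "f = e" using pendD(7)[OF assms(1,2)] joins_ends[OF assms(3), of C] assms(4,5) by blast
  then show "x = v" "y = p" using pendD(2-4)[OF assms(1)] assms(3-5) by (auto simp: joins_def)
qed

lemma closed_all:
  assumes "S \<subseteq> set vs" "x \<in> S" "\<And>f. f \<in> set es \<Longrightarrow> fst f \<in> S \<longleftrightarrow> snd f \<in> S"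
  shows "S = set vs"
proof
  show "set vs \<subseteq> S"
  proof
    fix y assume "y \<in> set vs"
    then have "(x, y) \<in> (adj (set es))\<^sup>*" using connected assms(1,2) by blast
    from adj_invariant[OF this, of S] show "y \<in> S" using assms(2,3) by blast
  qed
qed (rule assms(1))

text \<open>A side is connected and left by no arc except \<open>e\<close>. Two sides that contain
  the same end of \<open>e\<close> therefore contain each other; two sides with opposite ends are
  disjoint, and no arc leaves their union. So it does not matter which side \<open>cross\<close>
  picks.\<close>

lemma side_cases:
  assumes "side e C" "side e C'"
  shows "C' = C \<or> C' = set vs - C"
proof -
  obtain v p where P: "pend v e p C" using assms(1) by (auto simp: side_def)
  obtain v' p' where P': "pend v' e p' C'" using assms(2) by (auto simp: side_def)
  have sub: "D \<subseteq> D'" if "pend x e y D" "pend x e z D'" for x y z D D'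
  proof
    fix t assume "t \<in> D"
    have "fst f \<in> D' \<longleftrightarrow> snd f \<in> D'" if "f \<in> {f \<in> set es. fst f \<in> D \<and> snd f \<in> D}" for f
    proof (rule pendD(7)[OF \<open>pend x e z D'\<close>])
      show "f \<noteq> e" using that pendD(2-4)[OF \<open>pend x e y D\<close>] by (auto simp: joins_def)
    qed (use that in blast)
    from adj_invariant[OF pendD(6)[OF \<open>pend x e y D\<close> \<open>t \<in> D\<close>] this] pendD(3)[OF \<open>pend x e z D'\<close>]
    show "t \<in> D'" by blast
  qed
  show ?thesis
  proof (cases "v' = v")
    case True
    then show ?thesis using sub[OF P] sub[of v' p' C'] P P' by blast
  next
    case False
    then have e: "v' = p" "p' = v"
      using pendD(2)[OF P] pendD(2)[OF P'] by (auto simp: joins_def)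
    have disj: "C \<inter> C' = {}"
    proof (rule ccontr)
      assume "C \<inter> C' \<noteq> {}"
      then obtain t where t: "t \<in> C" "t \<in> C'" by blast
      have "fst f \<in> C' \<longleftrightarrow> snd f \<in> C'" if "f \<in> {f \<in> set es. fst f \<in> C \<and> snd f \<in> C}" for f
      proof (rule pendD(7)[OF P'])
        show "f \<noteq> e" using that pendD(2-4)[OF P] by (auto simp: joins_def)
      qed (use that in blast)
      from adj_invariant[OF pendD(6)[OF P t(1)] this] pendD(4)[OF P'] t(2) e show False by blast
    qed
    have "C \<union> C' = set vs"
    proof (rule closed_all)
      fix f assume f: "f \<in> set es"
      show "fst f \<in> C \<union> C' \<longleftrightarrow> snd f \<in> C \<union> C'"
      proof (cases "f = e")
        case True
        then show ?thesis using pendD(2,3)[OF P] pendD(3)[OF P'] e by (auto simp: joins_def)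
      next
        case False
        then show ?thesis using pendD(7)[OF P f] pendD(7)[OF P' f] by blast
      qed
    qed (use pendD(3,5)[OF P] pendD(5)[OF P'] in auto)
    then show ?thesis using disj by blast
  qed
qed

definition cross :: "'a \<Rightarrow> 'n arc \<Rightarrow> bool" where
  "cross a e \<longleftrightarrow> (\<exists>C. side e C \<and> cr a C)"

lemma cross_iff:
  assumes "side e C"
  shows "cross a e \<longleftrightarrow> cr a C"
proof
  assume "cross a e"
  then obtain C' where C': "side e C'" "cr a C'" by (auto simp: cross_def)
  have "ix a \<subseteq> set vs" using ix_leaf leaf_sub by blast
  then show "cr a C" using side_cases[OF assms C'(1)] C'(2) by (auto simp: cr_def)
qed (use assms in \<open>auto simp: cross_def\<close>)

lemma pend_side: "pend v e p C \<Longrightarrow> side e C"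
  by (auto simp: side_def)

text \<open>The arcs that separate two indices of \<open>a\<close> form the smallest subtree
  containing these indices. Its vertices are \<open>span a\<close>, and \<open>a\<close> is factored
  along it.\<close>

definition arcs_of :: "'a \<Rightarrow> 'n arc set" where "arcs_of a = {e \<in> set es. cross a e}"

definition span :: "'a \<Rightarrow> 'n set" where "span a = {v. v \<in> ix a \<or> (\<exists>e\<in>arcs_of a. touches e v)}"

definition blob :: "'n set \<Rightarrow> ('a \<times> 'n) set" where
  "blob C = {(a, x). a \<in> ids \<and> x \<in> C \<and> x \<in> span a}"

text \<open>A bond index of the factored network corresponds to a tensor and an arc of its tree, and
  it is open in \<open>U\<close> if exactly one end of the arc carries a piece in \<open>U\<close>.
  Thus \<open>rk\<close> speaks about ranks before any factorization is chosen.\<close>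

definition rk_arcs :: "('a \<times> 'n) set \<Rightarrow> ('a \<times> 'n arc) set" where
  "rk_arcs U = {(a, e). a \<in> ids \<and> e \<in> arcs_of a \<and> ((a, fst e) \<in> U) \<noteq> ((a, snd e) \<in> U)}"

definition rk_free :: "('a \<times> 'n) set \<Rightarrow> 'n set" where
  "rk_free U = {i. \<exists>!a. i \<in> ix a \<and> (a, i) \<in> U}"

definition rk :: "('a \<times> 'n) set \<Rightarrow> nat" where
  "rk U = card (rk_arcs U) + card (rk_free U)"

lemma finite_arcs_of [simp]: "finite (arcs_of a)" by (simp add: arcs_of_def)

lemma span_sub: "span a \<subseteq> set vs"
  using arcs ix_leaf leaf_sub unfolding span_def arcs_of_def touches_def by blast

lemma leaf_pend:
  assumes "i \<in> leaf_names"
  obtains e p where "pend i e p {i}" "\<And>f. f \<in> set es \<Longrightarrow> touches f i \<Longrightarrow> f = e"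
proof -
  obtain e where e: "{e \<in> set es. touches e i} = {e}"
    using card_1_singletonE[OF degree_leaf[OF assms]] .
  have "e \<in> {e \<in> set es. touches e i}" unfolding e by (rule singletonI)
  then have es: "e \<in> set es" "touches e i" by simp_all
  define p where "p = (if fst e = i then snd e else fst e)"
  have p: "joins e i p" "p \<noteq> i" using es(2) arcs[OF es(1)] unfolding joins_def touches_def p_def by auto
  have "\<not> touches f i" if "f \<in> set es" "f \<noteq> e" for f using e that by blast
  then have "\<forall>f\<in>set es. f \<noteq> e \<longrightarrow> (fst f \<in> {i} \<longleftrightarrow> snd f \<in> {i})" by (auto simp: touches_def)
  then have "pend i e p {i}" unfolding pend_def using es(1) p assms leaf_sub by auto
  moreover have "f = e" if "f \<in> set es" "touches f i" for f using e that by blast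
  ultimately show ?thesis by (rule that)
qed

text \<open>The only arc at a leaf \<open>i\<close> cuts off \<open>{i}\<close>, and a tensor
  crosses it only if \<open>i\<close> is one of its indices.\<close>

lemma span_leaf: "i \<in> leaf_names \<Longrightarrow> i \<in> span a \<longleftrightarrow> i \<in> ix a"
proof
  assume i: "i \<in> leaf_names" "i \<in> span a"
  obtain e p where e: "pend i e p {i}" "\<And>f. f \<in> set es \<Longrightarrow> touches f i \<Longrightarrow> f = e"
    using leaf_pend[OF i(1)] by metis
  show "i \<in> ix a"
  proof (rule ccontr)
    assume "i \<notin> ix a"
    then obtain f where "f \<in> arcs_of a" "touches f i" using i(2) by (auto simp: span_def)
    then have "cross a e" using e(2)[of f] by (auto simp: arcs_of_def)
    then have "cr a {i}" using cross_iff[OF pend_side[OF e(1)]] by blast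
    then show False using \<open>i \<notin> ix a\<close> by (auto simp: cr_def)
  qed
qed (auto simp: span_def)

end

section \<open>Merging two subtrees \<open>Wu\<close> and \<open>Wv\<close> at their common
  neighbour \<open>n\<close>\<close>

locale cherry = network_tree_width Ns vs es w
  for Ns :: "('a, 'n) net" and vs :: "'n list" and es :: "'n arc list" and w :: nat +
  fixes u v n p :: 'n and e1 e2 e3 :: "'n arc" and Wu Wv :: "'n set"
  assumes pend_u: "pend u e1 n Wu" and pend_v: "pend v e2 n Wv"
    and disjoint: "Wu \<inter> Wv = {}"
    and n_vs: "n \<in> set vs" and n_inner: "n \<notin> leaf_names"
    and e3: "e3 \<in> set es" "joins e3 n p" "p \<notin> Wu" "p \<notin> Wv" "p \<noteq> n"
    and arcs_n: "\<And>f. f \<in> set es \<Longrightarrow> touches f n \<Longrightarrow> f = e1 \<or> f = e2 \<or> f = e3"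
begin

definition Wn :: "'n set" where "Wn = insert n (Wu \<union> Wv)"

lemma n_notin: "n \<notin> Wu" "n \<notin> Wv"
  using pendD(4)[OF pend_u] pendD(4)[OF pend_v] by auto

lemma arcs_distinct: "e1 \<noteq> e2" "e1 \<noteq> e3" "e2 \<noteq> e3"
proof -
  have "u \<in> Wu" "v \<in> Wv" "joins e1 u n" "joins e2 v n"
    using pendD[OF pend_u] pendD[OF pend_v] by auto
  then show "e1 \<noteq> e2" "e1 \<noteq> e3" "e2 \<noteq> e3" using disjoint n_notin e3 by (auto simp: joins_def)
qed

lemma outside_Wn:
  assumes "f \<in> set es" "f \<noteq> e1" "f \<noteq> e2" "f \<noteq> e3"
  shows "fst f \<in> Wn \<longleftrightarrow> snd f \<in> Wn" "fst f \<noteq> n" "snd f \<noteq> n"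
proof -
  have "\<not> touches f n" using arcs_n[OF assms(1)] assms(2-4) by blast
  then show n: "fst f \<noteq> n" "snd f \<noteq> n" by (auto simp: touches_def)
  show "fst f \<in> Wn \<longleftrightarrow> snd f \<in> Wn"
    using pendD(7)[OF pend_u assms(1,2)] pendD(7)[OF pend_v assms(1,3)] n by (simp add: Wn_def)
qed

lemma pend_n: "pend n e3 p Wn"
proof -
  let ?E = "{f \<in> set es. fst f \<in> Wn \<and> snd f \<in> Wn}"
  have inner: "(n, x) \<in> (adj ?E)\<^sup>*" if "pend y e n W" "W \<subseteq> Wn" "x \<in> W" for y e W x
  proof -
    have "y \<in> Wn" "n \<in> Wn" using pendD(3)[OF that(1)] that(2) by (auto simp: Wn_def)
    then have e: "e \<in> ?E" using pendD(1)[OF that(1)] joins_both[OF pendD(2)[OF that(1)], of Wn] by simp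
    then have "(n, y) \<in> (adj ?E)\<^sup>*" by (rule adj_edge[OF _ iffD1[OF joins_sym pendD(2)[OF that(1)]]])
    moreover have "{f \<in> set es. fst f \<in> W \<and> snd f \<in> W} \<subseteq> ?E" using that(2) by blast
    from adj_mono[OF this] have "(y, x) \<in> (adj ?E)\<^sup>*" using pendD(6)[OF that(1,3)] by (rule subsetD)
    ultimately show ?thesis by (rule rtrancl_trans)
  qed
  have "\<forall>x\<in>Wn. (n, x) \<in> (adj ?E)\<^sup>*"
    using inner[OF pend_u] inner[OF pend_v] by (auto simp: Wn_def)
  moreover have "fst f \<in> Wn \<longleftrightarrow> snd f \<in> Wn" if "f \<in> set es" "f \<noteq> e3" for f
  proof (cases "f = e1 \<or> f = e2")
    case True
    have "u \<in> Wn" "v \<in> Wn" "n \<in> Wn" using pendD(3)[OF pend_u] pendD(3)[OF pend_v] by (auto simp: Wn_def)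
    then show ?thesis
      using True joins_ends[OF pendD(2)[OF pend_u], of Wn] joins_ends[OF pendD(2)[OF pend_v], of Wn] by blast
  next
    case False
    then show ?thesis using outside_Wn(1) that by blast
  qed
  ultimately show ?thesis unfolding pend_def
    using e3 n_vs pendD(5)[OF pend_u] pendD(5)[OF pend_v] by (auto simp: Wn_def)
qed

lemma cross_e:
  "e1 \<in> arcs_of a \<longleftrightarrow> cr a Wu" "e2 \<in> arcs_of a \<longleftrightarrow> cr a Wv" "e3 \<in> arcs_of a \<longleftrightarrow> cr a Wn"
  using cross_iff[OF pend_side[OF pend_u]] cross_iff[OF pend_side[OF pend_v]]
    cross_iff[OF pend_side[OF pend_n]] pendD(1)[OF pend_u] pendD(1)[OF pend_v] e3(1)
  by (auto simp: arcs_of_def)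

lemma ix_n: "n \<notin> ix a"
  using n_inner ix_leaf by blast

lemma touches_e: "touches e1 n" "touches e2 n" "touches e3 n"
  using pendD(2)[OF pend_u] pendD(2)[OF pend_v] e3(2) by (auto simp: joins_def touches_def)

lemma n_span: "n \<in> span a \<longleftrightarrow> cr a Wu \<or> cr a Wv \<or> cr a Wn"
proof
  assume "n \<in> span a"
  then obtain f where f: "f \<in> arcs_of a" "touches f n" using ix_n by (auto simp: span_def)
  then have "f = e1 \<or> f = e2 \<or> f = e3" using arcs_n by (auto simp: arcs_of_def)
  then show "cr a Wu \<or> cr a Wv \<or> cr a Wn" using f(1) cross_e by blast
next
  assume "cr a Wu \<or> cr a Wv \<or> cr a Wn"
  then show "n \<in> span a" using cross_e[of a] touches_e by (auto simp: span_def)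
qed

text \<open>\<open>n\<close> is not an index, so \<open>Wu\<close>, \<open>Wv\<close> and the
  outside of \<open>Wn\<close> partition the indices of \<open>a\<close>. An arc at \<open>n\<close>
  is crossed if its part is neither empty nor everything, and exactly one such part is
  impossible.\<close>

lemma two_of_three:
  "cr a Wn \<Longrightarrow> cr a Wu \<or> cr a Wv" "cr a Wu \<Longrightarrow> cr a Wv \<or> cr a Wn" "cr a Wv \<Longrightarrow> cr a Wu \<or> cr a Wn"
  using ix_n[of a] disjoint unfolding cr_def Wn_def by blast+

lemma degree_n:
  assumes "n \<in> span a"
  shows "2 \<le> card {e \<in> arcs_of a. touches e n}"
proof -
  obtain f g where "f \<noteq> g" "{f, g} \<subseteq> {e \<in> arcs_of a. touches e n}"
    using assms unfolding n_span using two_of_three[of a] cross_e[of a] touches_e arcs_distinct by blast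
  moreover have "card {f, g} \<le> card {e \<in> arcs_of a. touches e n}"
    by (rule card_mono) (use calculation in auto)
  ultimately show ?thesis by simp
qed

lemma card_inter_le:
  assumes "finite Q"
  shows "card (Q \<inter> A) + card (Q \<inter> B) \<le> card Q + card (Q \<inter> A \<inter> B)"
proof -
  have "card (Q \<inter> A) + card (Q \<inter> B) = card (Q \<inter> A \<union> Q \<inter> B) + card (Q \<inter> A \<inter> (Q \<inter> B))"
    using assms by (intro card_Un_Int) auto
  moreover have "card (Q \<inter> A \<union> Q \<inter> B) \<le> card Q" by (rule card_mono) (use assms in auto)
  moreover have "Q \<inter> A \<inter> (Q \<inter> B) = Q \<inter> A \<inter> B" by blast
  ultimately show ?thesis by simp
qed

text \<open>Every tensor with an index in \<open>W\<close> has its piece there in \<open>U\<close>.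
  An index that is open in \<open>U\<close> must then have a single carrier in the whole
  network.\<close>

lemma rk_free_blob:
  assumes U: "U \<inter> (UNIV \<times> W) = blob W" and sub: "U \<subseteq> UNIV \<times> insert n W"
  shows "card (rk_free U) \<le> card (free_names \<inter> W)"
proof (rule card_mono)
  show "rk_free U \<subseteq> free_names \<inter> W"
  proof
    fix i assume "i \<in> rk_free U"
    then obtain a where a: "i \<in> ix a" "(a, i) \<in> U" "\<And>b. i \<in> ix b \<Longrightarrow> (b, i) \<in> U \<Longrightarrow> b = a"
      by (auto simp: rk_free_def)
    have "i \<noteq> n" using a(1) ix_n by blast
    then have W: "i \<in> W" using a(2) sub by auto
    have "(b, i) \<in> blob W" if "b \<in> holders i" for b
      using that W by (auto simp: blob_def holders_def span_def)
    then have "(b, i) \<in> U" if "b \<in> holders i" for b using that U by blast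
    then have "b = a" if "b \<in> holders i" for b using a(3) that by (simp add: holders_def)
    moreover have "a \<in> holders i" using a(1) ix_ids by (simp add: holders_def)
    ultimately have "holders i = {a}" by blast
    then show "i \<in> free_names \<inter> W" using W by (simp add: free_names_def)
  qed
qed simp

text \<open>A tensor in \<open>Q\<close> closes its arc \<open>e1\<close> and opens those of
  \<open>e2\<close> and \<open>e3\<close> that it crosses. It crosses at least one of them, and it
  adds an index only if it crosses both; \<open>card_inter_le\<close> does this count for all of
  \<open>Q\<close> at once.\<close>

lemma rk_child:
  assumes Q: "Q \<subseteq> crossing Wu"
  shows "rk (blob Wu \<union> (\<lambda>a. (a, n)) ` Q)
    \<le> card (crossing Wu) + card (Q \<inter> crossing Wv \<inter> crossing Wn) + card (free_names \<inter> Wu)"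
proof -
  let ?U = "blob Wu \<union> (\<lambda>a. (a, n)) ` Q"
  have fin: "finite Q" using Q finite_crossing finite_subset by blast
  have mem: "(a, x) \<in> ?U \<longleftrightarrow> x \<in> Wu \<or> x = n \<and> a \<in> Q" if "a \<in> ids" "x \<in> span a" for a x
    using that n_notin by (auto simp: blob_def)
  have "rk_arcs ?U \<subseteq> (crossing Wu - Q) \<times> {e1} \<union> (Q \<inter> crossing Wv) \<times> {e2} \<union> (Q \<inter> crossing Wn) \<times> {e3}"
  proof
    fix q assume "q \<in> rk_arcs ?U"
    then obtain a e where q: "q = (a, e)" "a \<in> ids" "e \<in> arcs_of a" "((a, fst e) \<in> ?U) \<noteq> ((a, snd e) \<in> ?U)"
      by (auto simp: rk_arcs_def)
    have sp: "fst e \<in> span a" "snd e \<in> span a" using q(3) by (auto simp: span_def touches_def)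
    have ne: "(fst e \<in> Wu \<or> fst e = n \<and> a \<in> Q) \<noteq> (snd e \<in> Wu \<or> snd e = n \<and> a \<in> Q)"
      using q(4) mem[OF q(2) sp(1)] mem[OF q(2) sp(2)] by blast
    have e: "e \<in> set es" using q(3) by (simp add: arcs_of_def)
    show "q \<in> (crossing Wu - Q) \<times> {e1} \<union> (Q \<inter> crossing Wv) \<times> {e2} \<union> (Q \<inter> crossing Wn) \<times> {e3}"
    proof (cases "e = e1")
      case True
      then have "a \<notin> Q" using ne pendD(2,3)[OF pend_u] by (auto simp: joins_def)
      then show ?thesis using True q cross_e(1) by (auto simp: crossing_def)
    next
      case False
      then have "fst e \<in> Wu \<longleftrightarrow> snd e \<in> Wu" using pendD(7)[OF pend_u e] by blast
      then have "a \<in> Q" "touches e n" using ne by (auto simp: touches_def)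
      then show ?thesis using arcs_n[OF e] False q cross_e by (auto simp: crossing_def)
    qed
  qed
  then have "card (rk_arcs ?U) \<le> card ((crossing Wu - Q) \<times> {e1} \<union> (Q \<inter> crossing Wv) \<times> {e2} \<union> (Q \<inter> crossing Wn) \<times> {e3})"
    by (rule card_mono[rotated]) (use fin in auto)
  also have "\<dots> \<le> card ((crossing Wu - Q) \<times> {e1}) + card ((Q \<inter> crossing Wv) \<times> {e2}) + card ((Q \<inter> crossing Wn) \<times> {e3})"
    by (meson add_le_mono1 card_Un_le order_trans)
  also have "\<dots> = card (crossing Wu) - card Q + card (Q \<inter> crossing Wv) + card (Q \<inter> crossing Wn)"
    using card_Diff_subset[OF fin Q] by (simp add: card_cartesian_product)
  also have "\<dots> \<le> card (crossing Wu) + card (Q \<inter> crossing Wv \<inter> crossing Wn)"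
    using card_inter_le[OF fin, of "crossing Wv" "crossing Wn"] card_mono[OF finite_crossing Q] by linarith
  finally have "card (rk_arcs ?U) \<le> card (crossing Wu) + card (Q \<inter> crossing Wv \<inter> crossing Wn)" .
  moreover have "card (rk_free ?U) \<le> card (free_names \<inter> Wu)"
    by (rule rk_free_blob) (use n_notin in \<open>auto simp: blob_def\<close>)
  ultimately show ?thesis by (simp add: rk_def)
qed

text \<open>A tensor in \<open>Q\<close> leaves at most \<open>e3\<close> open. A tensor that still
  waits crosses all three arcs and leaves \<open>e1\<close> and \<open>e2\<close> open in place of
  \<open>e3\<close>, one index more than it will have after being absorbed.\<close>

lemma rk_merged:
  assumes Q: "Q \<subseteq> crossing Wu \<union> crossing Wv"
    and rest: "crossing Wu \<union> crossing Wv - Q \<subseteq> crossing Wu \<inter> crossing Wv \<inter> crossing Wn"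
  shows "rk (blob Wu \<union> blob Wv \<union> (\<lambda>a. (a, n)) ` Q)
    \<le> card (crossing Wn) + card (crossing Wu \<union> crossing Wv - Q) + card (free_names \<inter> Wn)"
proof -
  let ?U = "blob Wu \<union> blob Wv \<union> (\<lambda>a. (a, n)) ` Q"
  let ?R = "crossing Wu \<union> crossing Wv - Q"
  have fin: "finite Q" using Q finite_subset[OF Q] by simp
  have mem: "(a, x) \<in> ?U \<longleftrightarrow> x \<in> Wu \<or> x \<in> Wv \<or> x = n \<and> a \<in> Q" if "a \<in> ids" "x \<in> span a" for a x
    using that n_notin by (auto simp: blob_def)
  have "rk_arcs ?U \<subseteq> (Q \<inter> crossing Wn) \<times> {e3} \<union> ?R \<times> {e1} \<union> ?R \<times> {e2}"
  proof
    fix q assume "q \<in> rk_arcs ?U"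
    then obtain a e where q: "q = (a, e)" "a \<in> ids" "e \<in> arcs_of a" "((a, fst e) \<in> ?U) \<noteq> ((a, snd e) \<in> ?U)"
      by (auto simp: rk_arcs_def)
    have sp: "fst e \<in> span a" "snd e \<in> span a" using q(3) by (auto simp: span_def touches_def)
    have ne: "(fst e \<in> Wu \<or> fst e \<in> Wv \<or> fst e = n \<and> a \<in> Q) \<noteq> (snd e \<in> Wu \<or> snd e \<in> Wv \<or> snd e = n \<and> a \<in> Q)"
      using q(4) mem[OF q(2) sp(1)] mem[OF q(2) sp(2)] by blast
    have e: "e \<in> set es" using q(3) by (simp add: arcs_of_def)
    show "q \<in> (Q \<inter> crossing Wn) \<times> {e3} \<union> ?R \<times> {e1} \<union> ?R \<times> {e2}"
    proof (cases "e = e1 \<or> e = e2")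
      case True
      then have "a \<notin> Q" using ne pendD(2,3)[OF pend_u] pendD(2,3)[OF pend_v] by (auto simp: joins_def)
      then show ?thesis using True q cross_e by (auto simp: crossing_def)
    next
      case False
      then have "fst e \<in> Wu \<longleftrightarrow> snd e \<in> Wu" "fst e \<in> Wv \<longleftrightarrow> snd e \<in> Wv"
        using pendD(7)[OF pend_u e] pendD(7)[OF pend_v e] by blast+
      then have "a \<in> Q" "touches e n" using ne by (auto simp: touches_def)
      then show ?thesis using arcs_n[OF e] False q cross_e by (auto simp: crossing_def)
    qed
  qed
  then have "card (rk_arcs ?U) \<le> card ((Q \<inter> crossing Wn) \<times> {e3} \<union> ?R \<times> {e1} \<union> ?R \<times> {e2})"
    by (rule card_mono[rotated]) (use fin in auto)
  also have "\<dots> \<le> card ((Q \<inter> crossing Wn) \<times> {e3}) + card (?R \<times> {e1}) + card (?R \<times> {e2})"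
    by (meson add_le_mono1 card_Un_le order_trans)
  also have "\<dots> = card (Q \<inter> crossing Wn) + card ?R + card ?R"
    by (simp add: card_cartesian_product)
  \<comment> \<open>The waiting tensors cross \<open>e3\<close> as well and are disjoint from
    \<open>Q\<close>, so one of the two copies of \<open>card ?R\<close> fits into
    \<open>crossing Wn\<close>.\<close>
  also have "card (Q \<inter> crossing Wn) + card ?R \<le> card (crossing Wn)"
  proof -
    have "card (Q \<inter> crossing Wn) + card ?R = card (Q \<inter> crossing Wn \<union> ?R)"
      by (rule card_Un_disjoint[symmetric]) (use fin in auto)
    also have "\<dots> \<le> card (crossing Wn)" by (rule card_mono) (use rest in auto)
    finally show ?thesis .
  qed
  finally have "card (rk_arcs ?U) \<le> card (crossing Wn) + card ?R" by simp
  moreover have "card (rk_free ?U) \<le> card (free_names \<inter> Wn)"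
    unfolding Wn_def
  proof (rule order_trans[OF rk_free_blob[of _ "Wu \<union> Wv"]])
    show "?U \<inter> UNIV \<times> (Wu \<union> Wv) = blob (Wu \<union> Wv)" using n_notin by (auto simp: blob_def)
    show "?U \<subseteq> UNIV \<times> insert n (Wu \<union> Wv)" by (auto simp: blob_def)
  qed (auto intro!: card_mono)
  ultimately show ?thesis by (simp add: rk_def)
qed

text \<open>Rank 3 requires all three arcs, hence an index of the tensor beyond each of them and at
  least three indices in total. In this case \<open>bound\<close> is at least 3 even for
  \<open>w = 1\<close>.\<close>

lemma rk_piece:
  assumes "a \<in> crossing Wu \<union> crossing Wv"
  shows "rk {(a, n)} \<le> bound"
proof -
  have 0: "rk_free {(a, n)} = {}" using ix_n by (auto simp: rk_free_def)
  have sub: "rk_arcs {(a, n)} \<subseteq> (\<lambda>e. (a, e)) ` {e \<in> {e1, e2, e3}. e \<in> arcs_of a}"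
  proof
    fix q assume "q \<in> rk_arcs {(a, n)}"
    then obtain e where q: "q = (a, e)" "e \<in> arcs_of a" "touches e n"
      by (auto simp: rk_arcs_def touches_def)
    then show "q \<in> (\<lambda>e. (a, e)) ` {e \<in> {e1, e2, e3}. e \<in> arcs_of a}" using arcs_n[of e] by (auto simp: arcs_of_def)
  qed
  then have "card (rk_arcs {(a, n)}) \<le> card ((\<lambda>e. (a, e)) ` {e \<in> {e1, e2, e3}. e \<in> arcs_of a})"
    by (rule card_mono[rotated]) simp
  also have "\<dots> \<le> card {e \<in> {e1, e2, e3}. e \<in> arcs_of a}" by (rule card_image_le) simp
  finally have le: "rk {(a, n)} \<le> card {e \<in> {e1, e2, e3}. e \<in> arcs_of a}" by (simp add: rk_def 0)
  show ?thesis
  proof (cases "cr a Wu \<and> cr a Wv \<and> cr a Wn")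
    case True
    then obtain i j k where "i \<in> ix a \<inter> Wu" "j \<in> ix a \<inter> Wv" "k \<in> ix a - Wn"
      unfolding cr_def by blast
    then have "{i, j, k} \<subseteq> ix a" "i \<noteq> j" "i \<noteq> k" "j \<noteq> k" using disjoint by (auto simp: Wn_def)
    then have "3 \<le> card (ix a)" using card_mono[of "ix a" "{i, j, k}"] by simp
    then have "3 \<le> bound" using bound_simps(4) assms by (auto simp: crossing_def)
    moreover have "card {e \<in> {e1, e2, e3}. e \<in> arcs_of a} \<le> card {e1, e2, e3}" by (rule card_mono) auto
    ultimately show ?thesis using le arcs_distinct by simp
  next
    case False
    then have "{e \<in> {e1, e2, e3}. e \<in> arcs_of a} \<subset> {e1, e2, e3}" using cross_e by blast
    then have "card {e \<in> {e1, e2, e3}. e \<in> arcs_of a} < card {e1, e2, e3}" by (rule psubset_card_mono[rotated]) simp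
    then show ?thesis using le bound_simps(1) arcs_distinct by simp
  qed
qed

end

text \<open>Exchanging the children turns the estimates for the left child into those for the right
  one; \<open>n\<close>, \<open>e3\<close> and \<open>Wn\<close> stay the same.\<close>

lemma (in cherry) cherry_swap: "cherry Ns vs es w v u n p e2 e1 e3 Wv Wu"
  using pend_u pend_v disjoint n_vs n_inner e3 arcs_n by unfold_locales blast+

lemma absorb_Nil [simp]: "absorb n X [] = X"
  by (simp add: absorb_def)

lemma absorb_snoc [simp]: "absorb n X (as @ [a]) = Node (absorb n X as) (Leaf (a, n))"
  by (simp add: absorb_def)

lemma leaf_list_absorb [simp]: "leaf_list (absorb n X as) = leaf_list X @ map (\<lambda>a. (a, n)) as"
  by (induction as rule: rev_induct) auto

text \<open>Along the spine the subtrees absorb prefixes of \<open>as\<close>. Ranks depend on the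
  set of absorbed pieces only, so the order is forgotten.\<close>

lemma subtrees_absorb:
  assumes "U \<in> subtrees (absorb n X as)"
  shows "U \<in> subtrees X \<or> (\<exists>a\<in>set as. U = Leaf (a, n)) \<or> (\<exists>qs. set qs \<subseteq> set as \<and> U = absorb n X qs)"
  using assms
proof (induction as rule: rev_induct)
  case (snoc a as)
  have "U = absorb n X (as @ [a]) \<or> U \<in> subtrees (absorb n X as) \<or> U = Leaf (a, n)"
    using snoc.prems by auto
  then show ?case
  proof (elim disjE)
    assume "U = absorb n X (as @ [a])"
    then show ?thesis by blast
  next
    assume "U \<in> subtrees (absorb n X as)"
    from snoc.IH[OF this] show ?thesis by auto
  qed auto
qed simp

lemma self_subtree [simp]: "X \<in> subtrees X"
  by (cases X) auto

context network_tree_width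
begin

definition blob_ok :: "('a, 'n) blob \<Rightarrow> 'n set \<Rightarrow> bool" where
  "blob_ok b W \<longleftrightarrow> set (fst (snd b)) = W \<inter> leaf_names \<and> distinct (leaf_list (snd (snd b))) \<and>
     set (leaf_list (snd (snd b))) = blob W \<and>
     (\<forall>U\<in>subtrees (snd (snd b)). rk (set (leaf_list U)) \<le> bound)"

text \<open>The last two conjuncts prepare the tree of each tensor: no dead ends except at leaves,
  and a common vertex \<open>t\<close> to which all of \<open>span a\<close> inside \<open>W\<close>
  is connected. If \<open>a\<close> has indices on both sides of \<open>W\<close>, then
  \<open>t\<close> is the root \<open>v\<close>, through which its part leaves
  \<open>W\<close>.\<close>

definition part_ok :: "'n \<Rightarrow> 'n set \<Rightarrow> bool" where
  "part_ok v W \<longleftrightarrow> (\<exists>e p. pend v e p W) \<and>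
     (\<forall>f\<in>set es. fst f \<in> W \<and> snd f \<in> W \<longrightarrow> (\<exists>C. C \<subseteq> W \<and> side f C)) \<and>
     (\<forall>a. \<forall>x\<in>span a \<inter> W. x \<notin> leaf_names \<longrightarrow> 2 \<le> card {e \<in> arcs_of a. touches e x}) \<and>
     (\<forall>a. \<exists>t. \<forall>x\<in>span a \<inter> W. (x, t) \<in> (adj (arcs_of a))\<^sup>* \<and> (cr a W \<longrightarrow> t = v))"

lemma part_okD:
  assumes "part_ok v W"
  shows "\<exists>e p. pend v e p W"
    "f \<in> set es \<Longrightarrow> fst f \<in> W \<Longrightarrow> snd f \<in> W \<Longrightarrow> \<exists>C. C \<subseteq> W \<and> side f C"
    "x \<in> span a \<Longrightarrow> x \<in> W \<Longrightarrow> x \<notin> leaf_names \<Longrightarrow> 2 \<le> card {e \<in> arcs_of a. touches e x}"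
    "\<exists>t. \<forall>x\<in>span a \<inter> W. (x, t) \<in> (adj (arcs_of a))\<^sup>* \<and> (cr a W \<longrightarrow> t = v)"
  using assms unfolding part_ok_def by blast+

text \<open>Every arc inside \<open>W\<close> has a side contained in \<open>W\<close>, and the arc
  leading out has the side \<open>W\<close>. Without an index in \<open>W\<close> the tensor crosses
  none of them.\<close>

lemma span_empty:
  assumes ok: "part_ok v W" and ix: "ix a \<inter> W = {}"
  shows "span a \<inter> W = {}"
proof (rule ccontr)
  assume "span a \<inter> W \<noteq> {}"
  then obtain x where x: "x \<in> span a" "x \<in> W" by blast
  then obtain f where f: "f \<in> arcs_of a" "touches f x" using ix by (auto simp: span_def)
  obtain e p where e: "pend v e p W" using part_okD(1)[OF ok] by blast
  have fes: "f \<in> set es" "cross a f" using f(1) by (auto simp: arcs_of_def)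
  show False
  proof (cases "f = e")
    case True
    then have "cr a W" using cross_iff[OF pend_side[OF e]] fes by blast
    then show False using ix by (auto simp: cr_def)
  next
    case False
    then have "fst f \<in> W" "snd f \<in> W"
      using pendD(7)[OF e fes(1)] x(2) f(2) by (auto simp: touches_def)
    then obtain C where C: "C \<subseteq> W" "side f C" using part_okD(2)[OF ok fes(1)] by blast
    then have "cr a C" using cross_iff fes(2) by blast
    then show False using C(1) ix by (auto simp: cr_def)
  qed
qed

end

context cherry
begin

lemma part_n:
  assumes ou: "part_ok u Wu" and ov: "part_ok v Wv"
  shows "part_ok n Wn"
  unfolding part_ok_def
proof (intro conjI allI ballI impI)
  show "\<exists>e p. pend n e p Wn" using pend_n by blast
next
  fix f assume f: "f \<in> set es" "fst f \<in> Wn \<and> snd f \<in> Wn"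
  have "f \<noteq> e3" using f(2) e3 by (auto simp: joins_def Wn_def)
  show "\<exists>C. C \<subseteq> Wn \<and> side f C"
  proof (cases "f = e1 \<or> f = e2")
    case True
    then show ?thesis using pend_side[OF pend_u] pend_side[OF pend_v] by (auto simp: Wn_def)
  next
    case False
    then have "fst f \<noteq> n" "snd f \<noteq> n" using outside_Wn(2,3)[OF f(1)] \<open>f \<noteq> e3\<close> by auto
    then have "fst f \<in> Wu \<and> snd f \<in> Wu \<or> fst f \<in> Wv \<and> snd f \<in> Wv"
      using f(2) pendD(7)[OF pend_u f(1)] pendD(7)[OF pend_v f(1)] False unfolding Wn_def by blast
    then show ?thesis using part_okD(2)[OF ou f(1)] part_okD(2)[OF ov f(1)] unfolding Wn_def by blast
  qed
next
  fix a x assume x: "x \<in> span a \<inter> Wn" "x \<notin> leaf_names"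
  then consider "x = n" | "x \<in> Wu" | "x \<in> Wv" unfolding Wn_def by blast
  then show "2 \<le> card {e \<in> arcs_of a. touches e x}"
    using x degree_n part_okD(3)[OF ou] part_okD(3)[OF ov] by cases auto
next
  fix a
  let ?R = "(adj (arcs_of a))\<^sup>*"
  obtain s where s: "\<And>x. x \<in> span a \<inter> Wu \<Longrightarrow> (x, s) \<in> ?R \<and> (cr a Wu \<longrightarrow> s = u)"
    using part_okD(4)[OF ou, of a] by blast
  obtain t where t: "\<And>x. x \<in> span a \<inter> Wv \<Longrightarrow> (x, t) \<in> ?R \<and> (cr a Wv \<longrightarrow> t = v)"
    using part_okD(4)[OF ov, of a] by blast
  have un: "(u, n) \<in> ?R" if "cr a Wu"
    using adj_edge[OF _ pendD(2)[OF pend_u]] that cross_e(1) by blast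
  have vn: "(v, n) \<in> ?R" if "cr a Wv"
    using adj_edge[OF _ pendD(2)[OF pend_v]] that cross_e(2) by blast
  have eu: "span a \<inter> Wu = {}" if "ix a \<inter> Wu = {}" by (rule span_empty[OF ou that])
  have ev: "span a \<inter> Wv = {}" if "ix a \<inter> Wv = {}" by (rule span_empty[OF ov that])
  have toward_n: "(x, n) \<in> ?R"
    if "x \<in> span a" "x \<in> Wn" "x \<in> Wu \<Longrightarrow> cr a Wu" "x \<in> Wv \<Longrightarrow> cr a Wv" for x
  proof -
    from that(2) consider "x = n" | "x \<in> Wu" | "x \<in> Wv" unfolding Wn_def by blast
    then show ?thesis
    proof cases
      case 2
      then have "(x, u) \<in> ?R" using s that by blast
      then show ?thesis using un that(3) 2 rtrancl_trans by fast
    next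
      case 3
      then have "(x, v) \<in> ?R" using t that by blast
      then show ?thesis using vn that(4) 3 rtrancl_trans by fast
    qed simp
  qed
  show "\<exists>t. \<forall>x\<in>span a \<inter> Wn. (x, t) \<in> ?R \<and> (cr a Wn \<longrightarrow> t = n)"
  proof (cases "cr a Wu \<or> cr a Wv \<or> cr a Wn")
    case True
    have "(x, n) \<in> ?R" if x: "x \<in> span a" "x \<in> Wn" for x
    proof (rule toward_n[OF x])
      \<comment> \<open>A tensor that crosses some arc at \<open>n\<close> has indices outside each
        of the two subtrees. If it has a vertex in one of them it also has an index there by
        \<open>span_empty\<close>, so it crosses the arc from that subtree to
        \<open>n\<close>.\<close>
      have o: "ix a - Wu \<noteq> {}" "ix a - Wv \<noteq> {}"
        using True disjoint unfolding cr_def Wn_def by blast+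
      show "cr a Wu" if "x \<in> Wu" using eu that x(1) o(1) unfolding cr_def by blast
      show "cr a Wv" if "x \<in> Wv" using ev that x(1) o(2) unfolding cr_def by blast
    qed
    then show ?thesis by blast
  next
    case False
    then have n: "n \<notin> span a" using n_span by blast
    \<comment> \<open>No arc at \<open>n\<close> is crossed, so at most one of the two subtrees
      contains indices of \<open>a\<close>, and the tree of \<open>a\<close> within
      \<open>Wn\<close> stays inside that subtree.\<close>
    have "ix a \<inter> Wu = {} \<or> ix a \<inter> Wv = {}" using False disjoint unfolding cr_def by blast
    then show ?thesis
    proof
      assume "ix a \<inter> Wu = {}"
      then have "span a \<inter> Wn \<subseteq> span a \<inter> Wv" using eu n by (auto simp: Wn_def)
      then show ?thesis using t False by blast
    next
      assume "ix a \<inter> Wv = {}"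
      then have "span a \<inter> Wn \<subseteq> span a \<inter> Wu" using ev n by (auto simp: Wn_def)
      then show ?thesis using s False by blast
    qed
  qed
qed

text \<open>By \<open>two_of_three\<close> a tensor with a piece at \<open>n\<close> crosses at
  least one of the two child arcs, so its piece can be absorbed into a child.\<close>

lemma blob_n: "blob Wn = blob Wu \<union> blob Wv \<union> (\<lambda>a. (a, n)) ` (crossing Wu \<union> crossing Wv)"
  using n_span two_of_three(1) n_notin by (auto simp: blob_def Wn_def crossing_def)

lemma set_owners_crosses:
  assumes "set \<beta> = Wu \<inter> leaf_names" "set \<gamma> = Wv \<inter> leaf_names" "set \<delta> = Wn \<inter> leaf_names"
  shows "set (owners Ns (\<lambda>js. crosses js \<beta> \<and> crosses js \<gamma> \<and> crosses js \<delta>)) =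
      crossing Wu \<inter> crossing Wv \<inter> crossing Wn"
    "set (owners Ns (\<lambda>js. crosses js \<beta> \<and> \<not> (crosses js \<gamma> \<and> crosses js \<delta>))) =
      crossing Wu - (crossing Wv \<inter> crossing Wn)"
    "set (owners Ns (\<lambda>js. crosses js \<gamma> \<and> \<not> crosses js \<beta>)) = crossing Wv - crossing Wu"
proof -
  note iff = crosses_iff[OF _ assms(1)] crosses_iff[OF _ assms(2)] crosses_iff[OF _ assms(3)]
  have "set (owners Ns (\<lambda>js. crosses js \<beta> \<and> crosses js \<gamma> \<and> crosses js \<delta>)) =
      {a \<in> ids. cr a Wu \<and> cr a Wv \<and> cr a Wn}"
    by (rule owners_iff) (simp add: iff)
  then show "set (owners Ns (\<lambda>js. crosses js \<beta> \<and> crosses js \<gamma> \<and> crosses js \<delta>)) =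
      crossing Wu \<inter> crossing Wv \<inter> crossing Wn" by (auto simp: crossing_def)
  have "set (owners Ns (\<lambda>js. crosses js \<beta> \<and> \<not> (crosses js \<gamma> \<and> crosses js \<delta>))) =
      {a \<in> ids. cr a Wu \<and> \<not> (cr a Wv \<and> cr a Wn)}"
    by (rule owners_iff) (simp add: iff)
  then show "set (owners Ns (\<lambda>js. crosses js \<beta> \<and> \<not> (crosses js \<gamma> \<and> crosses js \<delta>))) =
      crossing Wu - (crossing Wv \<inter> crossing Wn)" by (auto simp: crossing_def)
  have "set (owners Ns (\<lambda>js. crosses js \<gamma> \<and> \<not> crosses js \<beta>)) = {a \<in> ids. cr a Wv \<and> \<not> cr a Wu}"
    by (rule owners_iff) (simp add: iff)
  then show "set (owners Ns (\<lambda>js. crosses js \<gamma> \<and> \<not> crosses js \<beta>)) = crossing Wv - crossing Wu"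
    by (auto simp: crossing_def)
qed

text \<open>\<open>(w + 2) div 3\<close> is \<open>\<lceil>w / 3\<rceil>\<close>. The list
  \<open>as\<close> may contain any number of tensors that miss an arc; only those in
  \<open>K\<close> cost an index.\<close>

lemma rk_absorb_child:
  assumes X: "set (leaf_list X) = blob Wu" "\<And>U. U \<in> subtrees X \<Longrightarrow> rk (set (leaf_list U)) \<le> bound"
    and as: "set as \<subseteq> crossing Wu" "set as \<inter> crossing Wv \<inter> crossing Wn \<subseteq> set K"
    and K: "length K \<le> (w + 2) div 3"
    and le: "card (crossing Wu) + card (free_names \<inter> Wu) \<le> w"
    and U: "U \<in> subtrees (absorb n X as)"
  shows "rk (set (leaf_list U)) \<le> bound"
  using subtrees_absorb[OF U]
proof (elim disjE bexE exE conjE)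
  fix a assume "a \<in> set as" "U = Leaf (a, n)"
  then show ?thesis using rk_piece as(1) by auto
next
  fix qs assume qs: "set qs \<subseteq> set as" "U = absorb n X qs"
  have "rk (set (leaf_list U)) \<le> card (crossing Wu) + card (set qs \<inter> crossing Wv \<inter> crossing Wn) + card (free_names \<inter> Wu)"
    using rk_child[of "set qs"] qs as(1) X(1) by (simp add: subset_trans)
  moreover have "card (set qs \<inter> crossing Wv \<inter> crossing Wn) \<le> card (set K)"
    by (rule card_mono) (use qs as(2) in auto)
  moreover have "card (set K) \<le> length K" by (rule card_length)
  ultimately show ?thesis using K le bound_simps(2) by linarith
qed (rule X(2))

text \<open>\<open>t = card (crossing Wu \<inter> crossing Wv \<inter> crossing Wn)\<close> pieces have all three arcs. The left child
  takes \<open>K\<close> of them and the right child takes \<open>L\<close>; the remaining \<open>M\<close>, at most \<open>t div 3\<close>, have both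
  child arcs open when the children are contracted.\<close>

lemma merge_tree_ok:
  assumes X: "blob_ok (u, \<beta>, X) Wu" and Y: "blob_ok (v, \<gamma>, Y) Wv"
    and d: "set \<delta> = Wn \<inter> leaf_names"
    and lu: "card (crossing Wu) + card (free_names \<inter> Wu) \<le> w"
    and lv: "card (crossing Wv) + card (free_names \<inter> Wv) \<le> w"
    and ln: "card (crossing Wn) + card (free_names \<inter> Wn) \<le> w \<or>
      card (crossing Wn) + card (free_names \<inter> Wn) \<le> w + 1 \<and> card (crossing Wu) < w"
  shows "blob_ok (n, \<delta>, merge_tree Ns n \<beta> \<gamma> \<delta> X Y) Wn"
proof -
  have b: "set \<beta> = Wu \<inter> leaf_names" and c: "set \<gamma> = Wv \<inter> leaf_names"
    and lX: "distinct (leaf_list X)" "set (leaf_list X) = blob Wu"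
    and lY: "distinct (leaf_list Y)" "set (leaf_list Y) = blob Wv"
    and rX: "\<And>U. U \<in> subtrees X \<Longrightarrow> rk (set (leaf_list U)) \<le> bound"
    and rY: "\<And>U. U \<in> subtrees Y \<Longrightarrow> rk (set (leaf_list U)) \<le> bound"
    using X Y by (auto simp: blob_ok_def)
  interpret swap: cherry Ns vs es w v u n p e2 e1 e3 Wv Wu by (rule cherry_swap)
  have swap_n: "swap.Wn = Wn" by (auto simp: Wn_def swap.Wn_def)
  define T where "T = owners Ns (\<lambda>js. crosses js \<beta> \<and> crosses js \<gamma> \<and> crosses js \<delta>)"
  define P where "P = owners Ns (\<lambda>js. crosses js \<beta> \<and> \<not> (crosses js \<gamma> \<and> crosses js \<delta>))"
  define Q where "Q = owners Ns (\<lambda>js. crosses js \<gamma> \<and> \<not> crosses js \<beta>)"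
  have sets: "set T = crossing Wu \<inter> crossing Wv \<inter> crossing Wn"
    "set P = crossing Wu - (crossing Wv \<inter> crossing Wn)" "set Q = crossing Wv - crossing Wu"
    unfolding T_def P_def Q_def by (rule set_owners_crosses[OF b c d])+
  have dist: "distinct T" "distinct P" "distinct Q"
    unfolding T_def P_def Q_def by (rule distinct_owners)+
  obtain M K L where split: "split3 T = (M, K, L)" using prod_cases3 by blast
  note sp = split3_props[OF split]
  have lenT: "length T \<le> card (crossing Wu)"
    using distinct_card[OF dist(1)] sets(1) by (metis Int_assoc Int_lower1 card_mono finite_crossing)
  have len: "length K \<le> (w + 2) div 3" "length L \<le> (w + 2) div 3" "length M \<le> w div 3"
    using lenT lu sp(2-5) by linarith+
  \<comment> \<open>\<open>(w - 1) div 3\<close> equals \<open>\<lceil>w / 3\<rceil> - 1\<close>,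
    which makes up for the additional index in the second alternative of \<open>ln\<close>.\<close>
  have lenM: "length M \<le> (w - 1) div 3" if "card (crossing Wu) < w"
    using lenT that sp(2-5) by linarith
  let ?A = "absorb n X (P @ K)" and ?B = "absorb n Y (Q @ L)"
  have tree: "merge_tree Ns n \<beta> \<gamma> \<delta> X Y = absorb n (Node ?A ?B) M"
    by (simp only: merge_tree_def Let_def split fst_conv snd_conv flip: T_def P_def Q_def)
  have PQ: "set P \<union> set K \<union> set Q \<union> set L \<union> set M = crossing Wu \<union> crossing Wv"
    using sets sp(1) by auto
  have "blob Wu \<inter> blob Wv = {}" "blob Wu \<inter> UNIV \<times> {n} = {}" "blob Wv \<inter> UNIV \<times> {n} = {}"
    using disjoint n_notin by (auto simp: blob_def)
  moreover have "distinct (P @ K @ Q @ L @ M)"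
    using dist sp(1) sp(6)[OF dist(1)] sets by auto
  ultimately have distinct: "distinct (leaf_list (absorb n (Node ?A ?B) M))"
    using lX lY by (auto simp: distinct_map inj_on_def)
  have set: "set (leaf_list (absorb n (Node ?A ?B) M)) = blob Wn"
    using lX(2) lY(2) PQ blob_n by auto
  have root: "rk (set (leaf_list (absorb n (Node ?A ?B) qs))) \<le> bound" if qs: "set qs \<subseteq> set M" for qs
  proof -
    let ?Q = "set P \<union> set K \<union> set Q \<union> set L \<union> set qs"
    have rest: "crossing Wu \<union> crossing Wv - ?Q \<subseteq> set M" using PQ by blast
    have "set (leaf_list (absorb n (Node ?A ?B) qs)) = blob Wu \<union> blob Wv \<union> (\<lambda>a. (a, n)) ` ?Q"
      using lX(2) lY(2) by auto
    then have "rk (set (leaf_list (absorb n (Node ?A ?B) qs)))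
        \<le> card (crossing Wn) + card (crossing Wu \<union> crossing Wv - ?Q) + card (free_names \<inter> Wn)"
    proof (simp only:, intro rk_merged)
      show "?Q \<subseteq> crossing Wu \<union> crossing Wv" using PQ qs by blast
      show "crossing Wu \<union> crossing Wv - ?Q \<subseteq> crossing Wu \<inter> crossing Wv \<inter> crossing Wn"
        using rest sets(1) sp(1) by blast
    qed
    moreover have "card (crossing Wu \<union> crossing Wv - ?Q) \<le> card (set M)"
      by (rule card_mono) (use rest in auto)
    moreover have "card (set M) \<le> length M" by (rule card_length)
    ultimately show ?thesis using ln len(3) lenM bound_simps(2) w_pos by linarith
  qed
  have "rk (set (leaf_list U)) \<le> bound" if U: "U \<in> subtrees (absorb n (Node ?A ?B) M)" for U
    using subtrees_absorb[OF U]
  proof (elim disjE bexE exE conjE)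
    assume "U \<in> subtrees (Node ?A ?B)"
    then consider "U = absorb n (Node ?A ?B) []" | "U \<in> subtrees ?A" | "U \<in> subtrees ?B" by auto
    then show ?thesis
    proof cases
      case 2
      then show ?thesis
        by (rule rk_absorb_child[OF lX(2) rX _ _ len(1) lu, rotated -1]) (use sets sp(1) in auto)
    next
      case 3
      then show ?thesis
        by (rule swap.rk_absorb_child[OF lY(2) rY _ _ len(2) lv, unfolded swap_n, rotated -1])
          (use sets sp(1) in auto)
    next
      case 1
      then show ?thesis using root[of "[]"] by simp
    qed
  next
    fix a assume "a \<in> set M" "U = Leaf (a, n)"
    then show ?thesis using rk_piece[of a] sets sp(1) by auto
  next
    fix qs assume qs: "set qs \<subseteq> set M" "U = absorb n (Node ?A ?B) qs"
    then show ?thesis using root by simp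
  qed
  then show ?thesis unfolding blob_ok_def tree using distinct set d by simp
qed

end

text \<open>If at most one fibre had two elements and the others at most one, then \<open>V\<close>
  would have at most \<open>card U + 1\<close> elements.\<close>

lemma two_fibres:
  assumes fin: "finite V" "finite U" and f: "f ` V \<subseteq> U" and card: "card U + 2 \<le> card V"
    and le: "\<And>n. n \<in> U \<Longrightarrow> card {v \<in> V. f v = n} \<le> 2"
  obtains m n u v x y where "m \<noteq> n" "u \<in> V" "v \<in> V" "u \<noteq> v" "f u = m" "f v = m"
    "x \<in> V" "y \<in> V" "x \<noteq> y" "f x = n" "f y = n"
proof -
  let ?F = "\<lambda>n. {v \<in> V. f v = n}"
  have sum: "card V = (\<Sum>n\<in>U. card (?F n))"
    using sum.group[OF fin f, of "\<lambda>_. 1 :: nat"] by simp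
  have two: "\<exists>u v. u \<in> V \<and> v \<in> V \<and> u \<noteq> v \<and> f u = n \<and> f v = n" if "\<not> card (?F n) \<le> 1" for n
  proof -
    have "2 \<le> card (?F n)" using that by linarith
    then obtain S where "S \<subseteq> ?F n" "card S = 2" using obtain_subset_with_card_n by metis
    then obtain u v where "u \<noteq> v" "{u, v} \<subseteq> ?F n" using card_2_iff by metis
    then show ?thesis by auto
  qed
  have "\<exists>m\<in>U. \<not> card (?F m) \<le> 1"
  proof (rule ccontr)
    assume "\<not> ?thesis"
    then have "(\<Sum>n\<in>U. card (?F n)) \<le> (\<Sum>n\<in>U. 1)" by (intro sum_mono) auto
    then show False using sum card by simp
  qed
  then obtain m where m: "m \<in> U" "\<not> card (?F m) \<le> 1" by blast
  have "\<exists>n\<in>U - {m}. \<not> card (?F n) \<le> 1"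
  proof (rule ccontr)
    assume "\<not> ?thesis"
    then have "(\<Sum>n\<in>U - {m}. card (?F n)) \<le> (\<Sum>n\<in>U - {m}. 1)" by (intro sum_mono) auto
    moreover have "(\<Sum>n\<in>U. card (?F n)) = card (?F m) + (\<Sum>n\<in>U - {m}. card (?F n))"
      by (rule sum.remove[OF fin(2) m(1)])
    moreover have "card (U - {m}) + 1 = card U" using card_Suc_Diff1[OF fin(2) m(1)] by simp
    ultimately show False using sum card le[OF m(1)] by simp
  qed
  then obtain n where n: "n \<in> U" "n \<noteq> m" "\<not> card (?F n) \<le> 1" by blast
  show ?thesis using two[OF m(2)] two[OF n(3)] n(2) that by metis
qed

section \<open>Partitions into subtrees and the existence of cherries\<close>

context network_tree_width
begin

text \<open>\<open>V\<close> holds the roots of the current subtrees and \<open>W v\<close> the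
  vertices of the subtree at \<open>v\<close>. Shrinking every subtree to a leaf leaves a tree with
  \<open>card V\<close> leaves whose inner vertices have degree 3; the last inequality bounds the
  number of these inner vertices.\<close>

definition cover :: "'n set \<Rightarrow> ('n \<Rightarrow> 'n set) \<Rightarrow> 'n arc set \<Rightarrow> bool" where
  "cover V W E \<longleftrightarrow> finite V \<and> (\<forall>v\<in>V. part_ok v (W v)) \<and>
     (\<forall>u\<in>V. \<forall>v\<in>V. u \<noteq> v \<longrightarrow> W u \<inter> W v = {}) \<and>
     E = {e \<in> set es. \<forall>v\<in>V. \<not> (fst e \<in> W v \<and> snd e \<in> W v)} \<and>
     leaf_names \<subseteq> \<Union> (W ` V) \<and> card (set vs - \<Union> (W ` V)) + 2 \<le> card V"

lemma coverD:
  assumes "cover V W E"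
  shows "finite V" "\<And>v. v \<in> V \<Longrightarrow> part_ok v (W v)"
    "\<And>u v. u \<in> V \<Longrightarrow> v \<in> V \<Longrightarrow> u \<noteq> v \<Longrightarrow> W u \<inter> W v = {}"
    "E = {e \<in> set es. \<forall>v\<in>V. \<not> (fst e \<in> W v \<and> snd e \<in> W v)}"
    "leaf_names \<subseteq> \<Union> (W ` V)" "card (set vs - \<Union> (W ` V)) + 2 \<le> card V"
  using assms unfolding cover_def by blast+

lemma cover_pend:
  assumes "cover V W E" "v \<in> V"
  obtains e p where "pend v e p (W v)" "e \<in> E"
proof -
  obtain e p where e: "pend v e p (W v)" using part_okD(1)[OF coverD(2)[OF assms]] by blast
  have "\<not> (fst e \<in> W x \<and> snd e \<in> W x)" if "x \<in> V" for x
  proof (cases "x = v")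
    case True
    then show ?thesis using pendD(2,4)[OF e] by (auto simp: joins_def)
  next
    case False
    then have "v \<notin> W x" using coverD(3)[OF assms(1) that assms(2)] pendD(3)[OF e] by blast
    then show ?thesis using pendD(2)[OF e] by (auto simp: joins_def)
  qed
  then have "e \<in> E" unfolding coverD(4)[OF assms(1)] using pendD(1)[OF e] by blast
  then show ?thesis using e that by blast
qed

lemma cover_self: "cover V W E \<Longrightarrow> v \<in> V \<Longrightarrow> v \<in> W v"
  using cover_pend pendD(3) by metis

lemma cover_sub: "cover V W E \<Longrightarrow> v \<in> V \<Longrightarrow> W v \<subseteq> set vs"
  using cover_pend pendD(5) by metis

lemma cover_arc:
  assumes c: "cover V W E" and v: "v \<in> V" and e: "e \<in> E" "joins e v n"
  shows "pend v e n (W v)"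
proof -
  obtain f p where f: "pend v f p (W v)" using cover_pend[OF c v] by blast
  have es: "e \<in> set es" and ns: "\<not> (fst e \<in> W v \<and> snd e \<in> W v)"
    using e(1) v unfolding coverD(4)[OF c] by blast+
  have vW: "v \<in> W v" using cover_self[OF c v] .
  then have "n \<notin> W v" using ns joins_both[OF e(2), of "W v"] by blast
  from pend_boundary[OF f es e(2) vW this] show ?thesis using f by simp
qed

lemma cover_cherry:
  assumes c: "cover V W E" and u: "u \<in> V" and v: "v \<in> V" and uv: "u \<noteq> v"
    and e: "e \<in> E" "joins e u n" and f: "f \<in> E" "joins f v n"
  obtains p g where "cherry Ns vs es w u v n p e f g (W u) (W v)" "n \<notin> \<Union> (W ` V)"
proof -
  have pu: "pend u e n (W u)" and pv: "pend v f n (W v)"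
    using cover_arc[OF c u e] cover_arc[OF c v f] .
  have es: "e \<in> set es" "f \<in> set es" using pendD(1)[OF pu] pendD(1)[OF pv] .
  have ef: "e \<noteq> f" using e(2) f(2) uv by (auto simp: joins_def)
  have disj: "W u \<inter> W v = {}" using coverD(3)[OF c u v uv] .
  \<comment> \<open>Only one arc leaves a subtree. If \<open>n\<close> were in \<open>W x\<close>,
    the arcs from \<open>n\<close> to \<open>u\<close> and to \<open>v\<close> would both leave it
    and would have the same outer end.\<close>
  have nW: "n \<notin> W x" if x: "x \<in> V" for x
  proof
    assume n: "n \<in> W x"
    have xu: "x \<noteq> u" and xv: "x \<noteq> v" using n pendD(4)[OF pu] pendD(4)[OF pv] by auto
    obtain g q where g: "pend x g q (W x)" using cover_pend[OF c x] by blast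
    have "u \<notin> W x" "v \<notin> W x"
      using coverD(3)[OF c x u xu] coverD(3)[OF c x v xv] cover_self[OF c u] cover_self[OF c v] by blast+
    then have "u = q" "v = q"
      using pend_boundary(3)[OF g es(1) iffD1[OF joins_sym e(2)] n]
        pend_boundary(3)[OF g es(2) iffD1[OF joins_sym f(2)] n] by blast+
    then show False using uv by simp
  qed
  then have n: "n \<notin> \<Union> (W ` V)" by blast
  have n_leaf: "n \<notin> leaf_names" using n coverD(5)[OF c] by blast
  have n_vs: "n \<in> set vs" using arcs[OF es(1)] e(2) by (auto simp: joins_def)
  let ?S = "{e \<in> set es. touches e n}"
  have "{e, f} \<subseteq> ?S" using es e(2) f(2) by (auto simp: joins_def touches_def)
  then have "card (?S - {e, f}) = 1"
    using degree_inner[OF n_vs n_leaf] ef card_Diff_subset[of "{e, f}" ?S] by simp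
  then obtain g where g: "?S - {e, f} = {g}" using card_1_singletonE by metis
  then have gS: "g \<in> set es" "touches g n" "g \<noteq> e" "g \<noteq> f" by blast+
  define p where "p = (if fst g = n then snd g else fst g)"
  have p: "joins g n p" "p \<noteq> n" using gS(2) arcs[OF gS(1)] unfolding joins_def touches_def p_def by auto
  have "p \<notin> W u"
    using pend_boundary(1)[OF pu gS(1) iffD1[OF joins_sym p(1)] _ pendD(4)[OF pu]] gS(3) by blast
  moreover have "p \<notin> W v"
    using pend_boundary(1)[OF pv gS(1) iffD1[OF joins_sym p(1)] _ pendD(4)[OF pv]] gS(4) by blast
  moreover have "h = e \<or> h = f \<or> h = g" if "h \<in> set es" "touches h n" for h
    using g that by blast
  ultimately have "cherry Ns vs es w u v n p e f g (W u) (W v)"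
    using pu pv disj n_vs n_leaf gS(1) p by unfold_locales
  then show ?thesis using n that by blast
qed

text \<open>If the outer neighbour of a root lay in another subtree, no arc would leave the union of
  the two. By connectedness they would cover everything, and there would be no third
  subtree.\<close>

lemma cover_neighbour:
  assumes c: "cover V W E" and V: "3 \<le> card V" and v: "v \<in> V"
  obtains e n where "e \<in> E" "joins e v n" "n \<in> set vs - \<Union> (W ` V)"
proof -
  obtain e p where e: "pend v e p (W v)" "e \<in> E" using cover_pend[OF c v] by blast
  have "p \<notin> W x" if x: "x \<in> V" for x
  proof
    assume p: "p \<in> W x"
    then have xv: "x \<noteq> v" using pendD(4)[OF e(1)] by blast
    obtain g q where g: "pend x g q (W x)" using cover_pend[OF c x] by blast
    have "v \<notin> W x" using coverD(3)[OF c x v xv] pendD(3)[OF e(1)] by blast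
    then have ge: "e = g" using pend_boundary[OF g pendD(1)[OF e(1)] iffD1[OF joins_sym pendD(2)[OF e(1)]] p] by blast
    have "W v \<union> W x = set vs"
    proof (rule closed_all)
      show "W v \<union> W x \<subseteq> set vs" using cover_sub[OF c] v x by blast
      show "v \<in> W v \<union> W x" using pendD(3)[OF e(1)] by blast
      fix f assume f: "f \<in> set es"
      show "fst f \<in> W v \<union> W x \<longleftrightarrow> snd f \<in> W v \<union> W x"
      proof (cases "f = e")
        case True
        then show ?thesis using pendD(2,3)[OF e(1)] p by (auto simp: joins_def)
      next
        case False
        then show ?thesis using pendD(7)[OF e(1) f] pendD(7)[OF g f] ge by blast
      qed
    qed
    have "card {v, x} < card V" using V card_insert_le_m1[of 2 "{x}" v] by (simp add: le_less_trans)
    then have "\<not> V \<subseteq> {v, x}" using card_mono[of "{v, x}" V] by auto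
    then obtain y where y: "y \<in> V" "y \<noteq> v" "y \<noteq> x" by blast
    then have "y \<in> W v \<union> W x" using cover_sub[OF c y(1)] cover_self[OF c y(1)] \<open>W v \<union> W x = set vs\<close> by blast
    then show False using coverD(3)[OF c y(1) v y(2)] coverD(3)[OF c y(1) x y(3)] cover_self[OF c y(1)] by blast
  qed
  moreover have "p \<in> set vs" using arcs[OF pendD(1)[OF e(1)]] pendD(2)[OF e(1)] by (auto simp: joins_def)
  ultimately show ?thesis using that[OF e(2) pendD(2)[OF e(1)]] by blast
qed

text \<open>The three subtrees use up the three arcs at \<open>n\<close>, so together with
  \<open>n\<close> they form a set that no arc leaves, and this set is everything.\<close>

lemma cover_three:
  assumes c: "cover V W E" and V: "{x, y, z} \<subseteq> V" "x \<noteq> y" "x \<noteq> z" "y \<noteq> z"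
    and e: "e \<in> E" "joins e x n" and f: "f \<in> E" "joins f y n" and g: "g \<in> E" "joins g z n"
  shows "V = {x, y, z}"
proof (rule ccontr)
  have xV: "x \<in> V" and yV: "y \<in> V" and zV: "z \<in> V" using V(1) by auto
  assume "V \<noteq> {x, y, z}"
  then obtain t where t: "t \<in> V" "t \<noteq> x" "t \<noteq> y" "t \<noteq> z" using V by blast
  obtain p h where "cherry Ns vs es w x y n p e f h (W x) (W y)" and n: "n \<notin> \<Union> (W ` V)"
    using cover_cherry[OF c xV yV V(2) e f] by metis
  then interpret cherry Ns vs es w x y n p e f h "W x" "W y" by simp
  have px: "pend x e n (W x)" and py: "pend y f n (W y)" and pz: "pend z g n (W z)"
    using cover_arc[OF c xV e] cover_arc[OF c yV f] cover_arc[OF c zV g] .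
  have "g \<noteq> e" "g \<noteq> f" using e(2) f(2) g(2) V by (auto simp: joins_def)
  moreover have "touches g n" using g(2) by (auto simp: joins_def touches_def)
  ultimately have gh: "g = h" using arcs_n[of g] pendD(1)[OF pz] by blast
  let ?S = "insert n (W x \<union> W y \<union> W z)"
  have "?S = set vs"
  proof (rule closed_all)
    show "?S \<subseteq> set vs" using n_vs cover_sub[OF c] xV yV zV by blast
    show "n \<in> ?S" by blast
    fix k assume k: "k \<in> set es"
    show "fst k \<in> ?S \<longleftrightarrow> snd k \<in> ?S"
    proof (cases "k = e \<or> k = f \<or> k = g")
      case True
      then show ?thesis using pendD(2,3)[OF px] pendD(2,3)[OF py] pendD(2,3)[OF pz]
        by (auto simp: joins_def)
    next
      case False
      then have "\<not> touches k n" using arcs_n[OF k] gh by blast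
      then have "fst k \<noteq> n" "snd k \<noteq> n" by (auto simp: touches_def)
      then show ?thesis using pendD(7)[OF px k] pendD(7)[OF py k] pendD(7)[OF pz k] False by blast
    qed
  qed
  then have "t \<in> ?S" using cover_sub[OF c t(1)] cover_self[OF c t(1)] by blast
  then show False
    using coverD(3)[OF c t(1) xV t(2)] coverD(3)[OF c t(1) yV t(3)] coverD(3)[OF c t(1) zV t(4)]
      cover_self[OF c t(1)] n t(1) by blast
qed

definition good_pair :: "'n set \<Rightarrow> 'n set \<Rightarrow> bool" where
  "good_pair A B \<longleftrightarrow> (free_names \<inter> A = {} \<or> free_names \<inter> B = {}) \<and>
     (free_names = {} \<or> \<not> free_names \<subseteq> A \<union> B)"

definition is_cherry :: "'n arc set \<Rightarrow> 'n set \<Rightarrow> 'n \<Rightarrow> 'n \<Rightarrow> 'n \<Rightarrow> bool" where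
  "is_cherry E V u v n \<longleftrightarrow> u \<in> V \<and> v \<in> V \<and> u \<noteq> v \<and> (\<exists>e\<in>E. joins e u n) \<and> (\<exists>e\<in>E. joins e v n)"

text \<open>With at least four subtrees left there are two disjoint cherries. A cherry is not good if
  it contains two free indices or all free indices; both cannot happen to both cherries as there are at
  most three free indices.\<close>

lemma progress:
  assumes c: "cover V W E" and V: "4 \<le> card V"
  shows "\<exists>u v n. is_cherry E V u v n \<and> good_pair (W u) (W v)"
proof -
  let ?U = "set vs - \<Union> (W ` V)"
  have "\<exists>n. n \<in> ?U \<and> (\<exists>e\<in>E. joins e v n)" if "v \<in> V" for v
  proof -
    have "3 \<le> card V" using V by simp
    obtain e n where "e \<in> E" "joins e v n" "n \<in> ?U" by (rule cover_neighbour[OF c \<open>3 \<le> card V\<close> \<open>v \<in> V\<close>])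
    then show ?thesis by (intro exI[of _ n] conjI bexI[of _ e])
  qed
  then obtain f where f: "\<And>v. v \<in> V \<Longrightarrow> f v \<in> ?U \<and> (\<exists>e\<in>E. joins e v (f v))" by metis
  have le: "card {v \<in> V. f v = n} \<le> 2" for n
  proof (rule ccontr)
    assume "\<not> ?thesis"
    then have "3 \<le> card {v \<in> V. f v = n}" by linarith
    then obtain S where "S \<subseteq> {v \<in> V. f v = n}" "card S = 3" using obtain_subset_with_card_n by metis
    then obtain x y z where xyz: "{x, y, z} \<subseteq> {v \<in> V. f v = n}" "x \<noteq> y" "x \<noteq> z" "y \<noteq> z"
      using card_3_iff by metis
    then have "x \<in> V" "y \<in> V" "z \<in> V" "f x = n" "f y = n" "f z = n" by auto
    then obtain e1 e2 e3 where "e1 \<in> E" "joins e1 x n" "e2 \<in> E" "joins e2 y n" "e3 \<in> E" "joins e3 z n"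
      using f[of x] f[of y] f[of z] by metis
    then have "V = {x, y, z}" using cover_three[OF c _ xyz(2-4)] xyz(1) by blast
    then show False using V xyz(2-4) by simp
  qed
  \<comment> \<open>\<open>f\<close> sends each root to its uncovered neighbour. By the inequality
    in \<open>cover\<close> and the bound \<open>le\<close> on fibres, two different vertices are
    hit twice.\<close>
  obtain m n u v x y where *: "m \<noteq> n" "u \<in> V" "v \<in> V" "u \<noteq> v" "f u = m" "f v = m"
    "x \<in> V" "y \<in> V" "x \<noteq> y" "f x = n" "f y = n"
    by (rule two_fibres[where f = f, OF coverD(1)[OF c] _ _ coverD(6)[OF c] le]) (use f in auto)
  have ch: "is_cherry E V u v m" "is_cherry E V x y n"
    using * f[of u] f[of v] f[of x] f[of y] by (simp_all add: is_cherry_def)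
  have ne: "u \<noteq> x" "u \<noteq> y" "v \<noteq> x" "v \<noteq> y" using * by auto
  have "good_pair (W u) (W v) \<or> good_pair (W x) (W y)"
  proof (rule ccontr)
    assume bad: "\<not> ?thesis"
    have d: "W u \<inter> W v = {}" "W x \<inter> W y = {}" "W u \<inter> W x = {}" "W u \<inter> W y = {}" "W v \<inter> W x = {}" "W v \<inter> W y = {}"
      using coverD(3)[OF c] * ne by auto
    \<comment> \<open>If a pair is not good because it contains all free indices, a disjoint pair
      contains none of them and is good. So two disjoint bad pairs are both bad for the other
      reason, and four free indices appear.\<close>
    have pair: "free_names \<inter> A \<noteq> {} \<and> free_names \<inter> B \<noteq> {}"
      if "\<not> good_pair A B" "\<not> good_pair A' B'" "A \<inter> A' = {}" "A \<inter> B' = {}" "B \<inter> A' = {}" "B \<inter> B' = {}"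
      for A B A' B'
      using that unfolding good_pair_def by blast
    have "free_names \<inter> W u \<noteq> {}" "free_names \<inter> W v \<noteq> {}" "free_names \<inter> W x \<noteq> {}" "free_names \<inter> W y \<noteq> {}"
      using pair[of "W u" "W v" "W x" "W y"] pair[of "W x" "W y" "W u" "W v"] bad d by (simp_all add: Int_commute)
    then obtain i j k l where "{i, j, k, l} \<subseteq> free_names" "i \<in> W u" "j \<in> W v" "k \<in> W x" "l \<in> W y" by blast
    note ijkl = this
    have "i \<noteq> j" "i \<noteq> k" "i \<noteq> l" "j \<noteq> k" "j \<noteq> l" "k \<noteq> l" 
      using disjoint_iff[THEN iffD1, OF d(1)] disjoint_iff[THEN iffD1, OF d(2)] disjoint_iff[THEN iffD1, OF d(3)]
        disjoint_iff[THEN iffD1, OF d(4)] disjoint_iff[THEN iffD1, OF d(5)] disjoint_iff[THEN iffD1, OF d(6)]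
        ijkl(2-5) by metis+
    then have "card {i, j, k, l} = 4" by simp
    moreover have "card {i, j, k, l} \<le> card free_names" using ijkl(1) by (intro card_mono) auto
    ultimately have "4 \<le> card free_names" by simp
    then have "4 \<le> (3 :: nat)" using free_le by (rule order_trans)
    then show False by simp
  qed
  then show ?thesis using ch by blast
qed

text \<open>All three subtrees hang on the one uncovered vertex, so any two form a cherry. If
  \<open>W v\<close> has no free index, one of the two cherries with \<open>v\<close> is good:
  otherwise there are free indices and all of them lie in each of the two other subtrees, which are
  disjoint.\<close>

lemma progress_star:
  assumes c: "cover V W E" and V: "card V = 3"
  shows "\<exists>u v n. is_cherry E V u v n"
    "(\<exists>u v n. is_cherry E V u v n \<and> good_pair (W u) (W v)) \<or> (\<forall>v\<in>V. free_names \<inter> W v \<noteq> {})"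
proof -
  let ?U = "set vs - \<Union> (W ` V)"
  have nb: "\<exists>n. n \<in> ?U \<and> (\<exists>e\<in>E. joins e v n)" if "v \<in> V" for v
  proof -
    have "3 \<le> card V" using V by simp
    obtain e n where "e \<in> E" "joins e v n" "n \<in> ?U" by (rule cover_neighbour[OF c \<open>3 \<le> card V\<close> \<open>v \<in> V\<close>])
    then show ?thesis by (intro exI[of _ n] conjI bexI[of _ e])
  qed
  have "card ?U \<le> 1" using coverD(6)[OF c] V by simp
  then have one: "m = n" if "m \<in> ?U" "n \<in> ?U" for m n
    using that card_le_Suc0_iff_eq[of ?U] by simp
  obtain x y z where xyz: "V = {x, y, z}" "x \<noteq> y" "x \<noteq> z" "y \<noteq> z" using V card_3_iff by metis
  obtain n where n: "n \<in> ?U" using nb[of x] xyz(1) by auto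
  have "\<exists>e\<in>E. joins e v n" if "v \<in> V" for v using nb[OF that] one[OF n] by blast
  then have ch: "is_cherry E V u v n" if "u \<in> V" "v \<in> V" "u \<noteq> v" for u v
    using that by (simp add: is_cherry_def)
  show "\<exists>u v n. is_cherry E V u v n" using ch[of x y] xyz by blast
  show "(\<exists>u v n. is_cherry E V u v n \<and> good_pair (W u) (W v)) \<or> (\<forall>v\<in>V. free_names \<inter> W v \<noteq> {})"
  proof (rule disjCI)
    assume "\<not> (\<forall>v\<in>V. free_names \<inter> W v \<noteq> {})"
    then obtain v where v: "v \<in> V" "free_names \<inter> W v = {}" by blast
    then obtain s t where st: "s \<in> V" "t \<in> V" "v \<noteq> s" "v \<noteq> t" "s \<noteq> t"
      using xyz by blast
    have "W s \<inter> W t = {}" using coverD(3)[OF c st(1,2,5)] .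
    then have "good_pair (W v) (W s) \<or> good_pair (W v) (W t)"
      using v(2) unfolding good_pair_def by blast
    then show "\<exists>u v n. is_cherry E V u v n \<and> good_pair (W u) (W v)"
      using ch[OF v(1) st(1,3)] ch[OF v(1) st(2,4)] by blast
  qed
qed

text \<open>\<open>n\<close> stops being uncovered while two roots are replaced by one, so both
  sides of the inequality in \<open>cover\<close> drop by one.\<close>

lemma cover_merge:
  assumes c: "cover V W E" and u: "u \<in> V" and v: "v \<in> V" and uv: "u \<noteq> v"
    and ch: "cherry Ns vs es w u v n p e1 e2 e3 (W u) (W v)" and n: "n \<notin> \<Union> (W ` V)"
  shows "cover (insert n (V - {u, v})) (W(n := insert n (W u \<union> W v)))
      {e \<in> E. \<not> touches e u \<and> \<not> touches e v}"
    "card (insert n (V - {u, v})) + 1 = card V" "n \<notin> V"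
proof -
  interpret cherry Ns vs es w u v n p e1 e2 e3 "W u" "W v" by (rule ch)
  let ?V = "insert n (V - {u, v})" and ?W = "W(n := insert n (W u \<union> W v))"
  let ?E = "{e \<in> E. \<not> touches e u \<and> \<not> touches e v}"
  show nV: "n \<notin> V" using n cover_self[OF c] by blast
  have fin: "finite V" by (rule coverD(1)[OF c])
  have "card (V - {u, v}) + 2 = card V"
    using u v uv fin card_Diff_subset[of "{u, v}" V] card_mono[OF fin, of "{u, v}"] by simp
  then show card: "card ?V + 1 = card V" using nV fin by simp
  have Wn: "?W n = Wn" by (simp add: Wn_def)
  have Wx: "?W x = W x" if "x \<in> V" for x using nV that by auto
  have un: "\<Union> (?W ` ?V) = insert n (\<Union> (W ` V))"
  proof -
    have "\<Union> (?W ` ?V) = insert n (W u \<union> W v) \<union> \<Union> (W ` (V - {u, v}))" using nV by auto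
    also have "\<dots> = insert n (\<Union> (W ` V))" using u v by auto
    finally show ?thesis .
  qed
  show "cover ?V ?W ?E"
    unfolding cover_def
  proof (intro conjI)
    show "finite ?V" using fin by simp
    show "\<forall>x\<in>?V. part_ok x (?W x)"
      using part_n[OF coverD(2)[OF c u] coverD(2)[OF c v]] coverD(2)[OF c] Wn Wx by auto
    have dn: "Wn \<inter> W x = {}" if "x \<in> V - {u, v}" for x
      using that n coverD(3)[OF c, of u x] coverD(3)[OF c, of v x] u v unfolding Wn_def by blast
    then show "\<forall>x\<in>?V. \<forall>y\<in>?V. x \<noteq> y \<longrightarrow> ?W x \<inter> ?W y = {}"
      using coverD(3)[OF c] Wn Wx nV by (auto simp del: fun_upd_apply)
    show "?E = {e \<in> set es. \<forall>x\<in>?V. \<not> (fst e \<in> ?W x \<and> snd e \<in> ?W x)}"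
    proof (intro set_eqI iffI)
      fix e assume "e \<in> ?E"
      then have e: "e \<in> E" "\<not> touches e u" "\<not> touches e v" by auto
      have es: "e \<in> set es" and ns: "\<And>x. x \<in> V \<Longrightarrow> \<not> (fst e \<in> W x \<and> snd e \<in> W x)"
        using e(1) unfolding coverD(4)[OF c] by blast+
      have "e \<noteq> e1" "e \<noteq> e2"
        using e pendD(2)[OF pend_u] pendD(2)[OF pend_v] by (auto simp: joins_def touches_def)
      then have "\<not> (fst e \<in> Wn \<and> snd e \<in> Wn)"
      proof (cases "e = e3")
        case True
        then show ?thesis using e3 joins_both[OF e3(2), of Wn] by (auto simp: Wn_def)
      next
        case False
        then show ?thesis
          using outside_Wn(2,3)[OF es \<open>e \<noteq> e1\<close> \<open>e \<noteq> e2\<close>] ns[OF u] ns[OF v]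
            pendD(7)[OF pend_u es \<open>e \<noteq> e1\<close>] pendD(7)[OF pend_v es \<open>e \<noteq> e2\<close>]
          unfolding Wn_def by blast
      qed
      then have "\<not> (fst e \<in> ?W x \<and> snd e \<in> ?W x)" if "x \<in> ?V" for x
        using that ns Wn Wx by (cases "x = n") (auto simp del: fun_upd_apply)
      then show "e \<in> {e \<in> set es. \<forall>x\<in>?V. \<not> (fst e \<in> ?W x \<and> snd e \<in> ?W x)}" using es by blast
    next
      fix e assume "e \<in> {e \<in> set es. \<forall>x\<in>?V. \<not> (fst e \<in> ?W x \<and> snd e \<in> ?W x)}"
      then have es: "e \<in> set es" and ns: "\<And>x. x \<in> ?V \<Longrightarrow> \<not> (fst e \<in> ?W x \<and> snd e \<in> ?W x)" by blast+
      have nWn: "\<not> (fst e \<in> Wn \<and> snd e \<in> Wn)" using ns[of n] unfolding Wn by blast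
      have "\<not> (fst e \<in> W x \<and> snd e \<in> W x)" if x: "x \<in> V" for x
      proof (cases "x = u \<or> x = v")
        case True
        then show ?thesis using nWn by (auto simp: Wn_def)
      next
        case False
        then show ?thesis using ns[of x] Wx[OF x] x by simp
      qed
      then have E: "e \<in> E" unfolding coverD(4)[OF c] using es by blast
      have "\<not> touches e x" if x: "x = u \<or> x = v" for x
      proof
        assume "touches e x"
        then obtain y where y: "joins e x y" by (auto simp: touches_def joins_def)
        have xV: "x \<in> V" using x u v by blast
        have "pend x e y (W x)" by (rule cover_arc[OF c xV E y])
        then have "e = e1 \<or> e = e2"
          using x pend_boundary(1)[OF pend_u] pend_boundary(1)[OF pend_v] pendD(1-4)[of x e y "W x"] by blast
        then have "x \<in> Wn" "y \<in> Wn"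
          using x y pendD(2,3)[OF pend_u] pendD(2,3)[OF pend_v] unfolding Wn_def joins_def by auto
        then show False using nWn joins_both[OF y, of Wn] by blast
      qed
      then show "e \<in> ?E" using E by blast
    qed
    show "leaf_names \<subseteq> \<Union> (?W ` ?V)" unfolding un using coverD(5)[OF c] by blast
    have "set vs - \<Union> (?W ` ?V) = (set vs - \<Union> (W ` V)) - {n}" unfolding un by blast
    then have "card (set vs - \<Union> (?W ` ?V)) + 1 = card (set vs - \<Union> (W ` V))"
      using n n_vs card_Suc_Diff1[of "set vs - \<Union> (W ` V)" n] by simp
    then show "card (set vs - \<Union> (?W ` ?V)) + 2 \<le> card ?V" using coverD(6)[OF c] card by linarith
  qed
qed

end

section \<open>The loop invariant and its preservation by a merge\<close>

context network_tree_width
begin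

text \<open>The last conjunct is the budget for free indices. Only the merge that leads to two
  subtrees may exceed it, and no merge follows that one.\<close>

definition invariant :: "('a, 'n) state \<Rightarrow> ('n \<Rightarrow> 'n set) \<Rightarrow> bool" where
  "invariant s W \<longleftrightarrow> distinct (map fst (fst s)) \<and> cover (fst ` set (fst s)) W (set (fst (snd s))) \<and>
     (\<forall>b\<in>set (fst s). blob_ok b (W (fst b))) \<and>
     distinct (map fst (snd (snd s))) \<and> fst ` set (snd (snd s)) = set es - set (fst (snd s)) \<and>
     (\<forall>q\<in>set (snd (snd s)). \<exists>C. side (fst q) C \<and> set (snd q) = C \<inter> leaf_names) \<and>
     (length (fst s) = 2 \<or> (\<forall>b\<in>set (fst s). card (free_names \<inter> W (fst b)) \<le> 1))"

lemma set_frees: "set (frees Ns vs) = free_names"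
proof -
  have "l \<noteq> [] \<and> tl l = [] \<longleftrightarrow> length l = 1" for l :: "'a list" by (cases l) auto
  then have "set (frees Ns vs) = {v \<in> set vs. length (owners Ns (\<lambda>js. v \<in> set js)) = 1}"
    by (simp add: frees_def)
  also have "\<dots> = {v \<in> set vs. card (holders v) = 1}"
    using distinct_card[OF distinct_owners] by (simp add: set_owners_mem[symmetric])
  also have "\<dots> = free_names" using free_leaf leaf_sub by (auto simp: free_names_def)
  finally show ?thesis .
qed

lemma good_iff:
  assumes "set \<beta> = A \<inter> leaf_names" "set \<gamma> = B \<inter> leaf_names"
  shows "good (frees Ns vs) \<beta> \<gamma> \<longleftrightarrow> good_pair A B"
proof -
  have "frees Ns vs = [] \<longleftrightarrow> free_names = {}" using set_frees by (metis set_empty)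
  then show ?thesis unfolding good_def good_pair_def set_frees assms using free_leaf by blast
qed

lemma record_arc_pend:
  assumes e: "pend u e n C" and b: "set \<beta> = C \<inter> leaf_names"
  shows "record_arc vs es u \<beta> n = [(e, filter (\<lambda>x. x \<in> set \<beta>) vs)]"
    "set (filter (\<lambda>x. x \<in> set \<beta>) vs) = C \<inter> leaf_names"
proof -
  have "joins f u n \<longleftrightarrow> f = e" if "f \<in> set es" for f
    using pend_boundary(1)[OF e that _ pendD(3,4)[OF e]] pendD(2)[OF e] by blast
  then have "filter (\<lambda>e. joins e u n) es = filter ((=) e) es" by (intro filter_cong) auto
  also have "\<dots> = [e]" using distinct_es pendD(1)[OF e] distinct_length_filter[OF distinct_es, of "(=) e"]
    by (induction es) (auto simp: filter_empty_conv)
  finally show "record_arc vs es u \<beta> n = [(e, filter (\<lambda>x. x \<in> set \<beta>) vs)]"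
    by (simp add: record_arc_def)
  show "set (filter (\<lambda>x. x \<in> set \<beta>) vs) = C \<inter> leaf_names" using b leaf_sub by auto
qed

lemma merge_inv:
  assumes invariant: "invariant s W" and b: "b \<in> set (fst s)" and c: "c \<in> set (fst s)" and bc: "fst b \<noteq> fst c"
    and e: "e \<in> set (fst (snd s))" "joins e (fst b) n"
    and f: "f \<in> set (fst (snd s))" "joins f (fst c) n"
    and len: "3 \<le> length (fst s)"
    and good: "good_pair (W (fst b)) (W (fst c)) \<or>
      length (fst s) = 3 \<and> (\<forall>d\<in>set (fst s). free_names \<inter> W (fst d) \<noteq> {})"
  shows "\<exists>W'. invariant (merge Ns vs es s (b, c, n)) W' \<and> length (fst (merge Ns vs es s (b, c, n))) + 1 = length (fst s)"
proof -
  obtain u \<beta> X where bt: "b = (u, \<beta>, X)" using prod_cases3 by blast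
  obtain v \<gamma> Y where ct: "c = (v, \<gamma>, Y)" using prod_cases3 by blast
  obtain L E acc where s: "s = (L, E, acc)" using prod_cases3 by blast
  let ?V = "fst ` set L"
  have dist: "distinct (map fst L)" and cov: "cover ?V W (set E)"
    and ok: "\<And>d. d \<in> set L \<Longrightarrow> blob_ok d (W (fst d))"
    and acc: "distinct (map fst acc)" "fst ` set acc = set es - set E"
      "\<And>q. q \<in> set acc \<Longrightarrow> \<exists>C. side (fst q) C \<and> set (snd q) = C \<inter> leaf_names"
    and one: "\<And>d. d \<in> set L \<Longrightarrow> card (free_names \<inter> W (fst d)) \<le> 1"
    using invariant len unfolding invariant_def s by auto
  have uV: "u \<in> ?V" and vV: "v \<in> ?V" and uv: "u \<noteq> v" using b c bc by (force simp: s bt ct)+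
  have E: "e \<in> set E" "joins e u n" "f \<in> set E" "joins f v n" using e f by (simp_all add: s bt ct)
  obtain p g where ch: "cherry Ns vs es w u v n p e f g (W u) (W v)" and nV: "n \<notin> \<Union> (W ` ?V)"
    using cover_cherry[OF cov uV vV uv E] by metis
  interpret cherry Ns vs es w u v n p e f g "W u" "W v" by (rule ch)
  let ?W = "W(n := insert n (W u \<union> W v))"
  note cm = cover_merge[OF cov uV vV uv ch nV]
  have bX: "blob_ok (u, \<beta>, X) (W u)" and cY: "blob_ok (v, \<gamma>, Y) (W v)"
    using ok[of b] ok[of c] b c by (simp_all add: s bt ct)
  then have beta: "set \<beta> = W u \<inter> leaf_names" and gamma: "set \<gamma> = W v \<inter> leaf_names"
    by (simp_all add: blob_ok_def)
  define \<delta> where "\<delta> = filter (\<lambda>x. x \<in> set \<beta> \<or> x \<in> set \<gamma>) vs"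
  have delta: "set \<delta> = Wn \<inter> leaf_names"
    using beta gamma leaf_sub n_inner by (auto simp: \<delta>_def Wn_def)
  let ?L = "(n, \<delta>, merge_tree Ns n \<beta> \<gamma> \<delta> X Y) # filter (\<lambda>d. fst d \<noteq> u \<and> fst d \<noteq> v) L"
  let ?E = "filter (\<lambda>e. \<not> touches e u \<and> \<not> touches e v) E"
  let ?r = "[(e, filter (\<lambda>x. x \<in> set \<beta>) vs), (f, filter (\<lambda>x. x \<in> set \<gamma>) vs)]"
  have merge: "merge Ns vs es s (b, c, n) = (?L, ?E, ?r @ acc)"
    using record_arc_pend(1)[OF pend_u beta] record_arc_pend(1)[OF pend_v gamma]
    by (simp add: merge_def Let_def s bt ct \<delta>_def)
  have set_L: "fst ` set ?L = insert n (?V - {u, v})" by auto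
  have distL: "distinct (map fst ?L)"
    using dist cm(3) by (auto simp: distinct_map_filter)
  have lenL: "length ?L + 1 = length L"
    using cm(2) distinct_card[OF distL] distinct_card[OF dist] set_L by simp
  have fr: "card (free_names \<inter> W u) \<le> 1" "card (free_names \<inter> W v) \<le> 1"
    using one[of b] one[of c] b c by (simp_all add: s bt ct)
  \<comment> \<open>Free indices on both sides put the free vertex on the arc. It occupies one unit
    of the width, which becomes available for one free index in the rank.\<close>
  have cr1: "card (crossing A) + 1 \<le> w" if "side h A" "free_names \<inter> A \<noteq> {}" "free_names - A \<noteq> {}" for h A
    using width[OF that(1)] that(2,3) by (simp add: free_crossing_def)
  have cr0: "card (crossing A) \<le> w" if "side h A" for h A
    using width[OF that(1)] by linarith
  note sides = pend_side[OF pend_u] pend_side[OF pend_v] pend_side[OF pend_n]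
  have Wn_free: "free_names \<inter> Wn = (free_names \<inter> W u) \<union> (free_names \<inter> W v)"
    using n_inner free_leaf by (auto simp: Wn_def)
  have inWn: "W u \<subseteq> Wn" "W v \<subseteq> Wn" by (auto simp: Wn_def)
  have one_le: "card (crossing A) + card (free_names \<inter> A) \<le> w"
    if "side h A" "card (free_names \<inter> A) \<le> 1" "free_names \<inter> A \<noteq> {} \<Longrightarrow> free_names - A \<noteq> {}" for h A
  proof (cases "free_names \<inter> A = {}")
    case True
    then show ?thesis using cr0[OF that(1)] by simp
  next
    case False
    then show ?thesis using cr1[OF that(1) False that(3)] that(2) by simp
  qed
  have bounds: "card (crossing (W u)) + card (free_names \<inter> W u) \<le> w \<and>
    card (crossing (W v)) + card (free_names \<inter> W v) \<le> w \<and>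
    (card (crossing Wn) + card (free_names \<inter> Wn) \<le> w \<or>
      card (crossing Wn) + card (free_names \<inter> Wn) \<le> w + 1 \<and> card (crossing (W u)) < w) \<and>
    (length ?L = 2 \<or> card (free_names \<inter> Wn) \<le> 1)"
  proof (cases "good_pair (W u) (W v)")
    case True
    then have out: "free_names - Wn \<noteq> {}" if "free_names \<noteq> {}"
      using that Wn_free unfolding good_pair_def by blast
    have one_n: "card (free_names \<inter> Wn) \<le> 1" using True fr unfolding Wn_free good_pair_def by auto
    show ?thesis
      using one_le[OF sides(1) fr(1)] one_le[OF sides(2) fr(2)] one_le[OF sides(3) one_n] one_n out inWn by blast
  next
    \<comment> \<open>Here all three remaining subtrees hold a free index, so the free vertex lies
      on all three arcs at \<open>n\<close> and \<open>cr1\<close> applies to each. The merged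
      subtree has up to two free indices, hence \<open>w + 1\<close>, and
      \<open>card (crossing (W u)) < w\<close> is the compensation that \<open>merge_tree_ok\<close>
      asks for.\<close>
    case False
    then have L3: "length L = 3" and all: "\<And>d. d \<in> set L \<Longrightarrow> free_names \<inter> W (fst d) \<noteq> {}"
      using good by (auto simp: s bt ct)
    then have "card (?V - {u, v}) = 1"
      using distinct_card[OF dist] uV vV uv card_Diff_subset[of "{u, v}" ?V] by simp
    then obtain x where "?V - {u, v} = {x}" using card_1_singletonE by metis
    then have x: "x \<in> ?V" "x \<noteq> u" "x \<noteq> v" by blast+
    have "W u \<inter> W v = {}" "W u \<inter> W x = {}" "W v \<inter> W x = {}"
      using coverD(3)[OF cov] uV vV x uv by metis+
    moreover have "free_names \<inter> W u \<noteq> {}" "free_names \<inter> W v \<noteq> {}" "free_names \<inter> W x \<noteq> {}"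
      using all uV vV x(1) by blast+
    ultimately have ne: "free_names \<inter> W u \<noteq> {}" "free_names - W u \<noteq> {}"
      "free_names \<inter> W v \<noteq> {}" "free_names - W v \<noteq> {}"
      "free_names \<inter> Wn \<noteq> {}" "free_names - Wn \<noteq> {}"
      using x(1) nV n_inner free_leaf unfolding Wn_def by blast+
    have "card (free_names \<inter> Wn) \<le> 2"
      using card_Un_le[of "free_names \<inter> W u" "free_names \<inter> W v"] fr unfolding Wn_free by linarith
    then show ?thesis
      using cr1[OF sides(1) ne(1,2)] cr1[OF sides(2) ne(3,4)] cr1[OF sides(3) ne(5,6)] fr L3 lenL by linarith
  qed
  have "invariant (?L, ?E, ?r @ acc) ?W"
    unfolding invariant_def fst_conv snd_conv
  proof (intro conjI)
    show "distinct (map fst ?L)" by (rule distL)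
    have "set ?E = {e \<in> set E. \<not> touches e u \<and> \<not> touches e v}" by auto
    then show "cover (fst ` set ?L) ?W (set ?E)" unfolding set_L using cm(1) by simp
    have "blob_ok (n, \<delta>, merge_tree Ns n \<beta> \<gamma> \<delta> X Y) Wn"
      using merge_tree_ok[OF bX cY delta] bounds by blast
    moreover have "fst d \<noteq> n" if "d \<in> set L" for d using cm(3) that by auto
    ultimately show "\<forall>d\<in>set ?L. blob_ok d (?W (fst d))" using ok by (auto simp: Wn_def)
    have ef: "e \<noteq> f" using E uv by (auto simp: joins_def)
    have "e \<notin> fst ` set acc" "f \<notin> fst ` set acc" unfolding acc(2) using E by auto
    then show "distinct (map fst (?r @ acc))" using acc(1) ef by simp
    have touch: "h = e \<or> h = f" if "h \<in> set E" "touches h u \<or> touches h v" for h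
    proof -
      from that(2) obtain x y where xy: "x = u \<or> x = v" "joins h x y"
        by (auto simp: touches_def joins_def)
      then have "pend x h y (W x)" using cover_arc[OF cov _ that(1)] uV vV by blast
      note P = pendD(1-4)[OF this]
      show ?thesis
        using xy(1) pend_boundary(1)[OF pend_u P(1,2)] pend_boundary(1)[OF pend_v P(1,2)] P(3,4) by blast
    qed
    have "touches e u" "touches f v" using E by (auto simp: joins_def touches_def)
    then show "fst ` set (?r @ acc) = set es - set ?E"
      using touch acc(2) E pendD(1)[OF pend_u] pendD(1)[OF pend_v] by auto
    show "\<forall>q\<in>set (?r @ acc). \<exists>C. side (fst q) C \<and> set (snd q) = C \<inter> leaf_names"
      using acc(3) sides record_arc_pend(2)[OF pend_u beta] record_arc_pend(2)[OF pend_v gamma] by auto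
    show "length ?L = 2 \<or> (\<forall>b\<in>set ?L. card (free_names \<inter> ?W (fst b)) \<le> 1)"
      using bounds one \<open>\<And>d. d \<in> set L \<Longrightarrow> fst d \<noteq> n\<close> by (auto simp: Wn_def)
  qed
  then show ?thesis using merge lenL s by auto
qed

end

lemma subtrees_leaves: "U \<in> subtrees X \<Longrightarrow> set (leaf_list U) \<subseteq> set (leaf_list X)"
  by (induction X) auto

section \<open>Running the loop from the single leaves to the last two subtrees\<close>

context network_tree_width
begin

lemma invD:
  assumes "invariant s W"
  shows "distinct (map fst (fst s))" "cover (fst ` set (fst s)) W (set (fst (snd s)))"
    "\<And>b. b \<in> set (fst s) \<Longrightarrow> blob_ok b (W (fst b))"
    "distinct (map fst (snd (snd s)))" "fst ` set (snd (snd s)) = set es - set (fst (snd s))"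
    "\<And>q. q \<in> set (snd (snd s)) \<Longrightarrow> \<exists>C. side (fst q) C \<and> set (snd q) = C \<inter> leaf_names"
    "length (fst s) = 2 \<or> (\<forall>b\<in>set (fst s). card (free_names \<inter> W (fst b)) \<le> 1)"
  using assms unfolding invariant_def by blast+

lemma inv_card: "invariant s W \<Longrightarrow> card (fst ` set (fst s)) = length (fst s)"
  using distinct_card[OF invD(1)] by fastforce

lemma inv_length: "invariant s W \<Longrightarrow> 2 \<le> length (fst s)"
  using coverD(6)[OF invD(2)] inv_card by fastforce

lemma cherries_iff:
  "(b, c, n) \<in> set (cherries vs L E) \<longleftrightarrow> b \<in> set L \<and> c \<in> set L \<and> n \<in> set vs \<and> fst b \<noteq> fst c \<and>
     (\<exists>e\<in>set E. joins e (fst b) n) \<and> (\<exists>e\<in>set E. joins e (fst c) n)"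
  by (auto simp: cherries_def)

lemma cherry_exists:
  assumes invariant: "invariant s W" and ch: "is_cherry (set (fst (snd s))) (fst ` set (fst s)) u v n"
  obtains b c where "(b, c, n) \<in> set (cherries vs (fst s) (fst (snd s)))" "fst b = u" "fst c = v"
proof -
  obtain b c where bc: "b \<in> set (fst s)" "c \<in> set (fst s)" "fst b = u" "fst c = v" "u \<noteq> v"
    using ch by (auto simp: is_cherry_def)
  obtain e where e: "e \<in> set (fst (snd s))" "joins e u n" using ch by (auto simp: is_cherry_def)
  then have "e \<in> set es" using coverD(4)[OF invD(2)[OF invariant]] by blast
  from arcs[OF this] have "n \<in> set vs" using e(2) by (auto simp: joins_def)
  then have "(b, c, n) \<in> set (cherries vs (fst s) (fst (snd s)))"
    using bc ch by (auto simp: cherries_iff is_cherry_def)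
  then show ?thesis using bc that by blast
qed

lemma step_inv:
  assumes invariant: "invariant s W" and len: "3 \<le> length (fst s)"
  shows "\<exists>W'. invariant (step Ns vs es s) W' \<and> length (fst (step Ns vs es s)) + 1 = length (fst s)"
proof -
  let ?V = "fst ` set (fst s)" and ?E = "set (fst (snd s))"
  let ?C = "cherries vs (fst s) (fst (snd s))"
  let ?G = "filter (\<lambda>t. good (frees Ns vs) (fst (snd (fst t))) (fst (snd (fst (snd t))))) ?C"
  have cov: "cover ?V W ?E" by (rule invD(2)[OF invariant])
  have card: "card ?V = length (fst s)" by (rule inv_card[OF invariant])
  have beta: "set (fst (snd b)) = W (fst b) \<inter> leaf_names" if "b \<in> set (fst s)" for b
    using invD(3)[OF invariant that] by (simp add: blob_ok_def)
  have good: "good (frees Ns vs) (fst (snd b)) (fst (snd c)) \<longleftrightarrow> good_pair (W (fst b)) (W (fst c))"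
    if "(b, c, n) \<in> set ?C" for b c n
    using that by (intro good_iff beta) (auto simp: cherries_iff)
  have ex: "?G \<noteq> [] \<or> ?C \<noteq> [] \<and> length (fst s) = 3 \<and> (\<forall>d\<in>set (fst s). free_names \<inter> W (fst d) \<noteq> {})"
  proof -
    have G: "?G \<noteq> []" if "is_cherry ?E ?V u v n" "good_pair (W u) (W v)" for u v n
    proof -
      obtain b c where bc: "(b, c, n) \<in> set ?C" "fst b = u" "fst c = v"
        by (rule cherry_exists[OF invariant \<open>is_cherry ?E ?V u v n\<close>])
      then have "(b, c, n) \<in> set ?G" using good[OF bc(1)] that(2) by simp
      then show ?thesis by (metis empty_iff empty_set)
    qed
    show ?thesis
    proof (cases "length (fst s) = 3")
      case True
      then have V3: "card ?V = 3" using card by simp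
      obtain u v n where ch: "is_cherry ?E ?V u v n" using progress_star(1)[OF cov V3] by blast
      have "?C \<noteq> []" using cherry_exists[OF invariant ch] by (metis empty_iff empty_set)
      then show ?thesis using progress_star(2)[OF cov V3] G True by blast
    next
      case False
      then have "4 \<le> card ?V" using card len by simp
      then show ?thesis using progress[OF cov] G by blast
    qed
  qed
  then obtain t r where tr: "?G @ ?C = t # r" by (cases "?G @ ?C") auto
  obtain b c n where t: "t = (b, c, n)" using prod_cases3 by blast
  have tC: "(b, c, n) \<in> set ?C"
  proof -
    have "t \<in> set (?G @ ?C)" unfolding tr by simp
    then show ?thesis using t by auto
  qed
  have bad: "good_pair (W (fst b)) (W (fst c)) \<or>
      length (fst s) = 3 \<and> (\<forall>d\<in>set (fst s). free_names \<inter> W (fst d) \<noteq> {})"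
  proof (cases "?G = []")
    case False
    then obtain t' G' where G: "?G = t' # G'" by (cases ?G) auto
    have "t' = t" using tr unfolding G by simp
    moreover have "t' \<in> set ?G" unfolding G by simp
    ultimately show ?thesis using good[OF tC] t by simp
  qed (use ex in blast)
  obtain e f where ef: "b \<in> set (fst s)" "c \<in> set (fst s)" "fst b \<noteq> fst c"
    "e \<in> ?E" "joins e (fst b) n" "f \<in> ?E" "joins f (fst c) n"
    using tC unfolding cherries_iff by (elim conjE bexE)
  have "step Ns vs es s = merge Ns vs es s (b, c, n)"
    unfolding step_def Let_def tr by (simp add: t)
  then show ?thesis using merge_inv[OF invariant ef len bad] by simp
qed

text \<open>With two subtrees the inequality in \<open>cover\<close> leaves no vertex uncovered,
  whereas the middle of a cherry is uncovered. So there is no cherry, and the number of further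
  iterations is irrelevant.\<close>

lemma step_two:
  assumes invariant: "invariant s W" and len: "length (fst s) = 2"
  shows "step Ns vs es s = s"
proof -
  have cov: "cover (fst ` set (fst s)) W (set (fst (snd s)))" by (rule invD(2)[OF invariant])
  have "card (set vs - \<Union> (W ` fst ` set (fst s))) = 0"
    using coverD(6)[OF cov] inv_card[OF invariant] len by simp
  then have "set vs - \<Union> (W ` fst ` set (fst s)) = {}" by (simp only: card_0_eq finite_Diff finite_set)
  then have all: "set vs \<subseteq> \<Union> (W ` fst ` set (fst s))" by blast
  have no: "(b, c, n) \<notin> set (cherries vs (fst s) (fst (snd s)))" for b c n
  proof
    assume "(b, c, n) \<in> set (cherries vs (fst s) (fst (snd s)))"
    then obtain e f where *: "fst b \<in> fst ` set (fst s)" "fst c \<in> fst ` set (fst s)" "fst b \<noteq> fst c"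
      "e \<in> set (fst (snd s))" "joins e (fst b) n" "f \<in> set (fst (snd s))" "joins f (fst c) n" "n \<in> set vs"
      unfolding cherries_iff by (meson imageI)
    obtain p g where "n \<notin> \<Union> (W ` fst ` set (fst s))" by (rule cover_cherry[OF cov *(1-7)])
    then show False using *(8) all by blast
  qed
  have "cherries vs (fst s) (fst (snd s)) = []"
  proof (cases "cherries vs (fst s) (fst (snd s))")
    case (Cons t r)
    obtain b c n where t: "t = (b, c, n)" using prod_cases3 by blast
    have "(b, c, n) \<in> set (cherries vs (fst s) (fst (snd s)))" unfolding Cons t by simp
    then show ?thesis using no by blast
  qed
  then show ?thesis by (simp add: step_def)
qed

lemma fold_inv:
  assumes "invariant s W"
  shows "\<exists>W'. invariant (foldl (\<lambda>s _. step Ns vs es s) s l) W' \<and>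
    length (fst (foldl (\<lambda>s _. step Ns vs es s) s l)) = max 2 (length (fst s) - length l)"
  using assms
proof (induction l arbitrary: s W)
  case Nil
  then show ?case using inv_length by fastforce
next
  case (Cons x l)
  show ?case
  proof (cases "length (fst s) = 2")
    case True
    then show ?thesis using Cons.IH[OF Cons.prems] step_two[OF Cons.prems] by simp
  next
    case False
    then have "3 \<le> length (fst s)" using inv_length[OF Cons.prems] by simp
    then obtain W' where W': "invariant (step Ns vs es s) W'" "length (fst (step Ns vs es s)) + 1 = length (fst s)"
      using step_inv[OF Cons.prems] by blast
    then have "length (fst (step Ns vs es s)) - length l = length (fst s) - length (x # l)" by simp
    then show ?thesis using Cons.IH[OF W'(1)] by simp
  qed
qed

text \<open>With \<open>L\<close> leaves, \<open>I\<close> inner vertices and \<open>E\<close> arcs,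
  counting incidences gives \<open>2 E = L + 3 I\<close>, and \<open>forest\<close> gives
  \<open>E < L + I\<close>.\<close>

lemma handshake: "card (set vs - leaf_names) + 2 \<le> card leaf_names"
proof -
  have "(\<Sum>v\<in>set vs. card {e \<in> set es. touches e v}) = (\<Sum>e\<in>set es. 2)"
  proof (rule sum_multicount_gen)
    show "\<forall>e\<in>set es. card {v \<in> set vs. touches e v} = 2"
    proof
      fix e assume e: "e \<in> set es"
      then have "{v \<in> set vs. touches e v} = {fst e, snd e}" using arcs[OF e] by (auto simp: touches_def)
      then show "card {v \<in> set vs. touches e v} = 2" using arcs[OF e] by simp
    qed
  qed auto
  also have "\<dots> = 2 * length es" using distinct_card[OF distinct_es] by simp
  finally have "2 * length es = (\<Sum>v\<in>set vs. if v \<in> leaf_names then 1 else 3)"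
    using sum.cong[OF refl, of "set vs" "\<lambda>v. card {e \<in> set es. touches e v}"
        "\<lambda>v. if v \<in> leaf_names then 1 else 3"] degree_leaf degree_inner by simp
  also have "\<dots> = card leaf_names + 3 * card (set vs - leaf_names)"
  proof -
    have "set vs \<inter> {v. v \<in> leaf_names} = leaf_names" "set vs \<inter> - {v. v \<in> leaf_names} = set vs - leaf_names"
      using leaf_sub by auto
    then show ?thesis by (simp add: sum.If_cases)
  qed
  finally have 1: "2 * length es = card leaf_names + 3 * card (set vs - leaf_names)" .
  have "card (set vs - leaf_names) + card leaf_names = length vs"
    using card_Diff_subset[OF finite_leaf_names leaf_sub] card_mono[OF _ leaf_sub] distinct_card[OF distinct_vs]
    by simp
  then show ?thesis using 1 forest by linarith
qed

text \<open>A leaf carries at most two pieces, each with at most one open arc. Two pieces share the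
  index of the leaf and close it; a single piece adds that index to its one arc.\<close>

lemma rk_leaf:
  assumes v: "v \<in> leaf_names" and S: "S \<subseteq> blob {v}"
  shows "rk S \<le> 2"
proof -
  obtain e p where e: "pend v e p {v}" "\<And>f. f \<in> set es \<Longrightarrow> touches f v \<Longrightarrow> f = e"
    using leaf_pend[OF v] by metis
  have Sv: "x = v \<and> a \<in> holders v" if "(a, x) \<in> S" for a x
    using that S span_leaf[OF v] by (auto simp: blob_def holders_def)
  then have fS: "fst ` S \<subseteq> holders v" by fastforce
  then have fin: "finite (fst ` S)" and le: "card (fst ` S) \<le> 2"
    using finite_subset[OF fS] card_mono[OF _ fS] holders_le[of v] by auto
  have "rk_arcs S \<subseteq> (\<lambda>a. (a, e)) ` (fst ` S)"
  proof
    fix q assume "q \<in> rk_arcs S"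
    then obtain a f where q: "q = (a, f)" "f \<in> arcs_of a" "(a, fst f) \<in> S \<or> (a, snd f) \<in> S"
      by (auto simp: rk_arcs_def)
    then have "touches f v" using Sv by (auto simp: touches_def)
    then have "f = e" using e(2) q(2) by (auto simp: arcs_of_def)
    then show "q \<in> (\<lambda>a. (a, e)) ` (fst ` S)" using q by force
  qed
  then have arcs: "card (rk_arcs S) \<le> card (fst ` S)"
    using card_mono[of "(\<lambda>a. (a, e)) ` fst ` S"] card_image_le[OF fin, of "\<lambda>a. (a, e)"] fin
    by (meson finite_imageI order_trans)
  have free: "rk_free S \<subseteq> {v}" using Sv by (auto simp: rk_free_def)
  then have one: "card (rk_free S) \<le> 1" using card_mono[OF _ free] by simp
  show ?thesis
  proof (cases "card (fst ` S) = 2")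
    case True
    then obtain a b where ab: "a \<noteq> b" "fst ` S = {a, b}" by (meson card_2_iff)
    then have "(a, v) \<in> S" "(b, v) \<in> S" 
    proof -
      have "a \<in> fst ` S" "b \<in> fst ` S" unfolding ab(2) by simp_all
      then show "(a, v) \<in> S" "(b, v) \<in> S" using Sv by fastforce+
    qed
    moreover have "v \<in> ix a" "v \<in> ix b" using fS ab by (auto simp: holders_def)
    ultimately have "v \<notin> rk_free S" using ab(1) by (auto simp: rk_free_def)
    then have "rk_free S = {}" using free by blast
    then show ?thesis using arcs le by (simp add: rk_def)
  next
    case False
    then show ?thesis using arcs le one by (simp add: rk_def)
  qed
qed

lemma leaf_tree_ok:
  assumes v: "v \<in> leaf_names"
  shows "blob_ok (v, [v], leaf_tree Ns v) {v}"
proof -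
  obtain a as where o: "owners Ns (\<lambda>js. v \<in> set js) = a # as"
    using holders_ge[OF v] set_owners_mem[of v] by (cases "owners Ns (\<lambda>js. v \<in> set js)") auto
  have t: "leaf_tree Ns v = absorb v (Leaf (a, v)) as" by (simp add: leaf_tree_def o)
  have "holders v = set (a # as)" "distinct (a # as)"
    using set_owners_mem[of v] distinct_owners[of "\<lambda>js. v \<in> set js"] by (simp_all add: o)
  moreover have "blob {v} = (\<lambda>a. (a, v)) ` holders v"
    using span_leaf[OF v] by (auto simp: blob_def holders_def)
  ultimately have set: "set (leaf_list (leaf_tree Ns v)) = blob {v}"
    and dist: "distinct (leaf_list (leaf_tree Ns v))"
    by (auto simp: t distinct_map inj_on_def)
  have "rk (set (leaf_list U)) \<le> bound" if "U \<in> subtrees (leaf_tree Ns v)" for U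
    using rk_leaf[OF v] subtrees_leaves[OF that] bound_simps(1) unfolding set by (meson order_trans)
  then show ?thesis using v set dist by (auto simp: blob_ok_def)
qed

lemma leaf_part_ok:
  assumes v: "v \<in> leaf_names"
  shows "part_ok v {v}"
proof -
  obtain e p where "pend v e p {v}" using leaf_pend[OF v] by metis
  moreover have "\<not> (fst f \<in> {v} \<and> snd f \<in> {v})" if "f \<in> set es" for f
    using arcs[OF that] by auto
  ultimately show ?thesis using v unfolding part_ok_def by blast
qed

lemma initial_inv:
  "invariant (initial Ns vs es) (\<lambda>v. {v})" "length (fst (initial Ns vs es)) \<le> length vs"
proof -
  let ?l = "filter (\<lambda>v. \<exists>p\<in>set Ns. v \<in> set (snd p)) vs"
  have "(\<exists>p\<in>set Ns. v \<in> set (snd p)) \<longleftrightarrow> v \<in> leaf_names" for v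
    unfolding leaf_names_def ids_def ix_def by force
  then have l: "set ?l = leaf_names" using leaf_sub by auto
  have fst: "fst ` set (fst (initial Ns vs es)) = leaf_names"
    using l by (simp add: initial_def image_image)
  have "\<not> (fst e \<in> {v} \<and> snd e \<in> {v})" if "e \<in> set es" for e v
    using arcs[OF that] by auto
  then have "set es = {e \<in> set es. \<forall>v\<in>leaf_names. \<not> (fst e \<in> {v} \<and> snd e \<in> {v})}" by blast
  then have "cover leaf_names (\<lambda>v. {v}) (set es)"
    unfolding cover_def using leaf_part_ok handshake by simp
  moreover have "\<forall>b\<in>set (fst (initial Ns vs es)). blob_ok b {fst b}"
    using leaf_tree_ok l by (auto simp: initial_def)
  moreover have "card (free_names \<inter> {v}) \<le> 1" for v
    using card_mono[of "{v}" "free_names \<inter> {v}"] by simp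
  ultimately show "invariant (initial Ns vs es) (\<lambda>v. {v})"
    unfolding invariant_def fst using distinct_vs by (simp add: initial_def comp_def)
  show "length (fst (initial Ns vs es)) \<le> length vs" by (simp add: initial_def)
qed

definition nodes :: "'a \<Rightarrow> 'n set" where
  "nodes a = (if ix a = {} then set (take 1 vs) else span a)"

lemma arcs_of_empty: "ix a = {} \<Longrightarrow> arcs_of a = {}"
  by (auto simp: arcs_of_def cross_def cr_def)

lemma vs_nonempty: "vs \<noteq> []"
  using forest by auto

text \<open>Two subtrees leave no vertex uncovered, so they are complementary, and the one remaining
  arc joins their roots.\<close>

lemma final_inv:
  obtains u \<beta> X v \<gamma> Y E acc e W where
    "final_state Ns vs es = ([(u, \<beta>, X), (v, \<gamma>, Y)], E, acc)"
    "invariant (final_state Ns vs es) W" "u \<noteq> v"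
    "pend u e v (W u)" "set E = {e}" "W v = set vs - W u"
proof -
  let ?s = "final_state Ns vs es"
  obtain W where W: "invariant ?s W" and len: "length (fst ?s) = 2"
    using fold_inv[OF initial_inv(1), of vs] initial_inv(2) unfolding final_state_def by auto
  obtain b c where bc: "fst ?s = [b, c]"
    using len by (auto simp: length_Suc_conv numeral_2_eq_2)
  obtain u \<beta> X where b: "b = (u, \<beta>, X)" using prod_cases3 by blast
  obtain v \<gamma> Y where c: "c = (v, \<gamma>, Y)" using prod_cases3 by blast
  obtain L E acc where "?s = (L, E, acc)" using prod_cases3 by blast
  then have s: "?s = ([(u, \<beta>, X), (v, \<gamma>, Y)], E, acc)" using bc b c by simp
  have uv: "u \<noteq> v" using invD(1)[OF W] s by simp
  have cov: "cover {u, v} W (set E)" using invD(2)[OF W] s by simp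
  have disj: "W u \<inter> W v = {}" using coverD(3)[OF cov] uv by blast
  have "card (set vs - \<Union> (W ` {u, v})) = 0" using coverD(6)[OF cov] uv by simp
  then have "set vs - \<Union> (W ` {u, v}) = {}" by (simp only: card_0_eq finite_Diff finite_set)
  then have Wv: "W v = set vs - W u" using disj cover_sub[OF cov] by blast
  obtain e p where e: "pend u e p (W u)" "e \<in> set E" using cover_pend[OF cov] by blast
  obtain f q where f: "pend v f q (W v)" using cover_pend[OF cov] by blast
  have "p \<in> W v" using Wv pendD(4)[OF e(1)] arcs[OF pendD(1)[OF e(1)]] pendD(2)[OF e(1)] by (auto simp: joins_def)
  moreover have "u \<notin> W v" using Wv pendD(3)[OF e(1)] by blast
  ultimately have pv: "p = v"
    using pend_boundary(2)[OF f pendD(1)[OF e(1)] iffD1[OF joins_sym pendD(2)[OF e(1)]]] by blast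
  have "set E = {e}"
  proof (intro set_eqI iffI)
    fix g assume "g \<in> set E"
    then have g: "g \<in> set es" "\<not> (fst g \<in> W u \<and> snd g \<in> W u)" "\<not> (fst g \<in> W v \<and> snd g \<in> W v)"
      unfolding coverD(4)[OF cov] by blast+
    then have "\<not> (fst g \<in> W u \<longleftrightarrow> snd g \<in> W u)" using Wv arcs[OF g(1)] by blast
    then show "g \<in> {e}" using pendD(7)[OF e(1) g(1)] by blast
  qed (use e in simp)
  then show ?thesis using that[OF s W uv _ _ Wv] e pv by blast
qed

theorem plan_correct:
  obtains acc R where "plan (Ns, vs, es) = (map (\<lambda>p. (fst p, tensor_tree vs acc (snd p))) Ns, R)"
    "\<And>a js. (a, js) \<in> set Ns \<Longrightarrow>
      distinct (fst (tensor_tree vs acc js)) \<and> set (fst (tensor_tree vs acc js)) = nodes a \<and>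
      distinct (snd (tensor_tree vs acc js)) \<and> set (snd (tensor_tree vs acc js)) = arcs_of a"
    "distinct (leaf_list R)" "set (leaf_list R) = {(a, x). a \<in> ids \<and> x \<in> nodes a}"
    "\<And>U. U \<in> subtrees R \<Longrightarrow> rk (set (leaf_list U)) \<le> bound"
    "\<And>a x y. x \<in> span a \<Longrightarrow> y \<in> span a \<Longrightarrow> (x, y) \<in> (adj (arcs_of a))\<^sup>*"
    "\<And>a x. x \<in> span a \<Longrightarrow> x \<notin> leaf_names \<Longrightarrow> 2 \<le> card {e \<in> arcs_of a. touches e x}"
proof -
  obtain u \<beta> X v \<gamma> Y E acc e W where s: "final_state Ns vs es = ([(u, \<beta>, X), (v, \<gamma>, Y)], E, acc)"
    and W: "invariant (final_state Ns vs es) W" and uv: "u \<noteq> v" and pend: "pend u e v (W u)"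
    and E: "set E = {e}" and Wv: "W v = set vs - W u"
    by (rule final_inv)
  have cov: "cover {u, v} W (set E)" using invD(2)[OF W] s by simp
  have ok: "blob_ok (u, \<beta>, X) (W u)" "blob_ok (v, \<gamma>, Y) (W v)" using invD(3)[OF W] s by auto
  have pu: "part_ok u (W u)" and pv: "part_ok v (W v)" using coverD(2)[OF cov] by auto
  have beta: "set \<beta> = W u \<inter> leaf_names" using ok by (simp add: blob_ok_def)
  let ?acc = "closing_arcs vs es (final_state Ns vs es)"
  obtain v0 vs' where vs: "vs = v0 # vs'" using vs_nonempty by (cases vs) auto
  have take1: "set (take 1 vs) = {v0}" by (simp add: vs)
  define Z where "Z = owners Ns (\<lambda>js. js = [])"
  let ?R = "absorb v0 (Node X Y) Z"
  have Z: "set Z = {a \<in> ids. ix a = {}}" "distinct Z"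
    unfolding Z_def by (rule owners_iff) (auto simp: ix_eq distinct_owners)
  have R: "closing_tree Ns vs (final_state Ns vs es) = ?R"
    unfolding s Z_def by (simp add: closing_tree_def vs)
  have acc_eq: "?acc = (e, filter (\<lambda>x. x \<in> set \<beta>) vs) # acc"
    using record_arc_pend(1)[OF pend beta] by (simp add: closing_arcs_def s)
  have "distinct (map fst acc)" "fst ` set acc = set es - {e}"
    and acc0: "\<And>q. q \<in> set acc \<Longrightarrow> \<exists>C. side (fst q) C \<and> set (snd q) = C \<inter> leaf_names"
    using invD(4-6)[OF W] E unfolding s by simp_all
  then have acc1: "distinct (map fst ?acc)" "fst ` set ?acc = set es"
    using pendD(1)[OF pend] unfolding acc_eq by auto
  have acc2: "\<exists>C. side (fst q) C \<and> set (snd q) = C \<inter> leaf_names" if "q \<in> set ?acc" for q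
  proof (cases "q \<in> set acc")
    case False
    then have "q = (e, filter (\<lambda>x. x \<in> set \<beta>) vs)" using that unfolding acc_eq by simp
    then show ?thesis
      using pend_side[OF pend] record_arc_pend(2)[OF pend beta] by (metis fst_conv snd_conv)
  qed (rule acc0)
  have crossed: "distinct (crossed_arcs ?acc js)" "set (crossed_arcs ?acc js) = arcs_of a"
    if "(a, js) \<in> set Ns" for a js
  proof -
    show "distinct (crossed_arcs ?acc js)"
      using acc1(1) by (simp add: crossed_arcs_def distinct_map_filter)
    have "crosses js (snd q) \<longleftrightarrow> cross a (fst q)" if q: "q \<in> set ?acc" for q
      using acc2[OF q] crosses_iff[OF \<open>(a, js) \<in> set Ns\<close>] cross_iff by metis
    then have "set (crossed_arcs ?acc js) = fst ` {q \<in> set ?acc. cross a (fst q)}"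
      by (auto simp: crossed_arcs_def)
    also have "\<dots> = {f \<in> fst ` set ?acc. cross a f}" by blast
    finally show "set (crossed_arcs ?acc js) = arcs_of a" unfolding acc1(2) by (simp add: arcs_of_def)
  qed
  have disj: "W u \<inter> W v = {}" using Wv by blast
  have blobs: "blob (W u) \<union> blob (W v) = {(a, x). a \<in> ids \<and> x \<in> span a}"
    using span_sub Wv unfolding blob_def by blast
  have span0: "span a = {}" if "ix a = {}" for a
    using that arcs_of_empty by (auto simp: span_def)
  have listR: "leaf_list ?R = leaf_list X @ leaf_list Y @ map (\<lambda>a. (a, v0)) Z" by simp
  have setXY: "set (leaf_list X) = blob (W u)" "set (leaf_list Y) = blob (W v)"
    "distinct (leaf_list X)" "distinct (leaf_list Y)"
    using ok by (auto simp: blob_ok_def)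
  \<comment> \<open>Once the pieces of all tensors with indices are present, no arc is open and only
    the free indices of the network count.\<close>
  have rk0: "rk (set (leaf_list U)) \<le> card free_names"
    if U: "{(a, x). a \<in> ids \<and> x \<in> span a} \<subseteq> set (leaf_list U)" for U
  proof -
    have "rk_arcs (set (leaf_list U)) = {}"
    proof -
      have "fst f \<in> span a" "snd f \<in> span a" if "f \<in> arcs_of a" for a f
        using that by (auto simp: span_def touches_def)
      then show ?thesis using U by (auto simp: rk_arcs_def)
    qed
    moreover have "rk_free (set (leaf_list U)) \<subseteq> free_names"
    proof
      fix i assume "i \<in> rk_free (set (leaf_list U))"
      then obtain a where a: "i \<in> ix a" "\<And>b. i \<in> ix b \<Longrightarrow> (b, i) \<in> set (leaf_list U) \<Longrightarrow> b = a"
        by (auto simp: rk_free_def)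
      have "b = a" if b: "i \<in> ix b" for b
      proof (rule a(2)[OF b])
        have "b \<in> ids" "i \<in> span b" using ix_ids[OF b] b by (auto simp: span_def)
        then show "(b, i) \<in> set (leaf_list U)" using U by blast
      qed
      then have "holders i = {a}" using a(1) ix_ids[OF a(1)] unfolding holders_def by blast
      then show "i \<in> free_names" by (simp add: free_names_def)
    qed
    then have "card (rk_free (set (leaf_list U))) \<le> card free_names" by (rule card_mono[rotated]) simp
    ultimately show ?thesis by (simp add: rk_def)
  qed
  \<comment> \<open>Three free indices are the other case in which \<open>bound\<close> is raised to
    3 for \<open>w = 1\<close>.\<close>
  have free_bound: "card free_names \<le> bound"
    using free_le bound_simps(1,5) by (cases "card free_names = 3") auto
  show ?thesis
  proof (rule that)
    show "plan (Ns, vs, es) = (map (\<lambda>p. (fst p, tensor_tree vs ?acc (snd p))) Ns, ?R)"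
      by (simp add: plan_def Let_def R)
  next
    fix a js assume js: "(a, js) \<in> set Ns"
    note c = crossed[OF js]
    have "js = [] \<longleftrightarrow> ix a = {}" using ix_eq[OF js] by simp
    moreover have "set (filter (\<lambda>v. v \<in> set js \<or> (\<exists>e\<in>set (crossed_arcs ?acc js). touches e v)) vs) = span a"
      using span_sub[of a] unfolding c(2) span_def ix_eq[OF js] by auto
    ultimately show "distinct (fst (tensor_tree vs ?acc js)) \<and> set (fst (tensor_tree vs ?acc js)) = nodes a \<and>
      distinct (snd (tensor_tree vs ?acc js)) \<and> set (snd (tensor_tree vs ?acc js)) = arcs_of a"
      using c distinct_vs by (auto simp: tensor_tree_def nodes_def)
  next
    have "blob (W u) \<inter> blob (W v) = {}" using disj by (auto simp: blob_def)
    moreover have "(a, v0) \<notin> blob (W u) \<union> blob (W v)" if "a \<in> set Z" for a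
      using that Z(1) span0 unfolding blobs by auto
    ultimately show "distinct (leaf_list ?R)"
      unfolding listR using setXY Z(2) by (auto simp: distinct_map inj_on_def)
    have "set (leaf_list ?R) = {(a, x). a \<in> ids \<and> x \<in> span a} \<union> (\<lambda>a. (a, v0)) ` set Z"
      unfolding listR using setXY(1,2) blobs by auto
    also have "\<dots> = {(a, x). a \<in> ids \<and> x \<in> nodes a}"
      using Z(1) span0 unfolding nodes_def take1 by (auto split: if_splits)
    finally show "set (leaf_list ?R) = {(a, x). a \<in> ids \<and> x \<in> nodes a}" .
  next
    fix U assume "U \<in> subtrees ?R"
    from subtrees_absorb[OF this] show "rk (set (leaf_list U)) \<le> bound"
    proof (elim disjE bexE exE conjE)
      assume "U \<in> subtrees (Node X Y)"
      then consider "U = Node X Y" | "U \<in> subtrees X" | "U \<in> subtrees Y" by auto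
      then show ?thesis
      proof cases
        case 1
        then have "rk (set (leaf_list U)) \<le> card free_names"
          by (intro rk0) (use setXY(1,2) blobs in auto)
        then show ?thesis using free_bound by simp
      qed (use ok in \<open>auto simp: blob_ok_def\<close>)
    next
      fix a assume a: "a \<in> set Z" "U = Leaf (a, v0)"
      then have "ix a = {}" using Z(1) by blast
      then have "rk_arcs (set (leaf_list U)) = {}" "rk_free (set (leaf_list U)) = {}"
        using a(2) arcs_of_empty by (auto simp: rk_arcs_def rk_free_def)
      then show ?thesis by (simp add: rk_def)
    next
      fix qs assume "U = absorb v0 (Node X Y) qs"
      then have "rk (set (leaf_list U)) \<le> card free_names"
        by (intro rk0) (use setXY(1,2) blobs in auto)
      then show ?thesis using free_bound by simp
    qed
  next
    fix a x y assume xy: "x \<in> span a" "y \<in> span a"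
    let ?A = "(adj (arcs_of a))\<^sup>*"
    obtain t where t: "\<And>x. x \<in> span a \<inter> W u \<Longrightarrow> (x, t) \<in> ?A \<and> (cr a (W u) \<longrightarrow> t = u)"
      using part_okD(4)[OF pu, of a] by blast
    obtain r where r: "\<And>x. x \<in> span a \<inter> W v \<Longrightarrow> (x, r) \<in> ?A \<and> (cr a (W v) \<longrightarrow> r = v)"
      using part_okD(4)[OF pv, of a] by blast
    have "ix a \<subseteq> set vs" using ix_leaf leaf_sub by blast
    then have crv: "cr a (W v) \<longleftrightarrow> cr a (W u)" unfolding cr_def Wv by blast
    \<comment> \<open>Either \<open>a\<close> crosses the last arc and both halves lead to its end
      \<open>v\<close>, or all indices of \<open>a\<close> lie in one half and
      \<open>span_empty\<close> clears the other.\<close>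
    have "\<exists>z. \<forall>x\<in>span a. (x, z) \<in> ?A"
    proof (cases "cr a (W u)")
      case True
      then have "e \<in> arcs_of a"
        using cross_iff[OF pend_side[OF pend]] pendD(1)[OF pend] by (simp add: arcs_of_def)
      then have uv: "(u, v) \<in> ?A" using adj_edge[OF _ pendD(2)[OF pend]] by blast
      have "(x, v) \<in> ?A" if "x \<in> span a" for x
      proof (cases "x \<in> W u")
        case True
        then have "(x, u) \<in> ?A" using t[of x] \<open>cr a (W u)\<close> that by blast
        then show ?thesis using uv by (rule rtrancl_trans)
      next
        case False
        then have "x \<in> W v" using that span_sub Wv by blast
        then show ?thesis using r[of x] crv \<open>cr a (W u)\<close> that by blast
      qed
      then show ?thesis by blast
    next
      case False
      then have "ix a \<inter> W u = {} \<or> ix a \<inter> W v = {}" unfolding cr_def Wv by blast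
      then have "span a \<inter> W u = {} \<or> span a \<inter> W v = {}" using span_empty[OF pu] span_empty[OF pv] by blast
      then have "span a \<subseteq> W v \<or> span a \<subseteq> W u" using span_sub[of a] Wv by blast
      then show ?thesis using t r by blast
    qed
    then obtain z where "(x, z) \<in> ?A" "(y, z) \<in> ?A" using xy by blast
    then show "(x, y) \<in> ?A" using adj_sym rtrancl_trans by metis
  next
    fix a x assume x: "x \<in> span a" "x \<notin> leaf_names"
    then have "x \<in> W u \<or> x \<in> W v" using span_sub Wv by blast
    then show "2 \<le> card {e \<in> arcs_of a. touches e x}"
      using part_okD(3)[OF pu x(1) _ x(2)] part_okD(3)[OF pv x(1) _ x(2)] by blast
  qed
qed

end

section \<open>Trees as graphs\<close>

definition reach_by :: "('v, 'e) graph \<Rightarrow> 'e set \<Rightarrow> ('v \<times> 'v) set" where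
  "reach_by G F = {(u, v). \<exists>e\<in>F. ends G e = {u, v}}\<^sup>*"

lemma reachable_eq: "reachable G = reach_by G (edges G)"
  by (simp add: reachable_def reach_by_def)

lemma reach_by_mono: "F \<subseteq> F' \<Longrightarrow> reach_by G F \<subseteq> reach_by G F'"
  unfolding reach_by_def by (rule rtrancl_mono) blast

lemma reach_by_sym: "(u, v) \<in> reach_by G F \<Longrightarrow> (v, u) \<in> reach_by G F"
proof -
  have "sym {(u, v). \<exists>e\<in>F. ends G e = {u, v}}" by (auto simp: sym_def insert_commute)
  then show "(u, v) \<in> reach_by G F \<Longrightarrow> (v, u) \<in> reach_by G F"
    unfolding reach_by_def by (meson sym_rtrancl symD)
qed

lemma reach_by_trans: "(u, v) \<in> reach_by G F \<Longrightarrow> (v, x) \<in> reach_by G F \<Longrightarrow> (u, x) \<in> reach_by G F"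
  unfolding reach_by_def by (rule rtrancl_trans)

definition simple_path :: "('v, 'e) graph \<Rightarrow> 'e set \<Rightarrow> 'v list \<Rightarrow> 'e list \<Rightarrow> bool" where
  "simple_path G F p es \<longleftrightarrow> distinct p \<and> length p = length es + 1 \<and> set es \<subseteq> F \<and>
     (\<forall>k<length es. ends G (es ! k) = {p ! k, p ! (k + 1)})"

lemma reach_by_simple_path:
  assumes "(u, v) \<in> reach_by G F"
  shows "\<exists>p es. simple_path G F p es \<and> hd p = u \<and> last p = v"
  using assms unfolding reach_by_def
proof (induction rule: converse_rtrancl_induct)
  case base
  have "simple_path G F [v] []" by (simp add: simple_path_def)
  then show ?case by force
next
  case (step x y)
  then obtain p es e where p: "simple_path G F p es" "hd p = y" "last p = v" and e: "e \<in> F" "ends G e = {x, y}"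
    by blast
  then have ne: "p \<noteq> []" by (auto simp: simple_path_def)
  show ?case
  proof (cases "x \<in> set p")
    \<comment> \<open>The path already visits \<open>x\<close>, so the new edge is dropped and the
      part of the path from \<open>x\<close> on is kept.\<close>
    case True
    then obtain k where k: "k < length p" "p ! k = x" by (auto simp: in_set_conv_nth)
    have "simple_path G F (drop k p) (drop k es)"
      using p(1) k(1) unfolding simple_path_def by (auto dest: in_set_dropD)
    moreover have "hd (drop k p) = x" "last (drop k p) = v" using k p(3) by (auto simp: hd_drop_conv_nth)
    ultimately show ?thesis by blast
  next
    case False
    have "simple_path G F (x # p) (e # es)"
      unfolding simple_path_def
    proof (intro conjI allI impI)
      fix k assume "k < length (e # es)"
      then show "ends G ((e # es) ! k) = {(x # p) ! k, (x # p) ! (k + 1)}"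
        using p e ne by (cases k) (auto simp: simple_path_def hd_conv_nth)
    qed (use p False e in \<open>auto simp: simple_path_def\<close>)
    moreover have "hd (x # p) = x" "last (x # p) = v" using p(3) ne by auto
    ultimately show ?thesis by blast
  qed
qed

lemma simple_path_distinct_edges:
  assumes "simple_path G F p es"
  shows "distinct es"
  unfolding distinct_conv_nth
proof (intro allI impI notI)
  fix k l assume kl: "k < length es" "l < length es" "k \<noteq> l" "es ! k = es ! l"
  have "ends G (es ! k) = {p ! k, p ! (k + 1)}" "ends G (es ! l) = {p ! l, p ! (l + 1)}"
    using assms kl(1,2) unfolding simple_path_def by blast+
  then have "{p ! k, p ! (k + 1)} = {p ! l, p ! (l + 1)}" using kl(4) by simp
  moreover have "distinct p" "length p = length es + 1" using assms by (auto simp: simple_path_def)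
  ultimately show False using kl by (auto simp: doubleton_eq_iff nth_eq_iff_index_eq)
qed

text \<open>A simple path that avoids \<open>e\<close> and joins the ends of \<open>e\<close> would
  be closed to a cycle by \<open>e\<close>.\<close>

lemma tree_bridge:
  assumes T: "tree T" and e: "e \<in> edges T" "ends T e = {u, v}" and F: "F \<subseteq> edges T - {e}"
  shows "(u, v) \<notin> reach_by T F"
proof
  assume "(u, v) \<in> reach_by T F"
  then have "(v, u) \<in> reach_by T F" by (rule reach_by_sym)
  then obtain p es where p: "simple_path T F p es" "hd p = v" "last p = u"
    using reach_by_simple_path by metis
  then have ne: "p \<noteq> []" by (auto simp: simple_path_def)
  have "is_cycle T (u # p) (e # es)"
    unfolding is_cycle_def
  proof (intro conjI allI impI)
    fix k assume "k < length (e # es)"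
    then show "ends T ((e # es) ! k) = {(u # p) ! k, (u # p) ! (k + 1)}"
      using p e ne by (cases k) (auto simp: simple_path_def hd_conv_nth)
  next
    have "e \<notin> set es" using p(1) F by (auto simp: simple_path_def)
    then show "distinct (e # es)" using simple_path_distinct_edges[OF p(1)] by simp
  qed (use p e F ne in \<open>auto simp: simple_path_def\<close>)
  then show False using T by (auto simp: tree_def)
qed

text \<open>Adding the edges of a tree one after the other, each edge joins two components.\<close>

lemma tree_card_edges:
  assumes T: "tree T"
  shows "card (edges T) < card (verts T)"
proof -
  have wf: "finite (verts T)" "finite (edges T)" "verts T \<noteq> {}"
    and ends: "\<And>e. e \<in> edges T \<Longrightarrow> ends T e \<subseteq> verts T \<and> card (ends T e) = 2"
    using T by (auto simp: tree_def wf_graph_def)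
  \<comment> \<open>The set of connected components formed by the edges \<open>F\<close>.\<close>
  let ?c = "\<lambda>F. (\<lambda>x. reach_by T F `` {x}) ` verts T"
  have "card F + card (?c F) \<le> card (verts T)" if "F \<subseteq> edges T" for F
    using finite_subset[OF that wf(2)] that
  proof (induction rule: finite_induct)
    case empty
    then show ?case using card_image_le[OF wf(1)] by simp
  next
    case (insert e F)
    have e: "e \<in> edges T" and F: "F \<subseteq> edges T - {e}" using insert by auto
    obtain u v where uv: "ends T e = {u, v}" using ends[OF e] by (meson card_2_iff)
    have uvV: "u \<in> verts T" "v \<in> verts T" using ends[OF e] uv by auto
    let ?f = "\<lambda>C. reach_by T (insert e F) `` C"
    have sub: "reach_by T F \<subseteq> reach_by T (insert e F)" by (rule reach_by_mono) blast
    have f: "?f (reach_by T F `` {x}) = reach_by T (insert e F) `` {x}" for x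
    proof
      show "?f (reach_by T F `` {x}) \<subseteq> reach_by T (insert e F) `` {x}"
        using sub reach_by_trans[of x _ T "insert e F"] by auto
      have "x \<in> reach_by T F `` {x}" by (simp add: reach_by_def)
      then show "reach_by T (insert e F) `` {x} \<subseteq> ?f (reach_by T F `` {x})" by blast
    qed
    then have im: "?c (insert e F) = ?f ` ?c F" by (simp add: image_image)
    \<comment> \<open>\<open>?f\<close> maps a component to the one that contains it after adding
      \<open>e\<close>. It identifies the components of \<open>u\<close> and \<open>v\<close>, which
      are different before by \<open>tree_bridge\<close>, so the number of components drops.\<close>
    have "\<not> inj_on ?f (?c F)"
    proof
      assume inj: "inj_on ?f (?c F)"
      have uv': "(u, v) \<in> reach_by T (insert e F)"
        unfolding reach_by_def by (rule r_into_rtrancl) (simp add: uv)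
      then have "reach_by T (insert e F) `` {u} = reach_by T (insert e F) `` {v}"
        using reach_by_trans[OF reach_by_sym[OF uv']] reach_by_trans[OF uv'] by auto
      then have "?f (reach_by T F `` {u}) = ?f (reach_by T F `` {v})" unfolding f .
      from inj_onD[OF inj this] have "reach_by T F `` {u} = reach_by T F `` {v}" using uvV by simp
      moreover have "v \<in> reach_by T F `` {v}" by (simp add: reach_by_def)
      ultimately show False using tree_bridge[OF T e uv F] by blast
    qed
    moreover have "card (?f ` ?c F) \<le> card (?c F)" by (rule card_image_le) (use wf in simp)
    ultimately have "card (?c (insert e F)) < card (?c F)"
      unfolding im using eq_card_imp_inj_on[of "?c F" ?f] wf by fastforce
    then show ?case using insert by simp
  qed
  from this[of "edges T"] have "card (edges T) + card (?c (edges T)) \<le> card (verts T)" by simp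
  moreover have "0 < card (?c (edges T))" using wf by (simp add: card_gt_0_iff)
  ultimately show ?thesis by linarith
qed

lemma tree_isolated_vertex:
  assumes T: "tree T" and v: "v \<in> verts T" and iso: "\<And>e. e \<in> edges T \<Longrightarrow> v \<notin> ends T e"
  shows "verts T = {v}"
proof -
  have "x = v" if x: "x \<in> verts T" for x
  proof -
    have "(v, x) \<in> reachable T" using T v x by (auto simp: tree_def)
    then show ?thesis unfolding reachable_def
    proof (cases rule: converse_rtranclE)
      case (step y)
      then obtain e where "e \<in> edges T" "ends T e = {v, y}" by auto
      then show ?thesis using iso by blast
    qed simp
  qed
  then show ?thesis using v by blast
qed

section \<open>Networks of factorizations\<close>

lemma inds_contraction [simp]: "inds (contraction D N) = free_inds N"
  by (simp add: contraction_def)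

lemma carriers_sub: "carriers N i \<subseteq> N"
  by (auto simp: carriers_def)

lemma carriers_iff: "X \<in> carriers N i \<longleftrightarrow> X \<in> N \<and> i \<in> inds X"
  by (simp add: carriers_def)

lemma network_index:
  assumes "tensor_network D N" "X \<in> N" "i \<in> inds X"
  shows "i \<in> bond_inds N \<or> i \<in> free_inds N"
proof -
  have "finite N" using assms(1) by (simp add: tensor_network_def)
  then have "finite (carriers N i)" by (rule finite_subset[OF carriers_sub])
  moreover have "X \<in> carriers N i" using assms by (simp add: carriers_iff)
  ultimately have "0 < card (carriers N i)" by (auto simp: card_gt_0_iff)
  moreover have "card (carriers N i) \<le> 2" using assms(1) by (simp add: tensor_network_def)
  ultimately show ?thesis by (auto simp: bond_inds_def free_inds_def)
qed

lemma contraction_singleton: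
  assumes "tensor_over D A"
  shows "contraction D {A} = A"
proof -
  have "carriers {A} i = (if i \<in> inds A then {A} else {})" for i by (auto simp: carriers_def)
  then have f: "free_inds {A} = inds A" and b: "bond_inds {A} = {}"
    by (auto simp: free_inds_def bond_inds_def)
  have "restrict (\<lambda>\<tau>. \<Sum>\<rho>\<in>PiE (bond_inds {A}) D. \<Prod>B\<in>{A}. entry B
      (restrict (\<lambda>i. if i \<in> bond_inds {A} then \<rho> i else \<tau> i) (inds B))) (PiE (free_inds {A}) D) = entry A"
  proof
    fix \<tau>
    show "restrict (\<lambda>\<tau>. \<Sum>\<rho>\<in>PiE (bond_inds {A}) D. \<Prod>B\<in>{A}. entry B
      (restrict (\<lambda>i. if i \<in> bond_inds {A} then \<rho> i else \<tau> i) (inds B))) (PiE (free_inds {A}) D) \<tau> = entry A \<tau>"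
    proof (cases "\<tau> \<in> PiE (inds A) D")
      case True
      then have "restrict \<tau> (inds A) = \<tau>" by (simp add: PiE_restrict)
      then show ?thesis using True by (simp add: f b)
    next
      case False
      have "entry A \<in> extensional (PiE (inds A) D)" using assms by (simp add: tensor_over_def)
      from extensional_arb[OF this False] show ?thesis using False by (simp add: f b)
    qed
  qed
  then show ?thesis unfolding contraction_def by (intro tensor.expand) (simp only: tensor.sel f)
qed

text \<open>Without the free vertex, only the bond indices remain as edges, and the ends of a bond
  are its two carriers; so the edge part of the isomorphism is a naming of the tree edges by
  bonds.\<close>

lemma graph_iso_structure:
  "graph_iso (\<lambda>v. Some (g v)) T (delete_vertex (structure_graph N) None) \<longleftrightarrow>
     bij_betw g (verts T) N \<and> (\<exists>h. bij_betw h (edges T) (bond_inds N) \<and>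
       (\<forall>e\<in>edges T. carriers N (h e) = g ` ends T e))"
proof -
  let ?G = "delete_vertex (structure_graph N) None"
  have v: "verts ?G = Some ` N" by (auto simp: delete_vertex_def structure_graph_def)
  have e: "edges ?G = bond_inds N"
    by (auto simp: delete_vertex_def structure_graph_def bond_inds_def free_inds_def)
  have im: "(\<lambda>v. Some (g v)) ` S = Some ` g ` S" for S by auto
  have "bij_betw (\<lambda>v. Some (g v)) (verts T) (Some ` N) \<longleftrightarrow> bij_betw g (verts T) N"
    unfolding bij_betw_def im by (simp add: inj_on_def inj_image_eq_iff)
  moreover have "ends ?G (h e) = (\<lambda>v. Some (g v)) ` ends T e \<longleftrightarrow> carriers N (h e) = g ` ends T e"
    if "bij_betw h (edges T) (bond_inds N)" "e \<in> edges T" for h e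
  proof -
    have "h e \<in> bond_inds N" using that by (auto simp: bij_betw_def)
    then have "h e \<notin> free_inds N" by (simp add: bond_inds_def free_inds_def)
    then have "ends ?G (h e) = Some ` carriers N (h e)" by (simp add: delete_vertex_def structure_graph_def)
    then show ?thesis unfolding im by (simp add: inj_image_eq_iff)
  qed
  ultimately show ?thesis unfolding graph_iso_def v e by metis
qed

text \<open>An index of a piece that is no bond has a single carrier, and the factorization requires
  that index \<open>j\<close> be carried at the leaf \<open>Inl j\<close>. This determines the
  indices of every piece completely.\<close>

lemma factor_structure:
  assumes F: "tree_factorization D A T (g ` verts T) g" and T: "tree T" and L: "leaves T = Inl ` inds A"
  obtains h where "bij_betw h (edges T) (bond_inds (g ` verts T))"
    "\<And>v j. v \<in> verts T \<Longrightarrow> j \<in> inds (g v) \<longleftrightarrow> (\<exists>e\<in>edges T. j = h e \<and> v \<in> ends T e) \<or> j \<in> inds A \<and> v = Inl j"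
    "free_inds (g ` verts T) = inds A"
proof -
  let ?N = "g ` verts T"
  have net: "tensor_network D ?N" and inj: "inj_on g (verts T)" and A: "A = contraction D ?N"
    and iso: "graph_iso (\<lambda>v. Some (g v)) T (delete_vertex (structure_graph ?N) None)"
    and own: "\<And>i. i \<in> inds A \<Longrightarrow> i \<in> inds (g (Inl i))"
    using F by (auto simp: tree_factorization_def bij_betw_def)
  have free: "free_inds ?N = inds A" using arg_cong[OF A, of inds] by simp
  have leaf: "Inl i \<in> verts T" if "i \<in> inds A" for i
  proof -
    have "Inl i \<in> leaves T" using L that by simp
    then show ?thesis by (simp add: leaves_def)
  qed
  have ends: "ends T e \<subseteq> verts T" if "e \<in> edges T" for e using T that by (auto simp: tree_def wf_graph_def)
  obtain h where h: "bij_betw h (edges T) (bond_inds ?N)"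
    and car: "\<And>e. e \<in> edges T \<Longrightarrow> carriers ?N (h e) = g ` ends T e"
    using iso unfolding graph_iso_structure by blast
  have "j \<in> inds (g v) \<longleftrightarrow> (\<exists>e\<in>edges T. j = h e \<and> v \<in> ends T e) \<or> j \<in> inds A \<and> v = Inl j"
    if v: "v \<in> verts T" for v j
  proof
    assume j: "j \<in> inds (g v)"
    have gv: "g v \<in> ?N" using v by blast
    show "(\<exists>e\<in>edges T. j = h e \<and> v \<in> ends T e) \<or> j \<in> inds A \<and> v = Inl j"
    proof (cases "j \<in> bond_inds ?N")
      case True
      then obtain e where e: "e \<in> edges T" "j = h e" using h by (auto simp: bij_betw_def)
      have "g v \<in> carriers ?N j" using gv j by (simp add: carriers_iff)
      then have "g v \<in> g ` ends T e" using car[OF e(1)] e(2) by simp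
      then have "v \<in> ends T e" using inj_on_image_mem_iff[OF inj v ends[OF e(1)]] by blast
      then show ?thesis using e by blast
    next
      case False
      then have jf: "j \<in> free_inds ?N" using network_index[OF net gv j] by blast
      then have jA: "j \<in> inds A" using free by blast
      have "g v \<in> carriers ?N j" "g (Inl j) \<in> carriers ?N j"
        using gv j own[OF jA] leaf[OF jA] by (auto simp: carriers_iff)
      moreover have "card (carriers ?N j) = 1" using jf by (simp add: free_inds_def)
      ultimately have "g v = g (Inl j)" by (metis card_1_singletonE singletonD)
      then have "v = Inl j" using inj_onD[OF inj _ v leaf[OF jA]] by blast
      then show ?thesis using jA by blast
    qed
  next
    assume "(\<exists>e\<in>edges T. j = h e \<and> v \<in> ends T e) \<or> j \<in> inds A \<and> v = Inl j"
    then show "j \<in> inds (g v)"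
    proof
      assume "\<exists>e\<in>edges T. j = h e \<and> v \<in> ends T e"
      then obtain e where e: "e \<in> edges T" "j = h e" "v \<in> ends T e" by blast
      then have "g v \<in> carriers ?N j" using car by auto
      then show ?thesis by (simp add: carriers_iff)
    qed (use own in blast)
  qed
  then show ?thesis using that h free by blast
qed

locale factoring =
  fixes D :: "'i \<Rightarrow> 'd set" and N :: "('i, 'd) tensor set" and Ts :: "('i, 'd) tensor \<Rightarrow> 'i leaf_tree"
    and g :: "('i, 'd) tensor \<Rightarrow> 'i + nat \<Rightarrow> ('i, 'd) tensor"
  assumes network: "tensor_network D N" and factors: "factors_along D N Ts g"
begin

definition pieces :: "(('i, 'd) tensor \<times> ('i + nat)) set" where
  "pieces = {(A, v). A \<in> N \<and> v \<in> verts (Ts A)}"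

definition piece :: "('i, 'd) tensor \<times> ('i + nat) \<Rightarrow> ('i, 'd) tensor" where
  "piece = (\<lambda>(A, v). g A v)"

lemma trees: "A \<in> N \<Longrightarrow> tree (Ts A)"
  using factors by (auto simp: factors_along_def)

lemma ends_sub: "A \<in> N \<Longrightarrow> e \<in> edges (Ts A) \<Longrightarrow> ends (Ts A) e \<subseteq> verts (Ts A) \<and> card (ends (Ts A) e) = 2"
  using trees by (auto simp: tree_def wf_graph_def)

text \<open>Tensors without indices are kept whole. Here they are brought into the same form as the
  factored ones, with a tree without edges.\<close>

lemma factor_cases:
  assumes A: "A \<in> N"
  shows "tensor_network D (g A ` verts (Ts A))" "inj_on (g A) (verts (Ts A))"
    "contraction D (g A ` verts (Ts A)) = A"
    "\<exists>h. bij_betw h (edges (Ts A)) (bond_inds (g A ` verts (Ts A))) \<and>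
      (\<forall>v\<in>verts (Ts A). \<forall>j. j \<in> inds (g A v) \<longleftrightarrow>
        (\<exists>e\<in>edges (Ts A). j = h e \<and> v \<in> ends (Ts A) e) \<or> j \<in> inds A \<and> v = Inl j)"
proof -
  have "tensor_network D (g A ` verts (Ts A)) \<and> inj_on (g A) (verts (Ts A)) \<and>
    contraction D (g A ` verts (Ts A)) = A \<and>
    (\<exists>h. bij_betw h (edges (Ts A)) (bond_inds (g A ` verts (Ts A))) \<and>
      (\<forall>v\<in>verts (Ts A). \<forall>j. j \<in> inds (g A v) \<longleftrightarrow>
        (\<exists>e\<in>edges (Ts A). j = h e \<and> v \<in> ends (Ts A) e) \<or> j \<in> inds A \<and> v = Inl j))"
  proof (cases "inds A = {}")
    case True
    moreover have "if inds A = {} then \<exists>v. verts (Ts A) = {v} \<and> g A v = A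
         else leaves (Ts A) = Inl ` inds A \<and> tree_factorization D A (Ts A) (g A ` verts (Ts A)) (g A)"
      using factors A unfolding factors_along_def by blast
    ultimately obtain v where v: "verts (Ts A) = {v}" "g A v = A" by auto
    have over: "tensor_over D A" using network A by (simp add: tensor_network_def)
    have "edges (Ts A) = {}"
    proof (rule ccontr)
      assume "edges (Ts A) \<noteq> {}"
      then obtain e where e: "ends (Ts A) e \<subseteq> {v}" "card (ends (Ts A) e) = 2"
        using ends_sub[OF A] v(1) by blast
      then have "card (ends (Ts A) e) \<le> card {v}" by (intro card_mono) auto
      then show False using e(2) by simp
    qed
    moreover have "carriers {A} i = {}" for i using True by (simp add: carriers_def)
    then have "tensor_network D {A}" "bond_inds {A} = {}"
      using over by (auto simp: tensor_network_def bond_inds_def)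
    ultimately show ?thesis using v True contraction_singleton[OF over] by (simp add: bij_betw_def)
  next
    case False
    then have L: "leaves (Ts A) = Inl ` inds A"
      and F: "tree_factorization D A (Ts A) (g A ` verts (Ts A)) (g A)"
      using factors A by (auto simp: factors_along_def)
    obtain h where "bij_betw h (edges (Ts A)) (bond_inds (g A ` verts (Ts A)))"
      "\<And>v j. v \<in> verts (Ts A) \<Longrightarrow> j \<in> inds (g A v) \<longleftrightarrow>
        (\<exists>e\<in>edges (Ts A). j = h e \<and> v \<in> ends (Ts A) e) \<or> j \<in> inds A \<and> v = Inl j"
      by (rule factor_structure[OF F trees[OF A] L]) blast
    then show ?thesis using F unfolding tree_factorization_def bij_betw_def by metis
  qed
  then show "tensor_network D (g A ` verts (Ts A))" "inj_on (g A) (verts (Ts A))"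
    "contraction D (g A ` verts (Ts A)) = A"
    "\<exists>h. bij_betw h (edges (Ts A)) (bond_inds (g A ` verts (Ts A))) \<and>
      (\<forall>v\<in>verts (Ts A). \<forall>j. j \<in> inds (g A v) \<longleftrightarrow>
        (\<exists>e\<in>edges (Ts A). j = h e \<and> v \<in> ends (Ts A) e) \<or> j \<in> inds A \<and> v = Inl j)"
    by blast+
qed

definition bond_name :: "('i, 'd) tensor \<Rightarrow> nat \<Rightarrow> 'i" where
  "bond_name A = (SOME h. bij_betw h (edges (Ts A)) (bond_inds (g A ` verts (Ts A))) \<and>
      (\<forall>v\<in>verts (Ts A). \<forall>j. j \<in> inds (g A v) \<longleftrightarrow>
        (\<exists>e\<in>edges (Ts A). j = h e \<and> v \<in> ends (Ts A) e) \<or> j \<in> inds A \<and> v = Inl j))"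

lemma bond_name:
  "A \<in> N \<Longrightarrow> v \<in> verts (Ts A) \<Longrightarrow> j \<in> inds (g A v) \<longleftrightarrow>
     (\<exists>e\<in>edges (Ts A). j = bond_name A e \<and> v \<in> ends (Ts A) e) \<or> j \<in> inds A \<and> v = Inl j"
  "A \<in> N \<Longrightarrow> B \<in> N \<Longrightarrow> e \<in> edges (Ts A) \<Longrightarrow> bond_name A e \<notin> inds B"
  "A \<in> N \<Longrightarrow> B \<in> N \<Longrightarrow> e \<in> edges (Ts A) \<Longrightarrow> f \<in> edges (Ts B) \<Longrightarrow>
     bond_name A e = bond_name B f \<Longrightarrow> A = B \<and> e = f"
proof -
  have h: "bij_betw (bond_name A) (edges (Ts A)) (bond_inds (g A ` verts (Ts A))) \<and>
      (\<forall>v\<in>verts (Ts A). \<forall>j. j \<in> inds (g A v) \<longleftrightarrow>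
        (\<exists>e\<in>edges (Ts A). j = bond_name A e \<and> v \<in> ends (Ts A) e) \<or> j \<in> inds A \<and> v = Inl j)"
    if "A \<in> N" for A
    unfolding bond_name_def by (rule someI_ex[OF factor_cases(4)[OF that]])
  have bond: "bond_name A e \<in> bond_inds (g A ` verts (Ts A))" if "A \<in> N" "e \<in> edges (Ts A)" for A e
    using h[OF that(1)] that(2) by (auto simp: bij_betw_def)
  have d: "\<forall>A\<in>N. \<forall>B\<in>N. bond_inds (g A ` verts (Ts A)) \<inter> inds B = {}"
    "\<forall>A\<in>N. \<forall>B\<in>N. A \<noteq> B \<longrightarrow> bond_inds (g A ` verts (Ts A)) \<inter> bond_inds (g B ` verts (Ts B)) = {}"
    using factors by (auto simp: factors_along_def)
  show "A \<in> N \<Longrightarrow> v \<in> verts (Ts A) \<Longrightarrow> j \<in> inds (g A v) \<longleftrightarrow>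
     (\<exists>e\<in>edges (Ts A). j = bond_name A e \<and> v \<in> ends (Ts A) e) \<or> j \<in> inds A \<and> v = Inl j"
    using h by blast
  show "A \<in> N \<Longrightarrow> B \<in> N \<Longrightarrow> e \<in> edges (Ts A) \<Longrightarrow> bond_name A e \<notin> inds B"
    using d(1) bond by blast
  assume *: "A \<in> N" "B \<in> N" "e \<in> edges (Ts A)" "f \<in> edges (Ts B)" "bond_name A e = bond_name B f"
  have "A = B"
  proof (rule ccontr)
    assume "A \<noteq> B"
    then have "bond_inds (g A ` verts (Ts A)) \<inter> bond_inds (g B ` verts (Ts B)) = {}" using d(2) * by blast
    then show False using bond[OF *(1,3)] bond[OF *(2,4)] *(5) by auto
  qed
  moreover have "inj_on (bond_name A) (edges (Ts A))" using h[OF *(1)] by (simp add: bij_betw_def)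
  ultimately show "A = B \<and> e = f" using * by (auto dest: inj_onD)
qed

text \<open>A network is a set, so equal pieces of different tensors would be identified. A piece
  shared by \<open>A\<close> and \<open>B\<close> can have no bond, since bonds are private to one
  tensor; both trees are then single vertices, the piece is \<open>A\<close> as well as
  \<open>B\<close>, and these coincide.\<close>

lemma inj_piece: "inj_on piece pieces"
proof (rule inj_onI)
  fix x y assume xy: "x \<in> pieces" "y \<in> pieces" "piece x = piece y"
  obtain A v B u where x: "x = (A, v)" and y: "y = (B, u)" by (cases x, cases y)
  have A: "A \<in> N" "v \<in> verts (Ts A)" and B: "B \<in> N" "u \<in> verts (Ts B)" and eq: "g A v = g B u"
    using xy by (auto simp: x y pieces_def piece_def)
  have AB: "A = B"
  proof (rule ccontr)
    assume ne: "A \<noteq> B"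
    have iso: "v \<notin> ends (Ts A) e"
      if "A \<in> N" "B \<in> N" "v \<in> verts (Ts A)" "u \<in> verts (Ts B)" "g A v = g B u" "A \<noteq> B" "e \<in> edges (Ts A)"
      for A B v u e
    proof
      assume "v \<in> ends (Ts A) e"
      then have "bond_name A e \<in> inds (g A v)" using bond_name(1)[OF that(1,3)] that(7) by blast
      then have "bond_name A e \<in> inds (g B u)" using that(5) by simp
      with bond_name(1)[OF that(2,4)] consider f where "f \<in> edges (Ts B)" "bond_name A e = bond_name B f" | "bond_name A e \<in> inds B"
        by blast
      then show False
      proof cases
        case 1
        then show False using bond_name(3)[OF that(1,2,7)] that(6) by blast
      qed (use bond_name(2)[OF that(1,2,7)] in blast)
    qed
    have single: "g A v = A" if "A \<in> N" "v \<in> verts (Ts A)" "\<And>e. e \<in> edges (Ts A) \<Longrightarrow> v \<notin> ends (Ts A) e" for A v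
    proof -
      have V: "verts (Ts A) = {v}" by (rule tree_isolated_vertex[OF trees[OF that(1)] that(2,3)])
      have "tensor_over D (g A v)" using factor_cases(1)[OF that(1)] that(2) by (auto simp: tensor_network_def)
      then have "contraction D {g A v} = g A v" by (rule contraction_singleton)
      then show ?thesis using factor_cases(3)[OF that(1)] V by simp
    qed
    have "g A v = A" using single[OF A] iso[OF A(1) B(1) A(2) B(2) eq ne] by blast
    moreover have "g B u = B" using single[OF B] iso[OF B(1) A(1) B(2) A(2) eq[symmetric] ne[symmetric]] by blast
    ultimately show False using eq ne by simp
  qed
  then have "v = u" using factor_cases(2)[OF A(1)] A(2) B(2) eq by (auto dest: inj_onD)
  then show "x = y" using AB x y by simp
qed

lemma factored_network_eq: "factored_network N Ts g = piece ` pieces"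
  by (auto simp: factored_network_def piece_def pieces_def)

lemma finite_pieces: "finite pieces"
proof -
  have "pieces = (SIGMA A:N. verts (Ts A))" by (auto simp: pieces_def)
  moreover have "finite N" using network by (simp add: tensor_network_def)
  moreover have "finite (verts (Ts A))" if "A \<in> N" for A using trees[OF that] by (auto simp: tree_def wf_graph_def)
  ultimately show ?thesis by simp
qed

lemma carriers_image:
  assumes U: "U \<subseteq> pieces"
  shows "card (carriers (piece ` U) j) = card {x \<in> U. j \<in> inds (piece x)}"
proof -
  have "carriers (piece ` U) j = piece ` {x \<in> U. j \<in> inds (piece x)}" by (auto simp: carriers_def)
  moreover have "inj_on piece {x \<in> U. j \<in> inds (piece x)}"
    by (rule inj_on_subset[OF inj_piece]) (use U in auto)
  ultimately show ?thesis by (simp add: card_image)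
qed

text \<open>An open index of the pieces in \<open>U\<close> is a bond whose tree edge has one end in
  \<open>U\<close>, or an original index with exactly one owner in \<open>U\<close>. This is the
  counterpart of \<open>rk\<close> for actual factorizations.\<close>

lemma rank_le:
  assumes U: "U \<subseteq> pieces"
  shows "card (free_inds (piece ` U)) \<le>
    card {(A, e). A \<in> N \<and> e \<in> edges (Ts A) \<and> card {v \<in> ends (Ts A) e. (A, v) \<in> U} = 1} +
    card {i. \<exists>!A. i \<in> inds A \<and> (A, Inl i) \<in> U}"
proof -
  let ?X = "{(A, e). A \<in> N \<and> e \<in> edges (Ts A) \<and> card {v \<in> ends (Ts A) e. (A, v) \<in> U} = 1}"
  let ?Y = "{i. \<exists>!A. i \<in> inds A \<and> (A, Inl i) \<in> U}"
  have finU: "finite U" using U finite_pieces finite_subset by blast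
  have finN: "finite N" using network by (simp add: tensor_network_def)
  have "?X \<subseteq> (SIGMA A:N. edges (Ts A))" by auto
  moreover have "finite (SIGMA A:N. edges (Ts A))"
    using finN trees by (auto simp: tree_def wf_graph_def)
  ultimately have finX: "finite ?X" by (rule finite_subset)
  have "?Y \<subseteq> (\<Union>A\<in>N. inds A)" using U by (auto simp: pieces_def)
  moreover have "finite (\<Union>A\<in>N. inds A)" using finN network by (auto simp: tensor_network_def tensor_over_def)
  ultimately have finY: "finite ?Y" by (rule finite_subset)
  have "free_inds (piece ` U) \<subseteq> (\<lambda>(A, e). bond_name A e) ` ?X \<union> ?Y"
  proof
    fix j assume "j \<in> free_inds (piece ` U)"
    then have one: "card {x \<in> U. j \<in> inds (piece x)} = 1"
      using carriers_image[OF U] by (simp add: free_inds_def)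
    then obtain x where x: "{x \<in> U. j \<in> inds (piece x)} = {x}" using card_1_singletonE by blast
    obtain A v where "x = (A, v)" by (cases x)
    then have Av: "{x \<in> U. j \<in> inds (piece x)} = {(A, v)}" using x by simp
    have "(A, v) \<in> {x \<in> U. j \<in> inds (piece x)}" unfolding Av by simp
    then have AvU: "(A, v) \<in> U" "j \<in> inds (g A v)" by (simp_all add: piece_def)
    then have A: "A \<in> N" "v \<in> verts (Ts A)" using U by (auto simp: pieces_def)
    consider e where "e \<in> edges (Ts A)" "j = bond_name A e" "v \<in> ends (Ts A) e" | "j \<in> inds A" "v = Inl j"
      using bond_name(1)[OF A] AvU(2) by blast
    then show "j \<in> (\<lambda>(A, e). bond_name A e) ` ?X \<union> ?Y"
    proof cases
      case 1
      have "{u \<in> ends (Ts A) e. (A, u) \<in> U} = {v}"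
      proof (intro set_eqI iffI)
        fix u assume u: "u \<in> {u \<in> ends (Ts A) e. (A, u) \<in> U}"
        then have "u \<in> verts (Ts A)" using ends_sub[OF A(1) 1(1)] by blast
        then have "j \<in> inds (g A u)" using bond_name(1)[OF A(1)] 1 u by blast
        then have "(A, u) \<in> {x \<in> U. j \<in> inds (piece x)}" using u by (simp add: piece_def)
        then show "u \<in> {v}" unfolding Av by simp
      qed (use 1 AvU in auto)
      then have "(A, e) \<in> ?X" using A 1 by simp
      then show ?thesis using 1(2) by force
    next
      case 2
      have "B = A" if B: "j \<in> inds B" "(B, Inl j) \<in> U" for B
      proof -
        have "B \<in> N" "Inl j \<in> verts (Ts B)" using B(2) U by (auto simp: pieces_def)
        then have "j \<in> inds (g B (Inl j))" using bond_name(1) B(1) by blast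
        then have "(B, Inl j) \<in> {x \<in> U. j \<in> inds (piece x)}" using B(2) by (simp add: piece_def)
        then show ?thesis unfolding Av by simp
      qed
      then show ?thesis using 2 AvU(1) by blast
    qed
  qed
  then have "card (free_inds (piece ` U)) \<le> card ((\<lambda>(A, e). bond_name A e) ` ?X \<union> ?Y)"
    by (rule card_mono[rotated]) (use finX finY in simp)
  also have "\<dots> \<le> card ((\<lambda>(A, e). bond_name A e) ` ?X) + card ?Y" by (rule card_Un_le)
  also have "\<dots> \<le> card ?X + card ?Y" using card_image_le[OF finX] by simp
  finally show ?thesis .
qed

lemma factored_network_ok: "tensor_network D (factored_network N Ts g)"
  unfolding factored_network_eq tensor_network_def
proof (intro conjI ballI allI)
  show "finite (piece ` pieces)" using finite_pieces by simp
  obtain A where A: "A \<in> N" using network by (auto simp: tensor_network_def)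
  then obtain v where "v \<in> verts (Ts A)" using trees[OF A] by (auto simp: tree_def)
  then show "piece ` pieces \<noteq> {}" using A by (auto simp: pieces_def)
  show "tensor_over D X" if "X \<in> piece ` pieces" for X
    using that factor_cases(1) by (auto simp: pieces_def piece_def tensor_network_def)
  show "card (carriers (piece ` pieces) j) \<le> 2" for j
  proof (cases "\<exists>A e. A \<in> N \<and> e \<in> edges (Ts A) \<and> j = bond_name A e")
    case True
    then obtain A e where A: "A \<in> N" and e: "e \<in> edges (Ts A)" "j = bond_name A e" by blast
    have "{x \<in> pieces. j \<in> inds (piece x)} \<subseteq> (\<lambda>u. (A, u)) ` ends (Ts A) e"
    proof
      fix x assume "x \<in> {x \<in> pieces. j \<in> inds (piece x)}"
      then obtain B u where x: "x = (B, u)" "B \<in> N" "u \<in> verts (Ts B)" "j \<in> inds (g B u)"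
        by (auto simp: pieces_def piece_def)
      have "j \<notin> inds B" using bond_name(2)[OF A x(2) e(1)] e(2) by simp
      then obtain f where f: "f \<in> edges (Ts B)" "j = bond_name B f" "u \<in> ends (Ts B) f" using bond_name(1)[OF x(2,3)] x(4) by blast
      have "A = B \<and> e = f" by (rule bond_name(3)[OF A x(2) e(1) f(1)]) (use e(2) f(2) in simp)
      then show "x \<in> (\<lambda>u. (A, u)) ` ends (Ts A) e" using x(1) f(3) by blast
    qed
    moreover have fin: "finite (ends (Ts A) e)" using ends_sub[OF A e(1)] by (auto intro: card_ge_0_finite)
    ultimately have "card {x \<in> pieces. j \<in> inds (piece x)} \<le> card ((\<lambda>u. (A, u)) ` ends (Ts A) e)"
      by (intro card_mono) auto
    also have "\<dots> \<le> card (ends (Ts A) e)" by (rule card_image_le[OF fin])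
    also have "\<dots> = 2" using ends_sub[OF A e(1)] by blast
    finally show ?thesis using carriers_image[of pieces] by simp
  next
    case False
    have "{x \<in> pieces. j \<in> inds (piece x)} \<subseteq> (\<lambda>A. (A, Inl j)) ` carriers N j"
    proof
      fix x assume "x \<in> {x \<in> pieces. j \<in> inds (piece x)}"
      then obtain B u where x: "x = (B, u)" "B \<in> N" "u \<in> verts (Ts B)" "j \<in> inds (g B u)"
        by (auto simp: pieces_def piece_def)
      then have "j \<in> inds B \<and> u = Inl j" using bond_name(1)[OF x(2,3)] False by blast
      then show "x \<in> (\<lambda>A. (A, Inl j)) ` carriers N j" using x(1,2) by (auto simp: carriers_def)
    qed
    moreover have fin: "finite (carriers N j)"
      using network by (auto simp: tensor_network_def carriers_def)
    ultimately have "card {x \<in> pieces. j \<in> inds (piece x)} \<le> card ((\<lambda>A. (A, Inl j :: 'i + nat)) ` carriers N j)"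
      by (intro card_mono) auto
    also have "\<dots> \<le> card (carriers N j)" by (rule card_image_le[OF fin])
    also have "\<dots> \<le> 2" using network by (simp add: tensor_network_def)
    finally show ?thesis using carriers_image[of pieces] by simp
  qed
qed

lemma partial_contraction_ok: "partial_contraction D N (factored_network N Ts g)"
  unfolding partial_contraction_def
proof (intro conjI)
  define f where "f X = fst (inv_into pieces piece X)" for X
  have f: "f (piece (A, v)) = A" if "(A, v) \<in> pieces" for A v
    using inv_into_f_f[OF inj_piece that] by (simp add: f_def)
  have "f ` factored_network N Ts g = N"
  proof
    show "f ` factored_network N Ts g \<subseteq> N"
      unfolding factored_network_eq using f by (auto simp: pieces_def)
    show "N \<subseteq> f ` factored_network N Ts g"
    proof
      fix A assume A: "A \<in> N"
      then obtain v where "v \<in> verts (Ts A)" using trees[OF A] by (auto simp: tree_def)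
      then have "(A, v) \<in> pieces" using A by (simp add: pieces_def)
      then show "A \<in> f ` factored_network N Ts g"
        unfolding factored_network_eq using f by (metis image_eqI)
    qed
  qed
  moreover have "contraction D {B \<in> factored_network N Ts g. f B = A} = A" if A: "A \<in> N" for A
  proof -
    have "{B \<in> factored_network N Ts g. f B = A} = g A ` verts (Ts A)"
    proof (intro set_eqI iffI)
      fix X assume "X \<in> {B \<in> factored_network N Ts g. f B = A}"
      then obtain B v where "X = piece (B, v)" "(B, v) \<in> pieces" "f X = A"
        unfolding factored_network_eq by auto
      then show "X \<in> g A ` verts (Ts A)" using f[of B v] by (auto simp: pieces_def piece_def)
    next
      fix X assume "X \<in> g A ` verts (Ts A)"
      then obtain v where v: "v \<in> verts (Ts A)" "X = piece (A, v)" by (auto simp: piece_def)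
      then have "(A, v) \<in> pieces" using A by (simp add: pieces_def)
      then show "X \<in> {B \<in> factored_network N Ts g. f B = A}"
        unfolding factored_network_eq using f v by auto
    qed
    then show ?thesis using factor_cases(3)[OF A] by simp
  qed
  ultimately show "\<exists>f. f ` factored_network N Ts g = N \<and>
      (\<forall>A\<in>N. contraction D {B \<in> factored_network N Ts g. f B = A} = A)" by blast
qed (rule network factored_network_ok)+

end

section \<open>Fresh names for the bond indices of a factorization\<close>

text \<open>Chosen greedily: an infinite set is not exhausted by the finitely many values already
  taken.\<close>

lemma distinct_representatives:
  assumes "finite J" "\<And>j. j \<in> J \<Longrightarrow> infinite (S j)"
  shows "\<exists>\<phi>. inj_on \<phi> J \<and> (\<forall>j\<in>J. \<phi> j \<in> S j)"
  using assms
proof (induction J rule: finite_induct)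
  case (insert x J)
  then obtain \<phi> where \<phi>: "inj_on \<phi> J" "\<forall>j\<in>J. \<phi> j \<in> S j" by auto
  have "infinite (S x - \<phi> ` J)" using insert by simp
  then obtain y where y: "y \<in> S x" "y \<notin> \<phi> ` J" by (metis Diff_iff finite.emptyI ex_in_conv)
  have "inj_on (\<phi>(x := y)) (insert x J)" using \<phi>(1) y(2) insert(2)
    by (auto simp: inj_on_def)
  moreover have "\<forall>j\<in>insert x J. (\<phi>(x := y)) j \<in> S j" using \<phi>(2) y(1) insert(2) by auto
  ultimately show ?case by blast
qed simp

lemma bij_betw_PiE:
  assumes \<phi>: "inj_on \<phi> S" and \<beta>: "\<And>j. j \<in> S \<Longrightarrow> bij_betw (\<beta> j) (D (\<phi> j)) (D j)"
  shows "bij_betw (\<lambda>\<tau>. restrict (\<lambda>j. \<beta> j (\<tau> (\<phi> j))) S) (PiE (\<phi> ` S) D) (PiE S D)"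
proof (rule bij_betw_byWitness[where f' = "\<lambda>\<sigma>. restrict (\<lambda>k. inv_into (D k) (\<beta> (inv_into S \<phi> k)) (\<sigma> (inv_into S \<phi> k))) (\<phi> ` S)"])
  let ?f = "\<lambda>\<tau>. restrict (\<lambda>j. \<beta> j (\<tau> (\<phi> j))) S"
  let ?g = "\<lambda>\<sigma>. restrict (\<lambda>k. inv_into (D k) (\<beta> (inv_into S \<phi> k)) (\<sigma> (inv_into S \<phi> k))) (\<phi> ` S)"
  have inv: "inv_into S \<phi> (\<phi> j) = j" if "j \<in> S" for j using inv_into_f_f[OF \<phi> that] .
  have in_D: "\<beta> j x \<in> D j" if "j \<in> S" "x \<in> D (\<phi> j)" for j x
    using \<beta>[OF that(1)] that(2) by (auto simp: bij_betw_def)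
  have inv_D: "inv_into (D (\<phi> j)) (\<beta> j) y \<in> D (\<phi> j)" "\<beta> j (inv_into (D (\<phi> j)) (\<beta> j) y) = y"
    if "j \<in> S" "y \<in> D j" for j y
    using \<beta>[OF that(1)] that(2) by (auto simp: bij_betw_def inv_into_into f_inv_into_f)
  have inv_\<beta>: "inv_into (D (\<phi> j)) (\<beta> j) (\<beta> j x) = x" if "j \<in> S" "x \<in> D (\<phi> j)" for j x
    using \<beta>[OF that(1)] that(2) by (auto simp: bij_betw_def)
  show "\<forall>\<tau>\<in>PiE (\<phi> ` S) D. ?g (?f \<tau>) = \<tau>"
  proof
    fix \<tau> assume \<tau>: "\<tau> \<in> PiE (\<phi> ` S) D"
    show "?g (?f \<tau>) = \<tau>"
    proof (rule PiE_ext[OF _ \<tau>])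
      show "?g (?f \<tau>) \<in> PiE (\<phi> ` S) D"
        using \<tau> inv inv_\<beta> by (auto simp: PiE_iff)
      show "?g (?f \<tau>) k = \<tau> k" if "k \<in> \<phi> ` S" for k
        using that \<tau> inv inv_\<beta> by (auto simp: PiE_iff)
    qed
  qed
  show "\<forall>\<sigma>\<in>PiE S D. ?f (?g \<sigma>) = \<sigma>"
  proof
    fix \<sigma> assume \<sigma>: "\<sigma> \<in> PiE S D"
    show "?f (?g \<sigma>) = \<sigma>"
    proof (rule PiE_ext[OF _ \<sigma>])
      show "?f (?g \<sigma>) \<in> PiE S D" using \<sigma> inv inv_D by (auto simp: PiE_iff)
      show "?f (?g \<sigma>) j = \<sigma> j" if "j \<in> S" for j using that \<sigma> inv inv_D by (auto simp: PiE_iff)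
    qed
  qed
  show "?f ` PiE (\<phi> ` S) D \<subseteq> PiE S D" using in_D by (auto simp: PiE_iff)
  show "?g ` PiE S D \<subseteq> PiE (\<phi> ` S) D" using inv inv_D by (auto simp: PiE_iff)
qed

text \<open>A factorization comes with bond names that may clash with other indices. Each bond is
  renamed to an index of equal domain size, of which \<open>D(2)\<close> supplies infinitely many,
  and entries are transported along bijections of the domains. Equal sizes also preserve the
  condition that compares bonds with an index of \<open>A\<close>.\<close>

lemma rename_factorization:
  fixes D :: "'i \<Rightarrow> 'd set"
  assumes D: "\<And>i. finite (D i)" "\<And>i. infinite {j. card (D j) = card (D i)}"
    and F: "tree_factorization D A T N g" and Z: "finite Z"
  shows "\<exists>N' g'. tree_factorization D A T N' g' \<and> bond_inds N' \<inter> Z = {}"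
proof -
  have net: "tensor_network D N" and bij: "bij_betw g (verts T) N" and A: "A = contraction D N"
    and iso: "graph_iso (\<lambda>v. Some (g v)) T (delete_vertex (structure_graph N) None)"
    and own: "\<And>i. i \<in> inds A \<Longrightarrow> i \<in> inds (g (Inl i))"
    and size: "\<exists>i\<in>inds A. \<forall>j\<in>bond_inds N. card (D j) \<le> card (D i)"
    using F by (auto simp: tree_factorization_def)
  have finN: "finite N" and over: "\<And>X. X \<in> N \<Longrightarrow> tensor_over D X"
    using net by (auto simp: tensor_network_def)
  let ?J = "bond_inds N" and ?F = "free_inds N"
  let ?K = "?J \<union> ?F"
  have indsK: "inds X \<subseteq> ?K" if "X \<in> N" for X using network_index[OF net that] by blast
  have "?K \<subseteq> (\<Union>X\<in>N. inds X)"
  proof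
    fix i assume "i \<in> ?K"
    then have "carriers N i \<noteq> {}" by (auto simp: bond_inds_def free_inds_def)
    then show "i \<in> (\<Union>X\<in>N. inds X)" by (auto simp: carriers_def)
  qed
  moreover have "finite (\<Union>X\<in>N. inds X)" using finN over by (auto simp: tensor_over_def)
  ultimately have finK: "finite ?K" by (rule finite_subset)
  then have finJ: "finite ?J" by simp
  \<comment> \<open>Avoiding \<open>Z\<close> is the goal; avoiding the free indices, which keep
    their names, makes the renaming injective.\<close>
  have "infinite ({k. card (D k) = card (D j)} - (Z \<union> ?F))" for j
    using D(2)[of j] Z finK by simp
  from distinct_representatives[where S = "\<lambda>j. {k. card (D k) = card (D j)} - (Z \<union> ?F)", OF finJ this]
  obtain \<phi>0 where \<phi>0: "inj_on \<phi>0 ?J" "\<forall>j\<in>?J. \<phi>0 j \<in> {k. card (D k) = card (D j)} - (Z \<union> ?F)"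
    by (elim exE conjE)
  define \<phi> where "\<phi> j = (if j \<in> ?J then \<phi>0 j else j)" for j
  have JF: "?J \<inter> ?F = {}" by (auto simp: bond_inds_def free_inds_def)
  have \<phi>J: "card (D (\<phi> j)) = card (D j)" "\<phi> j \<notin> Z" "\<phi> j \<notin> ?F" if "j \<in> ?J" for j
    using \<phi>0(2) that by (auto simp: \<phi>_def)
  have \<phi>F: "\<phi> j = j" if "j \<notin> ?J" for j using that by (simp add: \<phi>_def)
  have inj: "inj_on \<phi> ?K"
  proof (rule inj_onI)
    fix x y assume xy: "x \<in> ?K" "y \<in> ?K" "\<phi> x = \<phi> y"
    show "x = y"
    proof (cases "x \<in> ?J"; cases "y \<in> ?J")
      assume "x \<in> ?J" "y \<in> ?J"
      then show ?thesis using inj_onD[OF \<phi>0(1)] xy(3) by (simp add: \<phi>_def)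
    next
      assume "x \<in> ?J" "y \<notin> ?J"
      then show ?thesis using \<phi>J(3)[of x] \<phi>F[of y] xy by auto
    next
      assume "x \<notin> ?J" "y \<in> ?J"
      then show ?thesis using \<phi>J(3)[of y] \<phi>F[of x] xy by auto
    next
      assume "x \<notin> ?J" "y \<notin> ?J"
      then show ?thesis using \<phi>F xy(3) by simp
    qed
  qed
  \<comment> \<open>The identity away from the bonds keeps the values of the free indices, so the
    contraction stays literally the same tensor.\<close>
  have "\<exists>b. bij_betw b (D (\<phi> j)) (D j) \<and> (j \<notin> ?J \<longrightarrow> b = id)" for j
  proof (cases "j \<in> ?J")
    case True
    then show ?thesis using finite_same_card_bij[OF D(1) D(1) \<phi>J(1)[OF True]] by blast
  next
    case False
    then show ?thesis using \<phi>F[OF False] by (intro exI[of _ id]) auto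
  qed
  then obtain \<beta> where \<beta>: "\<And>j. bij_betw (\<beta> j) (D (\<phi> j)) (D j)" "\<And>j. j \<notin> ?J \<Longrightarrow> \<beta> j = id" by metis
  let ?pull = "\<lambda>S \<tau>. restrict (\<lambda>j. \<beta> j (\<tau> (\<phi> j))) S"
  have pull: "bij_betw (?pull S) (PiE (\<phi> ` S) D) (PiE S D)" if "S \<subseteq> ?K" for S
    by (rule bij_betw_PiE) (use inj_on_subset[OF inj that] \<beta>(1) in auto)
  define r where "r X = Tensor (\<phi> ` inds X) (restrict (\<lambda>\<tau>. entry X (?pull (inds X) \<tau>)) (PiE (\<phi> ` inds X) D))" for X
  have r_inds [simp]: "inds (r X) = \<phi> ` inds X" for X by (simp add: r_def)
  have r_entry: "entry (r X) \<tau> = entry X (?pull (inds X) \<tau>)" if "\<tau> \<in> PiE (\<phi> ` inds X) D" for X \<tau>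
    using that by (simp add: r_def)
  have inj_r: "inj_on r N"
  proof (rule inj_onI)
    fix X Y assume XY: "X \<in> N" "Y \<in> N" "r X = r Y"
    have "\<phi> ` inds X = \<phi> ` inds Y" using arg_cong[OF XY(3), of inds] by simp
    then have eq: "inds X = inds Y" using inj_on_image_eq_iff[OF inj indsK[OF XY(1)] indsK[OF XY(2)]] by blast
    have "entry X \<sigma> = entry Y \<sigma>" for \<sigma>
    proof (cases "\<sigma> \<in> PiE (inds X) D")
      case True
      then obtain \<tau> where \<tau>: "\<tau> \<in> PiE (\<phi> ` inds X) D" "?pull (inds X) \<tau> = \<sigma>"
        using pull[OF indsK[OF XY(1)]] unfolding bij_betw_def by (metis (no_types, lifting) imageE)
      then show ?thesis using r_entry[OF \<tau>(1)] r_entry[of \<tau> Y] XY(3) eq by simp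
    next
      case False
      have "entry X \<in> extensional (PiE (inds X) D)" "entry Y \<in> extensional (PiE (inds X) D)"
        using over[OF XY(1)] over[OF XY(2)] eq by (auto simp: tensor_over_def)
      then show ?thesis using extensional_arb[OF _ False] by metis
    qed
    then show "X = Y" using eq by (intro tensor.expand) auto
  qed
  let ?N = "r ` N"
  have car: "carriers ?N (\<phi> j) = r ` carriers N j" if "j \<in> ?K" for j
  proof -
    have "\<phi> j \<in> \<phi> ` inds X \<longleftrightarrow> j \<in> inds X" if "X \<in> N" for X
      using inj_on_image_mem_iff[OF inj \<open>j \<in> ?K\<close> indsK[OF that]] .
    then show ?thesis by (auto simp: carriers_def)
  qed
  have card_car: "card (carriers ?N (\<phi> j)) = card (carriers N j)" if "j \<in> ?K" for j
    unfolding car[OF that] by (rule card_image) (rule inj_on_subset[OF inj_r carriers_sub])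
  have car0: "carriers ?N k = {}" if "k \<notin> \<phi> ` ?K" for k
  proof -
    have "k \<notin> \<phi> ` inds X" if "X \<in> N" for X using \<open>k \<notin> _\<close> indsK[OF that] by blast
    then show ?thesis by (auto simp: carriers_def)
  qed
  have bond: "bond_inds ?N = \<phi> ` ?J"
  proof
    show "bond_inds ?N \<subseteq> \<phi> ` ?J"
    proof
      fix k assume k: "k \<in> bond_inds ?N"
      then have "k \<in> \<phi> ` ?K" using car0[of k] by (force simp: bond_inds_def)
      then obtain j where j: "j \<in> ?K" "k = \<phi> j" by blast
      then have "card (carriers N j) = 2" using k card_car[OF j(1)] by (simp add: bond_inds_def)
      then show "k \<in> \<phi> ` ?J" using j(2) by (simp add: bond_inds_def)
    qed
    show "\<phi> ` ?J \<subseteq> bond_inds ?N" using card_car by (auto simp: bond_inds_def)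
  qed
  have free: "free_inds ?N = ?F"
  proof
    show "free_inds ?N \<subseteq> ?F"
    proof
      fix k assume k: "k \<in> free_inds ?N"
      then have "k \<in> \<phi> ` ?K" using car0[of k] by (force simp: free_inds_def)
      then obtain j where j: "j \<in> ?K" "k = \<phi> j" by blast
      then have "j \<in> ?F" using k card_car[OF j(1)] by (simp add: free_inds_def)
      moreover have "\<phi> j = j" by (rule \<phi>F) (use calculation JF in blast)
      ultimately show "k \<in> ?F" using j(2) by simp
    qed
    show "?F \<subseteq> free_inds ?N"
    proof
      fix j assume j: "j \<in> ?F"
      then have "\<phi> j = j" using \<phi>F JF by blast
      then show "j \<in> free_inds ?N" using card_car[of j] j by (simp add: free_inds_def)
    qed
  qed
  have net': "tensor_network D ?N"
    unfolding tensor_network_def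
  proof (intro conjI ballI allI)
    show "finite ?N" "?N \<noteq> {}" using net by (auto simp: tensor_network_def)
    show "tensor_over D X" if X: "X \<in> ?N" for X
    proof -
      obtain Y where "Y \<in> N" "X = r Y" using X by blast
      then show ?thesis using over[of Y] by (auto simp: tensor_over_def r_def)
    qed
    show "card (carriers ?N k) \<le> 2" for k
    proof (cases "k \<in> \<phi> ` ?K")
      case True
      then obtain j where "j \<in> ?K" "k = \<phi> j" by blast
      then show ?thesis using card_car[of j] net by (simp add: tensor_network_def)
    next
      case False
      then show ?thesis using car0[OF False] by simp
    qed
  qed
  have "contraction D ?N = contraction D N"
  proof (rule tensor.expand, intro conjI)
    show "inds (contraction D ?N) = inds (contraction D N)" using free by simp
    have "(\<Sum>\<rho>\<in>PiE (bond_inds ?N) D. \<Prod>B\<in>?N. entry B (restrict (\<lambda>i. if i \<in> bond_inds ?N then \<rho> i else \<tau> i) (inds B)))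
        = (\<Sum>\<rho>\<in>PiE ?J D. \<Prod>B\<in>N. entry B (restrict (\<lambda>i. if i \<in> ?J then \<rho> i else \<tau> i) (inds B)))"
      if \<tau>: "\<tau> \<in> PiE ?F D" for \<tau>
    proof -
      have "(\<Prod>B\<in>?N. entry B (restrict (\<lambda>i. if i \<in> \<phi> ` ?J then \<rho> i else \<tau> i) (inds B)))
          = (\<Prod>X\<in>N. entry X (restrict (\<lambda>i. if i \<in> ?J then ?pull ?J \<rho> i else \<tau> i) (inds X)))"
        if \<rho>: "\<rho> \<in> PiE (\<phi> ` ?J) D" for \<rho>
      proof -
        let ?m = "\<lambda>i. if i \<in> \<phi> ` ?J then \<rho> i else \<tau> i"
        have m: "\<beta> j (?m (\<phi> j)) = (if j \<in> ?J then ?pull ?J \<rho> j else \<tau> j)" "?m (\<phi> j) \<in> D (\<phi> j)" if "j \<in> ?K" for j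
        proof -
          have "\<phi> j \<in> \<phi> ` ?J \<longleftrightarrow> j \<in> ?J" using inj_on_image_mem_iff[OF inj that, of ?J] by blast
          moreover have "\<tau> j \<in> D j" if "j \<notin> ?J" using \<open>j \<in> ?K\<close> that \<tau> by (auto simp: PiE_iff)
          ultimately show "\<beta> j (?m (\<phi> j)) = (if j \<in> ?J then ?pull ?J \<rho> j else \<tau> j)" "?m (\<phi> j) \<in> D (\<phi> j)"
            using \<rho> \<phi>F[of j] \<beta>(2)[of j] by (auto simp: PiE_iff)
        qed
        have "entry (r X) (restrict ?m (inds (r X))) = entry X (restrict (\<lambda>i. if i \<in> ?J then ?pull ?J \<rho> i else \<tau> i) (inds X))"
          if X: "X \<in> N" for X
        proof -
          have "restrict ?m (\<phi> ` inds X) \<in> PiE (\<phi> ` inds X) D" using m(2) indsK[OF X] by auto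
          then have "entry (r X) (restrict ?m (inds (r X))) = entry X (?pull (inds X) (restrict ?m (\<phi> ` inds X)))"
            using r_entry by simp
          also have "?pull (inds X) (restrict ?m (\<phi> ` inds X)) = restrict (\<lambda>i. if i \<in> ?J then ?pull ?J \<rho> i else \<tau> i) (inds X)"
          proof (rule restrict_ext)
            fix j assume j: "j \<in> inds X"
            then have "restrict ?m (\<phi> ` inds X) (\<phi> j) = ?m (\<phi> j)" by simp
            then show "\<beta> j (restrict ?m (\<phi> ` inds X) (\<phi> j)) = (if j \<in> ?J then ?pull ?J \<rho> j else \<tau> j)"
              using m(1)[of j] j indsK[OF X] by auto
          qed
          finally show ?thesis .
        qed
        then show ?thesis by (simp add: prod.reindex[OF inj_r] comp_def cong: prod.cong)
      qed
      then have "(\<Sum>\<rho>\<in>PiE (\<phi> ` ?J) D. \<Prod>B\<in>?N. entry B (restrict (\<lambda>i. if i \<in> \<phi> ` ?J then \<rho> i else \<tau> i) (inds B)))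
        = (\<Sum>\<rho>\<in>PiE (\<phi> ` ?J) D. \<Prod>X\<in>N. entry X (restrict (\<lambda>i. if i \<in> ?J then ?pull ?J \<rho> i else \<tau> i) (inds X)))"
        by (intro sum.cong refl)
      also have "\<dots> = (\<Sum>\<rho>\<in>PiE ?J D. \<Prod>X\<in>N. entry X (restrict (\<lambda>i. if i \<in> ?J then \<rho> i else \<tau> i) (inds X)))"
        by (rule sum.reindex_bij_betw[OF pull]) blast
      finally show ?thesis unfolding bond .
    qed
    then show "entry (contraction D ?N) = entry (contraction D N)"
      unfolding contraction_def free tensor.sel by (intro restrict_ext)
  qed
  moreover have "bij_betw (r \<circ> g) (verts T) ?N"
    using bij_betw_trans[OF bij bij_betw_imageI[OF inj_r refl]] .
  moreover have "graph_iso (\<lambda>v. Some ((r \<circ> g) v)) T (delete_vertex (structure_graph ?N) None)"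
  proof -
    obtain h where h: "bij_betw h (edges T) ?J" "\<forall>e\<in>edges T. carriers N (h e) = g ` ends T e"
      using iso unfolding graph_iso_structure by blast
    have "bij_betw (\<phi> \<circ> h) (edges T) (bond_inds ?N)"
      unfolding bond by (rule bij_betw_trans[OF h(1) bij_betw_imageI[OF inj_on_subset[OF inj] refl]]) blast
    moreover have "carriers ?N ((\<phi> \<circ> h) e) = (r \<circ> g) ` ends T e" if "e \<in> edges T" for e
    proof -
      have "h e \<in> ?K" using h(1) that by (auto simp: bij_betw_def)
      then show ?thesis using car h(2) that by (simp add: image_comp)
    qed
    ultimately show ?thesis unfolding graph_iso_structure
      using \<open>bij_betw (r \<circ> g) (verts T) ?N\<close> by blast
  qed
  moreover have "\<forall>i\<in>inds A. i \<in> inds ((r \<circ> g) (Inl i))"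
  proof
    fix i assume i: "i \<in> inds A"
    then have "i \<in> ?F" using A by simp
    then have "\<phi> i = i" using \<phi>F JF by blast
    then show "i \<in> inds ((r \<circ> g) (Inl i))" using own[OF i] by (simp, metis image_eqI)
  qed
  moreover have "\<exists>i\<in>inds A. \<forall>j\<in>bond_inds ?N. card (D j) \<le> card (D i)"
    using size \<phi>J(1) unfolding bond by force
  ultimately have "tree_factorization D A T ?N (r \<circ> g)"
    unfolding tree_factorization_def using net' A by simp
  moreover have "bond_inds ?N \<inter> Z = {}" unfolding bond using \<phi>J(2) by blast
  ultimately show ?thesis by blast
qed

text \<open>The factorizations are fixed one tensor after the other, each renamed away from all
  indices of \<open>N\<close> and from the finitely many bonds chosen before.\<close>

lemma factors_exist:
  fixes D :: "'i \<Rightarrow> 'd set"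
  assumes D: "\<And>i. finite (D i)" "\<And>i. infinite {j. card (D j) = card (D i)}"
    and N: "tensor_network D N" "\<And>A. A \<in> N \<Longrightarrow> tree_factorable D A"
    and Ts: "\<And>A. A \<in> N \<Longrightarrow> tree (Ts A)" "\<And>A. A \<in> N \<Longrightarrow> inds A = {} \<Longrightarrow> \<exists>v. verts (Ts A) = {v}"
      "\<And>A. A \<in> N \<Longrightarrow> inds A \<noteq> {} \<Longrightarrow> leaves (Ts A) = Inl ` inds A"
  shows "\<exists>g. factors_along D N Ts g"
proof -
  have finN: "finite N" and over: "\<And>A. A \<in> N \<Longrightarrow> tensor_over D A" using N(1) by (auto simp: tensor_network_def)
  let ?I = "\<Union>A\<in>N. inds A"
  have finI: "finite ?I" using finN over by (auto simp: tensor_over_def)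
  let ?b = "\<lambda>g A. bond_inds (g A ` verts (Ts A))"
  have "\<exists>g. (\<forall>A\<in>S. (if inds A = {} then (\<exists>v. verts (Ts A) = {v} \<and> g A v = A)
         else tree_factorization D A (Ts A) (g A ` verts (Ts A)) (g A)) \<and> finite (?b g A) \<and> ?b g A \<inter> ?I = {}) \<and>
      (\<forall>A\<in>S. \<forall>B\<in>S. A \<noteq> B \<longrightarrow> ?b g A \<inter> ?b g B = {})" if "S \<subseteq> N" for S
    using finite_subset[OF that finN] that
  proof (induction S rule: finite_induct)
    case empty
    then show ?case by simp
  next
    case (insert A S)
    have "S \<subseteq> N" using insert.prems by simp
    from insert.IH[OF this] obtain g where "(\<forall>A\<in>S. (if inds A = {} then (\<exists>v. verts (Ts A) = {v} \<and> g A v = A)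
         else tree_factorization D A (Ts A) (g A ` verts (Ts A)) (g A)) \<and> finite (?b g A) \<and> ?b g A \<inter> ?I = {}) \<and>
      (\<forall>A\<in>S. \<forall>B\<in>S. A \<noteq> B \<longrightarrow> ?b g A \<inter> ?b g B = {})"
      by (elim exE)
    then have g: "\<And>B. B \<in> S \<Longrightarrow> if inds B = {} then (\<exists>v. verts (Ts B) = {v} \<and> g B v = B)
         else tree_factorization D B (Ts B) (g B ` verts (Ts B)) (g B)"
      "\<And>B. B \<in> S \<Longrightarrow> finite (?b g B)" "\<And>B. B \<in> S \<Longrightarrow> ?b g B \<inter> ?I = {}"
      "\<And>B C. B \<in> S \<Longrightarrow> C \<in> S \<Longrightarrow> B \<noteq> C \<Longrightarrow> ?b g B \<inter> ?b g C = {}"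
      by blast+
    have A: "A \<in> N" using insert.prems by simp
    let ?Z = "?I \<union> (\<Union>B\<in>S. ?b g B)"
    have finZ: "finite ?Z" using finI insert(1) g(2) by simp
    have "\<exists>a. (if inds A = {} then (\<exists>v. verts (Ts A) = {v} \<and> a v = A)
         else tree_factorization D A (Ts A) (a ` verts (Ts A)) a) \<and>
         finite (bond_inds (a ` verts (Ts A))) \<and> bond_inds (a ` verts (Ts A)) \<inter> ?Z = {}"
    proof (cases "inds A = {}")
      case True
      then obtain v where "verts (Ts A) = {v}" using Ts(2)[OF A] by blast
      moreover have "carriers {A} i = {}" for i using True by (auto simp: carriers_def)
      then have "bond_inds {A} = {}" by (simp add: bond_inds_def)
      ultimately show ?thesis using True by (intro exI[of _ "\<lambda>_. A"]) simp
    next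
      case False
      then obtain NA a where "tree_factorization D A (Ts A) NA a"
        using N(2)[OF A] Ts(1)[OF A] Ts(3)[OF A] unfolding tree_factorable_def by blast
      then obtain NA a where a: "tree_factorization D A (Ts A) NA a" "bond_inds NA \<inter> ?Z = {}"
        using rename_factorization[OF D _ finZ] by blast
      then have NA: "NA = a ` verts (Ts A)" and net: "tensor_network D NA"
        by (auto simp: tree_factorization_def bij_betw_def)
      have "bond_inds NA \<subseteq> (\<Union>X\<in>NA. inds X)"
      proof
        fix i assume "i \<in> bond_inds NA"
        then have "carriers NA i \<noteq> {}" by (auto simp: bond_inds_def)
        then show "i \<in> (\<Union>X\<in>NA. inds X)" by (auto simp: carriers_def)
      qed
      moreover have "finite (\<Union>X\<in>NA. inds X)" using net by (auto simp: tensor_network_def tensor_over_def)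
      ultimately have "finite (bond_inds NA)" by (rule finite_subset)
      then show ?thesis using a False unfolding NA by auto
    qed
    then obtain a where a: "if inds A = {} then (\<exists>v. verts (Ts A) = {v} \<and> a v = A)
         else tree_factorization D A (Ts A) (a ` verts (Ts A)) a"
      "finite (bond_inds (a ` verts (Ts A)))" "bond_inds (a ` verts (Ts A)) \<inter> ?Z = {}" by blast
    have ne: "B \<noteq> A" if "B \<in> S" for B using that insert(2) by blast
    show ?case
    proof (intro exI[of _ "g(A := a)"] conjI ballI impI)
      fix B assume B: "B \<in> insert A S"
      show "if inds B = {} then (\<exists>v. verts (Ts B) = {v} \<and> (g(A := a)) B v = B)
         else tree_factorization D B (Ts B) ((g(A := a)) B ` verts (Ts B)) ((g(A := a)) B)"
        using B a(1) g(1)[of B] ne by (cases "B = A") auto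
      show "finite (?b (g(A := a)) B)" using B a(2) g(2) ne by (cases "B = A") auto
      show "?b (g(A := a)) B \<inter> ?I = {}" using B a(3) g(3) ne by (cases "B = A") auto
      fix C assume C: "C \<in> insert A S" "B \<noteq> C"
      show "?b (g(A := a)) B \<inter> ?b (g(A := a)) C = {}"
        using B C a(3) g(4) ne by (cases "B = A"; cases "C = A") auto
    qed
  qed
  from this[OF order_refl] obtain g where "(\<forall>A\<in>N. (if inds A = {} then (\<exists>v. verts (Ts A) = {v} \<and> g A v = A)
         else tree_factorization D A (Ts A) (g A ` verts (Ts A)) (g A)) \<and> finite (?b g A) \<and> ?b g A \<inter> ?I = {}) \<and>
      (\<forall>A\<in>N. \<forall>B\<in>N. A \<noteq> B \<longrightarrow> ?b g A \<inter> ?b g B = {})"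
    by (elim exE)
  then have g: "\<And>A. A \<in> N \<Longrightarrow> if inds A = {} then (\<exists>v. verts (Ts A) = {v} \<and> g A v = A)
         else tree_factorization D A (Ts A) (g A ` verts (Ts A)) (g A)"
      "\<And>A. A \<in> N \<Longrightarrow> ?b g A \<inter> ?I = {}" "\<forall>A\<in>N. \<forall>B\<in>N. A \<noteq> B \<longrightarrow> ?b g A \<inter> ?b g B = {}"
    by blast+
  have "if inds A = {} then (\<exists>v. verts (Ts A) = {v} \<and> g A v = A)
         else leaves (Ts A) = Inl ` inds A \<and> tree_factorization D A (Ts A) (g A ` verts (Ts A)) (g A)"
    if "A \<in> N" for A
    using g(1)[OF that] Ts(3)[OF that] by (auto split: if_splits)
  moreover have "?b g A \<inter> inds B = {}" if "A \<in> N" "B \<in> N" for A B using g(2)[OF that(1)] that(2) by blast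
  ultimately have "factors_along D N Ts g"
    unfolding factors_along_def using Ts(1) g(3) by (intro conjI ballI; simp)
  then show ?thesis by blast
qed

section \<open>From names back to networks\<close>

text \<open>The lists are those that the input code presents in its own arbitrary order, and
  \<open>ps\<close> orients the edges of \<open>T\<close>. Only names arranged in these lists are
  visible to the program.\<close>

locale coded =
  fixes D :: "'i \<Rightarrow> 'd set" and N :: "('i, 'd) tensor set" and T :: "'i leaf_tree" and w :: nat
    and \<mu> :: "('i, 'd) tensor \<Rightarrow> data" and \<nu> :: "'i + nat \<Rightarrow> data"
    and As :: "('i, 'd) tensor list" and index_list :: "('i, 'd) tensor \<Rightarrow> 'i list"
    and vs :: "('i + nat) list" and es :: "nat list" and ps :: "(('i + nat) \<times> ('i + nat)) list"
  assumes network: "tensor_network D N" and free3: "card (free_inds N) \<le> 3"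
    and bd: "branch_decomposition (structure_graph N) T" and bw: "branch_width (structure_graph N) T = w"
    and w1: "1 \<le> w" and inj_\<mu>: "inj_on \<mu> N" and inj_\<nu>: "inj_on \<nu> (verts T)"
    and As: "distinct As" "set As = N" and index_list: "\<And>A. A \<in> N \<Longrightarrow> set (index_list A) = inds A"
    and vs: "distinct vs" "set vs = verts T" and es: "distinct es" "set es = edges T"
    and ps: "map (ends T) es = map (\<lambda>(u, v). {u, v}) ps"
begin

definition Ns :: "(data \<times> data list) list" where
  "Ns = map (\<lambda>A. (\<mu> A, map (\<lambda>i. \<nu> (Inl i)) (index_list A))) As"

definition dvs :: "data list" where "dvs = map \<nu> vs"

definition des :: "data arc list" where "des = map (\<lambda>p. (\<nu> (fst p), \<nu> (snd p))) ps"

definition arc :: "nat \<Rightarrow> data arc" where "arc e = the (map_of (zip es des) e)"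

lemma tree_T: "tree T" and degree_T: "v \<in> verts T \<Longrightarrow> degree T v = 1 \<or> degree T v = 3"
  and leaves_T: "leaves T = Inl ` edges (structure_graph N)"
  using bd by (auto simp: branch_decomposition_def unrooted_binary_tree_def)

lemma ends_T: "e \<in> edges T \<Longrightarrow> ends T e \<subseteq> verts T \<and> card (ends T e) = 2"
  using tree_T by (auto simp: tree_def wf_graph_def)

lemma finite_N: "finite N" using network by (simp add: tensor_network_def)

lemma edges_structure: "edges (structure_graph N) = (\<Union>A\<in>N. inds A)"
proof
  show "edges (structure_graph N) \<subseteq> (\<Union>A\<in>N. inds A)"
  proof
    fix i assume "i \<in> edges (structure_graph N)"
    then have "carriers N i \<noteq> {}" by (auto simp: structure_graph_def bond_inds_def free_inds_def)
    then show "i \<in> (\<Union>A\<in>N. inds A)" by (auto simp: carriers_def)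
  qed
  show "(\<Union>A\<in>N. inds A) \<subseteq> edges (structure_graph N)"
    using network_index[OF network] by (auto simp: structure_graph_def)
qed

lemma leaf_vertex: "A \<in> N \<Longrightarrow> i \<in> inds A \<Longrightarrow> Inl i \<in> leaves T \<and> Inl i \<in> verts T"
proof -
  assume "A \<in> N" "i \<in> inds A"
  then have "Inl i \<in> leaves T" unfolding leaves_T edges_structure by blast
  then show ?thesis by (simp add: leaves_def)
qed

lemma \<nu>_eq: "u \<in> verts T \<Longrightarrow> v \<in> verts T \<Longrightarrow> \<nu> u = \<nu> v \<longleftrightarrow> u = v"
  using inj_\<nu> by (auto dest: inj_onD)

lemma length_ps: "length es = length ps" using arg_cong[OF ps, of length] by simp

lemma map_arc: "map arc es = des"
proof (rule nth_equalityI)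
  show "length (map arc es) = length des" using length_ps by (simp add: des_def)
  show "map arc es ! k = des ! k" if "k < length (map arc es)" for k
    using that es(1) length_ps by (simp add: arc_def map_of_zip_nth des_def)
qed

lemma set_des: "set des = arc ` edges T"
  using arg_cong[OF map_arc, of set] es(2) by simp

lemma arc_ends:
  assumes "e \<in> edges T"
  obtains u v where "ends T e = {u, v}" "arc e = (\<nu> u, \<nu> v)" "u \<in> verts T" "v \<in> verts T" "u \<noteq> v"
proof -
  obtain k where k: "k < length es" "es ! k = e" 
    using assms unfolding es(2)[symmetric] in_set_conv_nth by blast
  obtain u v where uv: "ps ! k = (u, v)" by (cases "ps ! k")
  have "arc e = des ! k" using map_arc k by (metis nth_map)
  then have a: "arc e = (\<nu> u, \<nu> v)" using k length_ps uv by (simp add: des_def)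
  have "map (ends T) es ! k = map (\<lambda>(u, v). {u, v}) ps ! k" using ps by simp
  then have e: "ends T e = {u, v}" using k length_ps uv by simp
  then show ?thesis using that[OF e a] ends_T[OF assms] by (auto simp: card_insert_if split: if_splits)
qed

lemma joins_arc:
  assumes "e \<in> edges T" "u \<in> verts T" "v \<in> verts T"
  shows "joins (arc e) (\<nu> u) (\<nu> v) \<longleftrightarrow> ends T e = {u, v}"
proof -
  obtain x y where *: "ends T e = {x, y}" "arc e = (\<nu> x, \<nu> y)" "x \<in> verts T" "y \<in> verts T" "x \<noteq> y"
    by (rule arc_ends[OF assms(1)])
  show ?thesis using assms(2,3) * \<nu>_eq by (auto simp: joins_def doubleton_eq_iff)
qed

lemma touches_arc:
  assumes "e \<in> edges T" "u \<in> verts T"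
  shows "touches (arc e) (\<nu> u) \<longleftrightarrow> u \<in> ends T e"
proof -
  obtain x y where *: "ends T e = {x, y}" "arc e = (\<nu> x, \<nu> y)" "x \<in> verts T" "y \<in> verts T" "x \<noteq> y"
    by (rule arc_ends[OF assms(1)])
  show ?thesis using assms(2) * \<nu>_eq by (auto simp: touches_def)
qed

lemma inj_arc: "inj_on arc (edges T)"
proof (rule inj_onI)
  fix e f assume ef: "e \<in> edges T" "f \<in> edges T" "arc e = arc f"
  obtain x y where *: "ends T e = {x, y}" "arc e = (\<nu> x, \<nu> y)" "x \<in> verts T" "y \<in> verts T"
    by (rule arc_ends[OF ef(1)])
  obtain x' y' where **: "ends T f = {x', y'}" "arc f = (\<nu> x', \<nu> y')" "x' \<in> verts T" "y' \<in> verts T"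
    by (rule arc_ends[OF ef(2)])
  have "ends T e = ends T f" using * ** ef(3) \<nu>_eq by auto
  moreover have "inj_on (ends T) (edges T)" using tree_T by (simp add: tree_def)
  ultimately show "e = f" using ef by (auto dest: inj_onD)
qed

lemma reach_to:
  assumes F: "F \<subseteq> edges T" and u: "u \<in> verts T" and r: "(u, v) \<in> reach_by T F"
  shows "v \<in> verts T \<and> (\<nu> u, \<nu> v) \<in> (adj (arc ` F))\<^sup>*"
  using r unfolding reach_by_def
proof (induction rule: rtrancl_induct)
  case (step y z)
  then obtain e where e: "e \<in> F" "ends T e = {y, z}" by blast
  have y: "y \<in> verts T" using step.IH by blast
  have eT: "e \<in> edges T" using F e(1) by blast
  then have z: "z \<in> verts T" using ends_T[OF eT] e(2) by simp
  note eT
  then have "joins (arc e) (\<nu> y) (\<nu> z)" using joins_arc y z e(2) by blast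
  from adj_edge[OF imageI[OF e(1), of arc] this] have "(\<nu> y, \<nu> z) \<in> (adj (arc ` F))\<^sup>*" .
  then show ?case using z step.IH by (auto intro: rtrancl_trans)
qed (use u in simp)

lemma reach_from:
  assumes F: "F \<subseteq> edges T" and u: "u \<in> verts T" and r: "(\<nu> u, y) \<in> (adj (arc ` F))\<^sup>*"
  shows "\<exists>v\<in>verts T. y = \<nu> v \<and> (u, v) \<in> reach_by T F"
  using r
proof (induction rule: rtrancl_induct)
  case base
  then show ?case using u by (auto simp: reach_by_def)
next
  case (step y z)
  then obtain v where v: "v \<in> verts T" "y = \<nu> v" "(u, v) \<in> reach_by T F" by blast
  obtain e where e: "e \<in> F" "joins (arc e) y z" using step.hyps(2) by (auto simp: adj_def)
  then have eT: "e \<in> edges T" using F by blast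
  obtain x x' where *: "ends T e = {x, x'}" "arc e = (\<nu> x, \<nu> x')" "x \<in> verts T" "x' \<in> verts T"
    by (rule arc_ends[OF eT])
  then obtain t where t: "t \<in> verts T" "z = \<nu> t" using e(2) by (auto simp: joins_def)
  then have "ends T e = {v, t}" using joins_arc[OF eT v(1) t(1)] e(2) v(2) by simp
  then have "(v, t) \<in> reach_by T F" unfolding reach_by_def using e(1) by (intro r_into_rtrancl) auto
  then show ?case using t reach_by_trans[OF v(3)] by blast
qed

sublocale nt: network_tree Ns dvs des w
proof
  show "distinct (map fst Ns)" using As inj_\<mu> by (simp add: Ns_def comp_def distinct_map)
  show "distinct dvs" using vs inj_\<nu> by (simp add: dvs_def distinct_map)
  show "distinct des" unfolding map_arc[symmetric] using es inj_arc by (simp add: distinct_map)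
  show "des \<noteq> []"
  proof
    assume "des = []"
    then have "edges T = {}" using set_des by simp
    moreover obtain v where "v \<in> verts T" using tree_T by (auto simp: tree_def)
    ultimately show False using degree_T[of v] by (auto simp: incident_def)
  qed
  show "fst e \<in> set dvs \<and> snd e \<in> set dvs \<and> fst e \<noteq> snd e" if "e \<in> set des" for e
  proof -
    obtain f where f: "f \<in> edges T" "e = arc f" using \<open>e \<in> _\<close> set_des by blast
    obtain x y where "arc f = (\<nu> x, \<nu> y)" "x \<in> verts T" "y \<in> verts T" "x \<noteq> y"
      by (rule arc_ends[OF f(1)])
    then show ?thesis using f(2) vs(2) \<nu>_eq by (simp add: dvs_def)
  qed
  show "(a, b) \<in> (adj (set des))\<^sup>*" if "a \<in> set dvs" "b \<in> set dvs" for a b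
  proof -
    from that obtain u v where uv: "u \<in> verts T" "v \<in> verts T" "a = \<nu> u" "b = \<nu> v"
      using vs(2) by (auto simp: dvs_def)
    then have "(u, v) \<in> reach_by T (edges T)" using tree_T by (simp add: tree_def reachable_eq)
    from reach_to[OF order_refl uv(1) this] show ?thesis using uv set_des by simp
  qed
  show "length des < length dvs"
    using tree_card_edges[OF tree_T] length_ps distinct_card[OF vs(1)] distinct_card[OF es(1)] vs(2) es(2)
    by (simp add: des_def dvs_def)
  show "1 \<le> w" by (rule w1)
qed

lemma set_dvs: "set dvs = \<nu> ` verts T" using vs(2) by (simp add: dvs_def)

lemma ids_eq: "nt.ids = \<mu> ` N"
  using As(2) unfolding nt.ids_def by (simp add: Ns_def image_image)

lemma ix_eq: "A \<in> N \<Longrightarrow> nt.ix (\<mu> A) = (\<lambda>i. \<nu> (Inl i)) ` inds A"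
proof -
  assume A: "A \<in> N"
  then have "(\<mu> A, map (\<lambda>i. \<nu> (Inl i)) (index_list A)) \<in> set Ns" using As(2) by (simp add: Ns_def)
  from nt.ix_eq[OF this] show ?thesis using index_list[OF A] by simp
qed

lemma ix_mem: "A \<in> N \<Longrightarrow> Inl i \<in> verts T \<Longrightarrow> \<nu> (Inl i) \<in> nt.ix (\<mu> A) \<longleftrightarrow> i \<in> inds A"
  using ix_eq leaf_vertex \<nu>_eq by auto

lemma leaf_names_eq: "nt.leaf_names = \<nu> ` leaves T"
  using ix_eq unfolding nt.leaf_names_def ids_eq leaves_T edges_structure by auto

lemma holders_eq:
  assumes "Inl i \<in> verts T"
  shows "nt.holders (\<nu> (Inl i)) = \<mu> ` carriers N i"
  using ix_mem[OF _ assms] unfolding nt.holders_def ids_eq carriers_def by auto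

lemma card_holders:
  assumes "Inl i \<in> verts T"
  shows "card (nt.holders (\<nu> (Inl i))) = card (carriers N i)"
  unfolding holders_eq[OF assms] by (rule card_image) (rule inj_on_subset[OF inj_\<mu> carriers_sub])

lemma free_names_eq: "nt.free_names = (\<lambda>i. \<nu> (Inl i)) ` free_inds N"
proof
  show "nt.free_names \<subseteq> (\<lambda>i. \<nu> (Inl i)) ` free_inds N"
  proof
    fix x assume x: "x \<in> nt.free_names"
    then have "x \<in> \<nu> ` leaves T" using nt.free_leaf leaf_names_eq by blast
    then obtain i where i: "x = \<nu> (Inl i)" "Inl i \<in> verts T" unfolding leaves_T
      using leaves_T by (auto simp: leaves_def)
    then have "card (carriers N i) = 1" using x card_holders by (simp add: nt.free_names_def)
    then show "x \<in> (\<lambda>i. \<nu> (Inl i)) ` free_inds N" using i(1) by (auto simp: free_inds_def)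
  qed
  show "(\<lambda>i. \<nu> (Inl i)) ` free_inds N \<subseteq> nt.free_names"
  proof
    fix x assume "x \<in> (\<lambda>i. \<nu> (Inl i)) ` free_inds N"
    then obtain i where i: "x = \<nu> (Inl i)" "card (carriers N i) = 1" by (auto simp: free_inds_def)
    then have "carriers N i \<noteq> {}" by auto
    then have "Inl i \<in> verts T" using leaf_vertex by (auto simp: carriers_def)
    then show "x \<in> nt.free_names" using i card_holders by (simp add: nt.free_names_def)
  qed
qed

lemma inj_names: "inj_on (\<lambda>i. \<nu> (Inl i)) (\<Union>A\<in>N. inds A)"
  using leaf_vertex \<nu>_eq by (fastforce simp: inj_on_def)

lemma free_inds_sub: "free_inds N \<subseteq> (\<Union>A\<in>N. inds A)"
  using edges_structure by (auto simp: structure_graph_def)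

lemma card_free_names: "card nt.free_names = card (free_inds N)"
  unfolding free_names_eq by (rule card_image) (rule inj_on_subset[OF inj_names free_inds_sub])

lemma card_ix: "A \<in> N \<Longrightarrow> card (nt.ix (\<mu> A)) = card (inds A)"
  unfolding ix_eq by (rule card_image) (rule inj_on_subset[OF inj_names], blast)

lemma card_touching:
  assumes u: "u \<in> verts T" and F: "F \<subseteq> edges T"
  shows "card {e \<in> arc ` F. touches e (\<nu> u)} = card {e \<in> F. u \<in> ends T e}"
proof -
  have "{e \<in> arc ` F. touches e (\<nu> u)} = arc ` {e \<in> F. u \<in> ends T e}"
    using touches_arc[OF _ u] F by blast
  moreover have "inj_on arc {e \<in> F. u \<in> ends T e}" by (rule inj_on_subset[OF inj_arc]) (use F in auto)
  ultimately show ?thesis by (simp add: card_image)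
qed

text \<open>From the end \<open>b\<close> of \<open>a\<close> everything in \<open>C\<close> is
  reached without \<open>a\<close>, and no other arc leaves \<open>C\<close>. So the leaves in
  \<open>C\<close> are those on one side of the deleted edge.\<close>

lemma side_cut:
  assumes "nt.side a C"
  obtains e u where "e \<in> edges T" "a = arc e" "u \<in> ends T e"
    "cut_side T e u = {i. Inl i \<in> leaves T \<and> \<nu> (Inl i) \<in> C}"
proof -
  obtain b p where P: "nt.pend b a p C" using assms by (auto simp: nt.side_def)
  have "a \<in> set des" using P by (simp add: nt.pend_def)
  then obtain e where e: "e \<in> edges T" "a = arc e" using set_des by blast
  obtain x y where xy: "ends T e = {x, y}" "arc e = (\<nu> x, \<nu> y)" "x \<in> verts T" "y \<in> verts T"
    by (rule arc_ends[OF e(1)])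
  have "joins a b p" using P by (simp add: nt.pend_def)
  then obtain u where u: "u \<in> ends T e" "b = \<nu> u" "u \<in> verts T" using e(2) xy by (auto simp: joins_def)
  let ?F = "edges T - {e}"
  have reach: "reachable (delete_edge T e) = reach_by T ?F"
    by (simp add: reachable_def reach_by_def delete_edge_def)
  have uC: "\<nu> u \<in> C" using P u(2) by (simp add: nt.pend_def)
  have "(u, Inl i) \<in> reach_by T ?F \<longleftrightarrow> \<nu> (Inl i) \<in> C" if i: "Inl i \<in> leaves T" for i
  proof
    assume "(u, Inl i) \<in> reach_by T ?F"
    then have r: "(\<nu> u, \<nu> (Inl i)) \<in> (adj (arc ` ?F))\<^sup>*" using reach_to[OF _ u(3)] by blast
    have "fst f \<in> C \<longleftrightarrow> snd f \<in> C" if "f \<in> arc ` ?F" for f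
    proof -
      have "f \<in> set des" "f \<noteq> a" using that set_des inj_arc e by (auto dest: inj_onD)
      then show ?thesis using P unfolding nt.pend_def by blast
    qed
    from adj_invariant[OF r this] show "\<nu> (Inl i) \<in> C" using uC by blast
  next
    assume iC: "\<nu> (Inl i) \<in> C"
    let ?G = "{f \<in> edges T. fst (arc f) \<in> C \<and> snd (arc f) \<in> C}"
    have G: "{f \<in> set des. fst f \<in> C \<and> snd f \<in> C} = arc ` ?G" unfolding set_des by blast
    have "(\<nu> u, \<nu> (Inl i)) \<in> (adj (arc ` ?G))\<^sup>*"
      using P iC u(2) unfolding nt.pend_def G by blast
    then obtain v where v: "v \<in> verts T" "\<nu> (Inl i) = \<nu> v" "(u, v) \<in> reach_by T ?G"
      using reach_from[of ?G u] u(3) by blast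
    have "v = Inl i" using v(1,2) i \<nu>_eq by (auto simp: leaves_def)
    have "b \<in> C" "p \<notin> C" using P by (auto simp: nt.pend_def)
    then have "\<not> (fst a \<in> C \<and> snd a \<in> C)" using joins_both[OF \<open>joins a b p\<close>, of C] by blast
    then have "?G \<subseteq> ?F" using e(2) by blast
    from reach_by_mono[OF this] show "(u, Inl i) \<in> reach_by T ?F" using v(3) \<open>v = Inl i\<close> by blast
  qed
  then have "cut_side T e u = {i. Inl i \<in> leaves T \<and> \<nu> (Inl i) \<in> C}"
    unfolding cut_side_def reach by blast
  then show ?thesis using that e u(1) by blast
qed

text \<open>\<open>Some A\<close> is an endpoint on both sides of the cut exactly if
  \<open>A\<close> crosses it, and \<open>None\<close> exactly if the free indices do. The injective
  naming preserves the count.\<close>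

lemma width_bound:
  assumes "nt.side a C"
  shows "card (nt.crossing C) + (if nt.free_crossing C then 1 else 0) \<le> w"
proof -
  obtain e u where e: "e \<in> edges T" "u \<in> ends T e"
    and cut: "cut_side T e u = {i. Inl i \<in> leaves T \<and> \<nu> (Inl i) \<in> C}"
    by (rule side_cut[OF assms])
  let ?G = "structure_graph N" and ?C = "cut_side T e u"
  let ?K = "endpoints ?G ?C \<inter> endpoints ?G (edges ?G - ?C)"
  let ?f = "\<lambda>(e, u). card (endpoints ?G (cut_side T e u) \<inter> endpoints ?G (edges ?G - cut_side T e u))"
  have set: "{card (endpoints ?G C \<inter> endpoints ?G (edges ?G - C)) | C a u. a \<in> edges T \<and> u \<in> ends T a \<and> C = cut_side T a u}
      = ?f ` (SIGMA e:edges T. ends T e)" by (auto simp: image_iff)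
  have fin: "finite (edges T)" "\<And>e. e \<in> edges T \<Longrightarrow> finite (ends T e)"
    using tree_T ends_T by (auto simp: tree_def wf_graph_def intro: card_ge_0_finite)
  have "card ?K \<le> branch_width ?G T"
    unfolding branch_width_def set
  proof (rule Max_ge)
    show "finite (?f ` (SIGMA e:edges T. ends T e))" using fin by simp
    show "card ?K \<in> ?f ` (SIGMA e:edges T. ends T e)" using e by force
  qed
  then have K: "card ?K \<le> w" using bw by simp
  have mem: "i \<in> ?C \<longleftrightarrow> \<nu> (Inl i) \<in> C" if "A \<in> N" "i \<in> inds A" for A i
    using cut leaf_vertex[OF that] by blast
  have Csub: "?C \<subseteq> edges ?G" unfolding cut using leaves_T by blast
  have some: "Some A \<in> endpoints ?G E \<longleftrightarrow> A \<in> N \<and> inds A \<inter> E \<noteq> {}" if "E \<subseteq> edges ?G" for A E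
    using that by (auto simp: endpoints_def structure_graph_def carriers_def split: if_splits)
  have none: "None \<in> endpoints ?G E \<longleftrightarrow> free_inds N \<inter> E \<noteq> {}" if "E \<subseteq> edges ?G" for E
    using that by (auto simp: endpoints_def structure_graph_def split: if_splits)
  have sub: "edges ?G - ?C \<subseteq> edges ?G" by blast
  have ind_edge: "i \<in> edges ?G" if "A \<in> N" "i \<in> inds A" for A i using that edges_structure by blast
  let ?X = "{A \<in> N. Some A \<in> ?K}"
  have "nt.cr (\<mu> A) C \<longleftrightarrow> Some A \<in> ?K" if A: "A \<in> N" for A
  proof -
    have "nt.cr (\<mu> A) C \<longleftrightarrow> (\<exists>i\<in>inds A. \<nu> (Inl i) \<in> C) \<and> (\<exists>i\<in>inds A. \<nu> (Inl i) \<notin> C)"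
      unfolding nt.cr_def ix_eq[OF A] by blast
    also have "\<dots> \<longleftrightarrow> Some A \<in> ?K"
      using mem[OF A] ind_edge[OF A] A unfolding Int_iff some[OF Csub] some[OF sub] by blast
    finally show ?thesis .
  qed
  then have "nt.crossing C = \<mu> ` ?X" unfolding nt.crossing_def ids_eq by blast
  moreover have "inj_on \<mu> ?X" by (rule inj_on_subset[OF inj_\<mu>]) blast
  ultimately have cr: "card (nt.crossing C) = card ?X" by (simp only: card_image)
  have z: "nt.free_crossing C \<longleftrightarrow> None \<in> ?K"
  proof -
    have f: "i \<in> edges ?G \<and> (i \<in> ?C \<longleftrightarrow> \<nu> (Inl i) \<in> C)" if "i \<in> free_inds N" for i
      using mem ind_edge that free_inds_sub by blast
    have "nt.free_crossing C \<longleftrightarrow> (\<exists>i\<in>free_inds N. \<nu> (Inl i) \<in> C) \<and> (\<exists>i\<in>free_inds N. \<nu> (Inl i) \<notin> C)"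
      unfolding nt.free_crossing_def free_names_eq by blast
    also have "\<dots> \<longleftrightarrow> None \<in> ?K" unfolding Int_iff none[OF Csub] none[OF sub] using f by blast
    finally show ?thesis .
  qed
  have finK: "finite ?K"
  proof -
    have "?K \<subseteq> insert None (Some ` N)"
      by (auto simp: endpoints_def structure_graph_def carriers_def split: if_splits)
    then show ?thesis using finite_N finite_subset by blast
  qed
  have fX: "finite ?X" using finite_N by simp
  have "Some ` ?X \<union> (if nt.free_crossing C then {None} else {}) \<subseteq> ?K" using z by auto
  then have "card (Some ` ?X \<union> (if nt.free_crossing C then {None} else {})) \<le> card ?K"
    by (rule card_mono[OF finK])
  moreover have "card (Some ` ?X \<union> (if nt.free_crossing C then {None} else {})) =
      card (Some ` ?X) + (if nt.free_crossing C then 1 else 0)"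
    using fX by (subst card_Un_disjoint) auto
  moreover have "card (Some ` ?X) = card ?X" by (rule card_image) simp
  ultimately show ?thesis using cr K by simp
qed

sublocale nt: network_tree_width Ns dvs des w
proof
  show "nt.leaf_names \<subseteq> set dvs" unfolding leaf_names_eq set_dvs by (auto simp: leaves_def)
  have inc: "{e \<in> edges T. u \<in> ends T e} = incident T u" for u by (simp add: incident_def)
  show "card {e \<in> set des. touches e x} = 1" if "x \<in> nt.leaf_names" for x
  proof -
    from that obtain u where u: "u \<in> leaves T" "x = \<nu> u" unfolding leaf_names_eq by blast
    then have "u \<in> verts T" "degree T u \<le> 1" by (auto simp: leaves_def)
    then show ?thesis using degree_T[of u] card_touching[of u "edges T"] u(2) unfolding set_des inc by auto
  qed
  show "card {e \<in> set des. touches e x} = 3" if "x \<in> set dvs" "x \<notin> nt.leaf_names" for x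
  proof -
    from that(1) obtain u where u: "u \<in> verts T" "x = \<nu> u" unfolding set_dvs by blast
    then have "u \<notin> leaves T" using that(2) unfolding leaf_names_eq by blast
    then have "degree T u = 3" using u(1) degree_T[of u] by (auto simp: leaves_def)
    then show ?thesis using card_touching[of u "edges T"] u unfolding set_des inc by simp
  qed
  show "card (nt.holders x) \<le> 2" for x
  proof (cases "nt.holders x = {}")
    case False
    then have "x \<in> nt.leaf_names" by (auto simp: nt.holders_def nt.leaf_names_def)
    then obtain i where "x = \<nu> (Inl i)" "Inl i \<in> verts T"
      unfolding leaf_names_eq using leaves_T by (auto simp: leaves_def)
    then show ?thesis using card_holders network by (simp add: tensor_network_def)
  qed simp
  show "card nt.free_names \<le> 3" using card_free_names free3 by simp
qed (rule width_bound)

end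

section \<open>Reading the output of the program as a plan for tensors\<close>

lemma leaf_list_map [simp]: "leaf_list (map_btree f t) = map f (leaf_list t)"
  by (induction t) auto

lemma subtrees_map: "subtrees (map_btree f t) = map_btree f ` subtrees t"
  by (induction t) auto

lemma btree_code_map: "btree_code \<kappa> (map_btree f t) = btree_code (\<lambda>a. \<kappa> (f a)) t"
  by (induction t) auto

lemma btree_code_cong: "(\<And>a. a \<in> set (leaf_list t) \<Longrightarrow> \<kappa> a = \<kappa>' a) \<Longrightarrow> btree_code \<kappa> t = btree_code \<kappa>' t"
  by (induction t) auto

lemma finite_subtrees: "finite (subtrees t)"
  by (induction t) auto

lemma ceiling_four_thirds: "\<lceil>4 * real w / 3\<rceil> = int ((4 * w + 2) div 3)"
proof (rule ceiling_unique)
  have "3 * ((4 * w + 2) div 3) \<le> 4 * w + 2" "4 * w \<le> 3 * ((4 * w + 2) div 3)" by presburger+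
  then have "real (3 * ((4 * w + 2) div 3)) \<le> real (4 * w + 2)" "real (4 * w) \<le> real (3 * ((4 * w + 2) div 3))"
    by (simp_all only: of_nat_le_iff)
  then show "of_int (int ((4 * w + 2) div 3)) - 1 < 4 * real w / 3" "4 * real w / 3 \<le> of_int (int ((4 * w + 2) div 3))"
    by simp_all
qed

context coded
begin

definition Ts :: "('i, 'd) tensor \<Rightarrow> 'i leaf_tree" where
  "Ts A = \<lparr>verts = {v \<in> verts T. \<nu> v \<in> nt.nodes (\<mu> A)}, edges = {e \<in> edges T. arc e \<in> nt.arcs_of (\<mu> A)},
    ends = ends T\<rparr>"

lemma Ts_simps [simp]:
  "verts (Ts A) = {v \<in> verts T. \<nu> v \<in> nt.nodes (\<mu> A)}"
  "edges (Ts A) = {e \<in> edges T. arc e \<in> nt.arcs_of (\<mu> A)}" "ends (Ts A) = ends T"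
  by (simp_all add: Ts_def)

lemma arcs_Ts: "arc ` {e \<in> edges T. arc e \<in> nt.arcs_of a} = nt.arcs_of a"
  using set_des by (auto simp: nt.arcs_of_def)

lemma nodes_sub: "nt.nodes a \<subseteq> \<nu> ` verts T"
proof -
  have "set (take 1 dvs) \<subseteq> set dvs" by (rule set_take_subset)
  then show ?thesis using nt.span_sub[of a] unfolding nt.nodes_def set_dvs by simp
qed

lemma nodes_empty:
  assumes "A \<in> N" "inds A = {}"
  shows "\<exists>v. verts (Ts A) = {v}"
proof -
  have "nt.ix (\<mu> A) = {}" using ix_eq assms by simp
  obtain x xs where dx: "dvs = x # xs" using nt.vs_nonempty by (cases dvs) auto
  then have n: "nt.nodes (\<mu> A) = {x}" unfolding nt.nodes_def \<open>nt.ix (\<mu> A) = {}\<close> by simp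
  then obtain v where "v \<in> verts T" "\<nu> v = x" using nodes_sub[of "\<mu> A"] by auto
  then have "verts (Ts A) = {v}" using n \<nu>_eq by auto
  then show ?thesis by blast
qed

context
  assumes conn: "\<And>a x y. x \<in> nt.span a \<Longrightarrow> y \<in> nt.span a \<Longrightarrow> (x, y) \<in> (adj (nt.arcs_of a))\<^sup>*"
    and deg: "\<And>a x. x \<in> nt.span a \<Longrightarrow> x \<notin> nt.leaf_names \<Longrightarrow> 2 \<le> card {e \<in> nt.arcs_of a. touches e x}"
begin

text \<open>Acyclicity is inherited from \<open>T\<close>, and connectedness is \<open>conn\<close>
  translated back from names to vertices.\<close>

lemma Ts_tree:
  assumes A: "A \<in> N"
  shows "tree (Ts A)"
  unfolding tree_def
proof (intro conjI ballI)
  have ends: "ends T e \<subseteq> {v \<in> verts T. \<nu> v \<in> nt.nodes (\<mu> A)}" if e: "e \<in> edges T" "arc e \<in> nt.arcs_of (\<mu> A)" for e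
  proof
    fix u assume u: "u \<in> ends T e"
    then have uT: "u \<in> verts T" using ends_T[OF e(1)] by blast
    then have "\<nu> u \<in> nt.span (\<mu> A)" using touches_arc[OF e(1) uT] u e(2) by (auto simp: nt.span_def)
    moreover have "nt.ix (\<mu> A) \<noteq> {}" using nt.arcs_of_empty e(2) by blast
    ultimately show "u \<in> {v \<in> verts T. \<nu> v \<in> nt.nodes (\<mu> A)}" using uT by (simp add: nt.nodes_def)
  qed
  have fin: "finite (verts T)" "finite (edges T)" using tree_T by (auto simp: tree_def wf_graph_def)
  show "wf_graph (Ts A)" unfolding wf_graph_def using fin ends ends_T by simp
  show "verts (Ts A) \<noteq> {}"
  proof (cases "inds A = {}")
    case True
    then show ?thesis using nodes_empty[OF A] by auto
  next
    case False
    then obtain i where i: "i \<in> inds A" by blast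
    then have "\<nu> (Inl i) \<in> nt.ix (\<mu> A)" using ix_eq[OF A] by blast
    then have "\<nu> (Inl i) \<in> nt.nodes (\<mu> A)" by (auto simp: nt.nodes_def nt.span_def)
    then show ?thesis using leaf_vertex[OF A i] by auto
  qed
  have "inj_on (ends T) (edges T)" using tree_T by (simp add: tree_def)
  then show "inj_on (ends (Ts A)) (edges (Ts A))" 
    using inj_on_subset[of "ends T" "edges T" "edges (Ts A)"] by auto
  show "(u, v) \<in> reachable (Ts A)" if u: "u \<in> verts (Ts A)" and v: "v \<in> verts (Ts A)" for u v
  proof (cases "inds A = {}")
    case True
    then have "u = v" using nodes_empty[OF A] u v by (metis singletonD)
    then show ?thesis by (simp add: reachable_def)
  next
    case False
    then have "nt.ix (\<mu> A) \<noteq> {}" using ix_eq[OF A] by simp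
    then have "\<nu> u \<in> nt.span (\<mu> A)" "\<nu> v \<in> nt.span (\<mu> A)" using u v by (auto simp: nt.nodes_def)
    then have "(\<nu> u, \<nu> v) \<in> (adj (arc ` edges (Ts A)))\<^sup>*" using conn arcs_Ts by simp
    then obtain v' where "v' \<in> verts T" "\<nu> v = \<nu> v'" "(u, v') \<in> reach_by T (edges (Ts A))"
      using reach_from[of "edges (Ts A)" u "\<nu> v"] u by auto
    then have "(u, v) \<in> reach_by T (edges (Ts A))" using v \<nu>_eq by simp
    then show ?thesis by (simp add: reachable_def reach_by_def)
  qed
  show "\<nexists>vs es. is_cycle (Ts A) vs es"
  proof
    assume "\<exists>vs es. is_cycle (Ts A) vs es"
    then obtain p q where "is_cycle (Ts A) p q" by blast
    then have "is_cycle T p q" by (auto simp: is_cycle_def)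
    then show False using tree_T by (auto simp: tree_def)
  qed
qed

text \<open>\<open>deg\<close> excludes vertices of degree at most one that are not leaves of
  \<open>T\<close>, and \<open>span_leaf\<close> excludes leaves of \<open>T\<close> that are not
  indices of \<open>A\<close>.\<close>

lemma Ts_leaves:
  assumes A: "A \<in> N" and ne: "inds A \<noteq> {}"
  shows "leaves (Ts A) = Inl ` inds A"
proof -
  have "nt.ix (\<mu> A) \<noteq> {}" using ix_eq[OF A] ne by simp
  then have nodes: "nt.nodes (\<mu> A) = nt.span (\<mu> A)" by (simp add: nt.nodes_def)
  have d: "degree (Ts A) v = card {e \<in> nt.arcs_of (\<mu> A). touches e (\<nu> v)}" if "v \<in> verts T" for v
    using card_touching[OF that, of "edges (Ts A)"] arcs_Ts[of "\<mu> A"] by (auto simp: incident_def conj_assoc)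
  show ?thesis
  proof (intro set_eqI iffI)
    fix v assume v: "v \<in> leaves (Ts A)"
    then have vT: "v \<in> verts T" "\<nu> v \<in> nt.span (\<mu> A)" "degree (Ts A) v \<le> 1"
      using nodes by (auto simp: leaves_def)
    then have "\<nu> v \<in> nt.leaf_names" using deg[of "\<nu> v" "\<mu> A"] d[OF vT(1)] by fastforce
    then have "\<nu> v \<in> nt.ix (\<mu> A)" using nt.span_leaf vT(2) by blast
    then obtain i where "i \<in> inds A" "\<nu> v = \<nu> (Inl i)" using ix_eq[OF A] by blast
    then show "v \<in> Inl ` inds A" using \<nu>_eq[OF vT(1)] leaf_vertex[OF A] by blast
  next
    fix v :: "'i + nat" assume "v \<in> Inl ` inds A"
    then obtain i where i: "i \<in> inds A" "v = Inl i" by blast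
    have iT: "Inl i \<in> leaves T" "Inl i \<in> verts T" using leaf_vertex[OF A i(1)] by auto
    have "\<nu> v \<in> nt.span (\<mu> A)" using ix_eq[OF A] i by (auto simp: nt.span_def)
    moreover have "degree (Ts A) v \<le> degree T v"
      by (rule card_mono) (use tree_T in \<open>auto simp: incident_def tree_def wf_graph_def\<close>)
    ultimately show "v \<in> leaves (Ts A)" using iT i(2) nodes by (auto simp: leaves_def)
  qed
qed

end

text \<open>The naming maps open bonds injectively into \<open>rk_arcs S\<close> and open original
  indices injectively into \<open>rk_free S\<close>, which suffices for an upper bound.\<close>

lemma rank_transfer:
  fixes U :: "(('i, 'd) tensor \<times> ('i + nat)) set"
  assumes fac: "factors_along D N Ts g" and S: "S \<subseteq> {(a, x). a \<in> nt.ids \<and> x \<in> nt.nodes a}"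
    and U: "U = {(A, v). A \<in> N \<and> v \<in> verts T \<and> (\<mu> A, \<nu> v) \<in> S}"
  shows "card (free_inds ((\<lambda>(A, v). g A v) ` U)) \<le> nt.rk S"
proof -
  interpret f: factoring D N Ts g by unfold_locales (rule network fac)+
  have "U \<subseteq> f.pieces" using S unfolding U f.pieces_def by auto
  note le = f.rank_le[OF this]
  let ?X = "{(A, e). A \<in> N \<and> e \<in> edges (Ts A) \<and> card {v \<in> ends (Ts A) e. (A, v) \<in> U} = 1}"
  let ?Y = "{i. \<exists>!A. i \<in> inds A \<and> (A, Inl i) \<in> U}"
  have finS: "finite (nt.rk_arcs S)"
  proof -
    have "nt.rk_arcs S \<subseteq> (SIGMA a:nt.ids. nt.arcs_of a)" by (auto simp: nt.rk_arcs_def)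
    then show ?thesis by (rule finite_subset) simp
  qed
  have "card ?X \<le> card (nt.rk_arcs S)"
  proof (rule card_inj_on_le[OF _ _ finS])
    show "inj_on (\<lambda>(A, e). (\<mu> A, arc e)) ?X"
      using inj_arc inj_\<mu> by (auto simp: inj_on_def)
    show "(\<lambda>(A, e). (\<mu> A, arc e)) ` ?X \<subseteq> nt.rk_arcs S"
    proof
      fix q assume "q \<in> (\<lambda>(A, e). (\<mu> A, arc e)) ` ?X"
      then obtain A e where q: "q = (\<mu> A, arc e)" "A \<in> N" "e \<in> edges T" "arc e \<in> nt.arcs_of (\<mu> A)"
        "card {v \<in> ends T e. (A, v) \<in> U} = 1" by auto
      obtain u v where uv: "ends T e = {u, v}" "arc e = (\<nu> u, \<nu> v)" "u \<in> verts T" "v \<in> verts T" "u \<noteq> v"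
        by (rule arc_ends[OF q(3)])
      have set: "{x \<in> ends T e. (A, x) \<in> U} = (if (A, u) \<in> U then {u} else {}) \<union> (if (A, v) \<in> U then {v} else {})"
        unfolding uv(1) by auto
      have "((A, u) \<in> U) \<noteq> ((A, v) \<in> U)" using q(5) uv(5) unfolding set by (auto split: if_splits)
      moreover have "(A, u) \<in> U \<longleftrightarrow> (\<mu> A, \<nu> u) \<in> S" "(A, v) \<in> U \<longleftrightarrow> (\<mu> A, \<nu> v) \<in> S"
        using U q(2) uv by auto
      ultimately show "q \<in> nt.rk_arcs S" using q uv(2) ids_eq by (auto simp: nt.rk_arcs_def)
    qed
  qed
  moreover have "card ?Y \<le> card (nt.rk_free S)"
  proof (rule card_inj_on_le)
    have Y: "?Y \<subseteq> (\<Union>A\<in>N. inds A)" using U by auto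
    show "inj_on (\<lambda>i. \<nu> (Inl i)) ?Y" by (rule inj_on_subset[OF inj_names Y])
    have "nt.rk_free S \<subseteq> nt.leaf_names" using nt.ix_leaf by (auto simp: nt.rk_free_def)
    then show "finite (nt.rk_free S)" by (rule finite_subset) simp
    show "(\<lambda>i. \<nu> (Inl i)) ` ?Y \<subseteq> nt.rk_free S"
    proof
      fix x assume "x \<in> (\<lambda>i. \<nu> (Inl i)) ` ?Y"
      then obtain i A where x: "x = \<nu> (Inl i)" and A: "i \<in> inds A" "(A, Inl i) \<in> U"
        and uniq: "\<And>B. i \<in> inds B \<Longrightarrow> (B, Inl i) \<in> U \<Longrightarrow> B = A" by auto
      have AN: "A \<in> N" and iT: "Inl i \<in> verts T" and AS: "(\<mu> A, \<nu> (Inl i)) \<in> S" using A(2) U by auto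
      have "b = \<mu> A" if b: "x \<in> nt.ix b" "(b, x) \<in> S" for b
      proof -
        obtain B where B: "B \<in> N" "b = \<mu> B" using nt.ix_ids[OF b(1)] ids_eq by blast
        have "i \<in> inds B" using ix_mem[OF B(1) iT] b(1) B(2) x by simp
        moreover have "(B, Inl i) \<in> U" using U B iT b(2) x by simp
        ultimately show ?thesis using uniq B(2) by blast
      qed
      moreover have "x \<in> nt.ix (\<mu> A)" using ix_mem[OF AN iT] A(1) x by simp
      ultimately show "x \<in> nt.rk_free S" using AS x unfolding nt.rk_free_def by blast
    qed
  qed
  ultimately show ?thesis using le unfolding nt.rk_def f.piece_def by linarith
qed

lemma bound_le:
  "int nt.bound \<le> (if w = 1 \<and> (card (free_inds N) = 3 \<or> (\<exists>A\<in>N. card (inds A) \<ge> 3)) then 3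
     else \<lceil>4 * real w / 3\<rceil>)"
proof -
  have "(\<exists>a\<in>nt.ids. 3 \<le> card (nt.ix a)) \<longleftrightarrow> (\<exists>A\<in>N. card (inds A) \<ge> 3)"
    unfolding ids_eq using card_ix by auto
  then show ?thesis unfolding nt.bound_def card_free_names ceiling_four_thirds by simp
qed

theorem plan_works:
  assumes D: "\<And>i. finite (D i)" "\<And>i. infinite {j. card (D j) = card (D i)}"
    and fact: "\<And>A. A \<in> N \<Longrightarrow> tree_factorable D A"
  shows "\<exists>Ts R. plan_code \<mu> \<nu> N Ts R (enc (plan (Ns, dvs, des))) \<and> (\<exists>g. factors_along D N Ts g) \<and>
    (\<forall>g. factors_along D N Ts g \<longrightarrow>
      (let M = factored_network N Ts g; S = factored_tree R g in
        tensor_network D M \<and> contraction_tree M S \<and> max_rank S \<le> nt.bound \<and> partial_contraction D N M))"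
proof -
  obtain acc R where plan: "plan (Ns, dvs, des) = (map (\<lambda>p. (fst p, tensor_tree dvs acc (snd p))) Ns, R)"
    and tt: "\<And>a js. (a, js) \<in> set Ns \<Longrightarrow>
      distinct (fst (tensor_tree dvs acc js)) \<and> set (fst (tensor_tree dvs acc js)) = nt.nodes a \<and>
      distinct (snd (tensor_tree dvs acc js)) \<and> set (snd (tensor_tree dvs acc js)) = nt.arcs_of a"
    and R: "distinct (leaf_list R)" "set (leaf_list R) = {(a, x). a \<in> nt.ids \<and> x \<in> nt.nodes a}"
    and rk: "\<And>U. U \<in> subtrees R \<Longrightarrow> nt.rk (set (leaf_list U)) \<le> nt.bound"
    and conn: "\<And>a x y. x \<in> nt.span a \<Longrightarrow> y \<in> nt.span a \<Longrightarrow> (x, y) \<in> (adj (nt.arcs_of a))\<^sup>*"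
    and deg: "\<And>a x. x \<in> nt.span a \<Longrightarrow> x \<notin> nt.leaf_names \<Longrightarrow> 2 \<le> card {e \<in> nt.arcs_of a. touches e x}"
    by (rule nt.plan_correct) (rule that; assumption)
  \<comment> \<open>The program returns names only; \<open>dec\<close> recovers the tensors and
    vertices that the plan speaks about.\<close>
  define dec where "dec = (\<lambda>(a, x). (inv_into N \<mu> a, inv_into (verts T) \<nu> x))"
  have dec: "dec (\<mu> A, \<nu> v) = (A, v)" if "A \<in> N" "v \<in> verts T" for A v
    using that inj_\<mu> inj_\<nu> by (simp add: dec_def)
  let ?R = "map_btree dec R"
  have leafR: "\<exists>A v. q = (\<mu> A, \<nu> v) \<and> A \<in> N \<and> v \<in> verts T \<and> \<nu> v \<in> nt.nodes (\<mu> A)" if "q \<in> set (leaf_list R)" for q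
    using that R(2) ids_eq nodes_sub by fastforce
  have tree: "\<And>A. A \<in> N \<Longrightarrow> tree (Ts A)" by (rule Ts_tree[OF conn deg])
  have leaves: "\<And>A. A \<in> N \<Longrightarrow> inds A \<noteq> {} \<Longrightarrow> leaves (Ts A) = Inl ` inds A" by (rule Ts_leaves[OF conn deg])
  let ?js = "\<lambda>A. map (\<lambda>i. \<nu> (Inl i)) (index_list A)"
  have "plan_code \<mu> \<nu> N Ts ?R (enc (plan (Ns, dvs, des)))"
    unfolding plan_code_def
  proof (intro exI conjI ballI)
    show "distinct As" "set As = N" by (rule As)+
    \<comment> \<open>All trees \<open>Ts A\<close> are parts of \<open>T\<close> and keep its
      vertex names, so the one naming \<open>\<nu>\<close> serves for every tensor.\<close>
    show "inj_on ((\<lambda>_. \<nu>) A) (verts (Ts A))" for A by (rule inj_on_subset[OF inj_\<nu>]) auto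
    show "(\<lambda>_. \<nu>) A (Inl i) = \<nu> (Inl i)" for A i by simp
    show "graph_code ((\<lambda>_. \<nu>) A) (Ts A) ((\<lambda>A. enc (tensor_tree dvs acc (?js A))) A)" if A: "A \<in> N" for A
    proof -
      have "(\<mu> A, ?js A) \<in> set Ns" using A As(2) by (simp add: Ns_def)
      note t = tt[OF this]
      let ?V = "fst (tensor_tree dvs acc (?js A))" and ?E = "snd (tensor_tree dvs acc (?js A))"
      let ?iv = "inv_into (verts T) \<nu>" and ?ia = "inv_into (edges T) arc"
      have V: "set ?V \<subseteq> \<nu> ` verts T" using t nodes_sub by blast
      have E: "set ?E \<subseteq> arc ` edges T" using t set_des by (auto simp: nt.arcs_of_def)
      let ?p = "\<lambda>q. (?iv (fst q), ?iv (snd q))"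
      have p: "ends T (?ia q) = {?iv (fst q), ?iv (snd q)} \<and> \<nu> (?iv (fst q)) = fst q \<and> \<nu> (?iv (snd q)) = snd q"
        if "q \<in> set ?E" for q
      proof -
        from that obtain e where e: "e \<in> edges T" "q = arc e" using E by blast
        obtain u v where uv: "ends T e = {u, v}" "arc e = (\<nu> u, \<nu> v)" "u \<in> verts T" "v \<in> verts T"
          by (rule arc_ends[OF e(1)])
        then show ?thesis using e inv_into_f_f[OF inj_arc e(1)] inv_into_f_f[OF inj_\<nu>] by simp
      qed
      have iv: "\<nu> (?iv x) = x" if "x \<in> set ?V" for x using V that by (meson f_inv_into_f subsetD)
      show ?thesis
        unfolding graph_code_def
      proof (intro exI conjI)
        show "distinct (map ?iv ?V)" using t inj_on_inv_into[OF V] by (simp add: distinct_map)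
        show "set (map ?iv ?V) = verts (Ts A)"
        proof -
          have "?iv ` nt.nodes (\<mu> A) = {v \<in> verts T. \<nu> v \<in> nt.nodes (\<mu> A)}"
            using nodes_sub[of "\<mu> A"] inv_into_f_f[OF inj_\<nu>] by (force simp: image_iff)
          then show ?thesis using t by simp
        qed
        show "distinct (map ?ia ?E)" using t inj_on_inv_into[OF E] by (simp add: distinct_map)
        show "set (map ?ia ?E) = edges (Ts A)"
        proof -
          have "?ia ` nt.arcs_of (\<mu> A) = {e \<in> edges T. arc e \<in> nt.arcs_of (\<mu> A)}"
            using E t inv_into_f_f[OF inj_arc] by (force simp: image_iff)
          then show ?thesis using t by simp
        qed
        show "map (ends (Ts A)) (map ?ia ?E) = map (\<lambda>(u, v). {u, v}) (map ?p ?E)"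
          using p by simp
        show "enc (tensor_tree dvs acc (?js A)) =
            Cell (list_code (map \<nu> (map ?iv ?V))) (list_code (map (\<lambda>(u, v). Cell (\<nu> u) (\<nu> v)) (map ?p ?E)))"
        proof -
          have "map \<nu> (map ?iv ?V) = map enc ?V" using iv by (simp add: enc_data_def)
          moreover have "map (\<lambda>(u, v). Cell (\<nu> u) (\<nu> v)) (map ?p ?E) = map enc ?E"
            using p by (simp add: enc_data_def enc_prod_def)
          ultimately show ?thesis by (simp only: enc_prod_def enc_list_def)
        qed
      qed
    qed
    show "enc (plan (Ns, dvs, des)) =
        Cell (list_code (map (\<lambda>A. Cell (\<mu> A) ((\<lambda>A. enc (tensor_tree dvs acc (?js A))) A)) As))
          (btree_code (\<lambda>(A, v). Cell (\<mu> A) ((\<lambda>_. \<nu>) A v)) ?R)"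
    proof -
      have "btree_code (\<lambda>(A, v). Cell (\<mu> A) (\<nu> v)) ?R = btree_code enc R"
        unfolding btree_code_map
      proof (rule btree_code_cong)
        fix q assume "q \<in> set (leaf_list R)"
        then obtain A v where "q = (\<mu> A, \<nu> v)" "A \<in> N" "v \<in> verts T" using leafR by blast
        then show "(case dec q of (A, v) \<Rightarrow> Cell (\<mu> A) (\<nu> v)) = enc q" using dec by (simp add: enc_data_def)
      qed
      then show ?thesis unfolding plan
        by (simp add: enc_prod_def enc_list_def enc_btree_def Ns_def enc_data_def comp_def)
    qed
  qed
  moreover have "\<exists>g. factors_along D N Ts g"
    by (rule factors_exist[OF D network fact tree nodes_empty leaves])
  moreover have "let M = factored_network N Ts g; S = factored_tree ?R g in
        tensor_network D M \<and> contraction_tree M S \<and> max_rank S \<le> nt.bound \<and> partial_contraction D N M"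
    if fac: "factors_along D N Ts g" for g
  proof -
    interpret f: factoring D N Ts g by unfold_locales (rule network fac)+
    have S: "factored_tree ?R g = map_btree f.piece ?R" by (simp add: factored_tree_def f.piece_def)
    have set: "set (leaf_list ?R) = f.pieces"
    proof
      show "set (leaf_list ?R) \<subseteq> f.pieces" using leafR dec by (fastforce simp: f.pieces_def)
      show "f.pieces \<subseteq> set (leaf_list ?R)"
      proof
        fix q assume "q \<in> f.pieces"
        then obtain A v where q: "q = (A, v)" "A \<in> N" "v \<in> verts T" "\<nu> v \<in> nt.nodes (\<mu> A)"
          by (auto simp: f.pieces_def)
        then have "(\<mu> A, \<nu> v) \<in> set (leaf_list R)" unfolding R(2) using ids_eq by blast
        then show "q \<in> set (leaf_list ?R)" using dec[OF q(2,3)] q(1) by force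
      qed
    qed
    have "inj_on dec (set (leaf_list R))"
    proof (rule inj_onI)
      fix p q assume "p \<in> set (leaf_list R)" "q \<in> set (leaf_list R)" "dec p = dec q"
      then show "p = q" using leafR[of p] leafR[of q] dec by auto
    qed
    then have "distinct (leaf_list ?R)" using R(1) by (simp add: distinct_map)
    then have "distinct (map f.piece (leaf_list ?R))" using f.inj_piece by (simp only: distinct_map set)
    moreover have "set (map f.piece (leaf_list ?R)) = f.piece ` f.pieces" by (simp only: set_map set)
    ultimately have "contraction_tree (factored_network N Ts g) (factored_tree ?R g)"
      unfolding contraction_tree_def S f.factored_network_eq leaf_list_map[of f.piece] by blast
    moreover have "max_rank (factored_tree ?R g) \<le> nt.bound"
      unfolding max_rank_def
    proof (rule Max.boundedI)
      show "finite ((\<lambda>U. card (free_inds (set (leaf_list U)))) ` subtrees (factored_tree ?R g))"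
        by (intro finite_imageI finite_subtrees)
      show "(\<lambda>U. card (free_inds (set (leaf_list U)))) ` subtrees (factored_tree ?R g) \<noteq> {}"
        using self_subtree[of "factored_tree ?R g"] by blast
      fix k assume "k \<in> (\<lambda>U. card (free_inds (set (leaf_list U)))) ` subtrees (factored_tree ?R g)"
      then obtain U where U: "U \<in> subtrees R"
        "k = card (free_inds (set (leaf_list (map_btree f.piece (map_btree dec U)))))"
        unfolding S subtrees_map by auto
      have sub: "set (leaf_list U) \<subseteq> set (leaf_list R)" by (rule subtrees_leaves[OF U(1)])
      have "dec ` set (leaf_list U) = {(A, v). A \<in> N \<and> v \<in> verts T \<and> (\<mu> A, \<nu> v) \<in> set (leaf_list U)}"
      proof (intro set_eqI iffI)
        fix q assume "q \<in> dec ` set (leaf_list U)"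
        then obtain p where p: "p \<in> set (leaf_list U)" "q = dec p" by blast
        then obtain A v where "p = (\<mu> A, \<nu> v)" "A \<in> N" "v \<in> verts T" using leafR sub by blast
        then show "q \<in> {(A, v). A \<in> N \<and> v \<in> verts T \<and> (\<mu> A, \<nu> v) \<in> set (leaf_list U)}" using p dec by simp
      next
        fix q assume "q \<in> {(A, v). A \<in> N \<and> v \<in> verts T \<and> (\<mu> A, \<nu> v) \<in> set (leaf_list U)}"
        then show "q \<in> dec ` set (leaf_list U)" using dec by (force simp: image_iff)
      qed
      from rank_transfer[OF fac _ this, of] sub R(2)
      have "card (free_inds (f.piece ` dec ` set (leaf_list U))) \<le> nt.rk (set (leaf_list U))"
        unfolding f.piece_def by simp
      then show "k \<le> nt.bound" using U rk[OF U(1)] by (simp add: image_image)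
    qed
    ultimately show ?thesis
      using f.factored_network_ok f.partial_contraction_ok by (simp add: Let_def)
  qed
  ultimately show ?thesis by blast
qed

end

theorem theorem4:
  fixes D :: "'i \<Rightarrow> 'd set"
  assumes "\<And>i. finite (D i)"
    and "\<And>i. infinite {j. card (D j) = card (D i)}"
  shows "\<exists>(P :: prog) (q :: nat poly).
    \<forall>(N :: ('i, 'd) tensor set) (T :: 'i leaf_tree) (w :: nat) \<mu> \<nu> x.
      tensor_network D N \<and> (\<forall>A\<in>N. tree_factorable D A) \<and> card (free_inds N) \<le> 3 \<and>
      branch_decomposition (structure_graph N) T \<and> branch_width (structure_graph N) T = w \<and> w \<ge> 1 \<and>
      instance_code \<mu> \<nu> N T x \<longrightarrow>
      (\<exists>t y Ts R.
        runs P x t y \<and> t \<le> poly q (vsize x) \<and> plan_code \<mu> \<nu> N Ts R y \<and>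
        (\<exists>g. factors_along D N Ts g) \<and>
        (\<forall>g. factors_along D N Ts g \<longrightarrow>
          (let M = factored_network N Ts g; S = factored_tree R g in
             tensor_network D M \<and> contraction_tree M S \<and>
             int (max_rank S) \<le>
               (if w = 1 \<and> (card (free_inds N) = 3 \<or> (\<exists>A\<in>N. card (inds A) \<ge> 3)) then 3
                else \<lceil>4 * real w / 3\<rceil>) \<and>
             partial_contraction D N M)))"
proof -
  obtain P and q :: "nat poly" where
    P: "\<And>x :: (data, data) net \<times> data list \<times> data arc list.
      \<exists>t. runs P (enc x) t (enc (plan x)) \<and> t \<le> poly q (esize x)"
    by (rule ptimeE[OF ptime_plan]) blast
  show ?thesis
  proof (intro exI[of _ P] exI[of _ q] allI impI, elim conjE)
    fix N :: "('i, 'd) tensor set" and T :: "'i leaf_tree" and w :: nat and \<mu> \<nu> x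
    assume N: "tensor_network D N" "\<forall>A\<in>N. tree_factorable D A" "card (free_inds N) \<le> 3"
      and T: "branch_decomposition (structure_graph N) T" "branch_width (structure_graph N) T = w" "w \<ge> 1"
      and code: "instance_code \<mu> \<nu> N T x"
    obtain y z where inj: "inj_on \<mu> N" "inj_on \<nu> (verts T)"
      and y: "network_code \<mu> (\<nu> \<circ> Inl) N y" and z: "graph_code \<nu> T z" and x: "x = Cell y z"
      using code unfolding instance_code_def by blast
    obtain As js where As: "distinct As" "set As = N" "\<forall>A\<in>N. distinct (js A) \<and> set (js A) = inds A"
      and y': "y = list_code (map (\<lambda>A. Cell (\<mu> A) (list_code (map (\<nu> \<circ> Inl) (js A)))) As)"
      using y unfolding network_code_def by blast
    obtain vs es ps where vs: "distinct vs" "set vs = verts T" and es: "distinct es" "set es = edges T"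
      and ps: "map (ends T) es = map (\<lambda>(u, v). {u, v}) ps"
      and z': "z = Cell (list_code (map \<nu> vs)) (list_code (map (\<lambda>(u, v). Cell (\<nu> u) (\<nu> v)) ps))"
      using z unfolding graph_code_def by blast
    interpret coded D N T w \<mu> \<nu> As js vs es ps
      using N(1,3) T inj As vs es ps by unfold_locales simp_all
    \<comment> \<open>The given input code is literally the code of the typed input, so the program
      and its bound apply to \<open>x\<close> itself without any conversion.\<close>
    have enc: "enc (Ns, dvs, des) = x"
    proof -
      have "map (enc :: data \<Rightarrow> data) l = l" for l by (induction l) (simp_all add: enc_data_def)
      moreover have "map enc des = map (\<lambda>(u, v). Cell (\<nu> u) (\<nu> v)) ps"
        by (simp add: des_def enc_data_def case_prod_beta)
      moreover have "map enc Ns = map (\<lambda>A. Cell (\<mu> A) (list_code (map (\<nu> \<circ> Inl) (js A)))) As"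
        using calculation(1) by (simp add: Ns_def enc_data_def enc_list_def comp_def)
      ultimately show ?thesis by (simp add: x y' z' enc_list_def dvs_def enc_data_def comp_def)
    qed
    obtain t where t: "runs P x t (enc (plan (Ns, dvs, des)))" "t \<le> poly q (vsize x)"
      using P[of "(Ns, dvs, des)"] unfolding enc by blast
    obtain Ts R where *: "plan_code \<mu> \<nu> N Ts R (enc (plan (Ns, dvs, des)))" "\<exists>g. factors_along D N Ts g"
      "\<And>g. factors_along D N Ts g \<Longrightarrow>
      (let M = factored_network N Ts g; S = factored_tree R g in
        tensor_network D M \<and> contraction_tree M S \<and> max_rank S \<le> nt.bound \<and> partial_contraction D N M)"
      using plan_works[OF assms] N(2) by blast
    show "\<exists>t y Ts R.
        runs P x t y \<and> t \<le> poly q (vsize x) \<and> plan_code \<mu> \<nu> N Ts R y \<and>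
        (\<exists>g. factors_along D N Ts g) \<and>
        (\<forall>g. factors_along D N Ts g \<longrightarrow>
          (let M = factored_network N Ts g; S = factored_tree R g in
             tensor_network D M \<and> contraction_tree M S \<and>
             int (max_rank S) \<le>
               (if w = 1 \<and> (card (free_inds N) = 3 \<or> (\<exists>A\<in>N. card (inds A) \<ge> 3)) then 3
                else \<lceil>4 * real w / 3\<rceil>) \<and>
             partial_contraction D N M))"
    proof (rule exI[of _ t], rule exI[of _ "enc (plan (Ns, dvs, des))"], rule exI[of _ Ts],
        rule exI[of _ R], intro conjI allI impI)
      fix g assume "factors_along D N Ts g"
      note ** = *(3)[OF this]
      have "int (max_rank (factored_tree R g)) \<le> int nt.bound" using ** by (simp add: Let_def)
      then have "int (max_rank (factored_tree R g)) \<le>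
         (if w = 1 \<and> (card (free_inds N) = 3 \<or> (\<exists>A\<in>N. card (inds A) \<ge> 3)) then 3
                else \<lceil>4 * real w / 3\<rceil>)" using bound_le by (rule order_trans)
      then show "let M = factored_network N Ts g; S = factored_tree R g in
             tensor_network D M \<and> contraction_tree M S \<and>
             int (max_rank S) \<le>
               (if w = 1 \<and> (card (free_inds N) = 3 \<or> (\<exists>A\<in>N. card (inds A) \<ge> 3)) then 3
                else \<lceil>4 * real w / 3\<rceil>) \<and>
             partial_contraction D N M" using ** unfolding Let_def by blast
    qed (rule t *)+
  qed
qed

end
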